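(* Let $s\ge0$ and $U_0\in H^s(\mathbb T^3)$ be an initial datum, with horizontal average $\underline{U_0}=(\underline u_0^h,0,\underline U_0^4)$. Then the solution $\underline U=(\underline u^h,0,\underline U^4)$ of $$\begin{cases}\partial_t\underline u^h(x_3,t)-\nu\partial_3^2\underline u^h(x_3,t)=0,\\ \underline U^4(x_3,t)=\underline U_0^4(x_3),\\ \underline u^h|_{t=0}=\underline u^h_0,\quad\underline U^4|_{t=0}=\underline U^4_0\end{cases}$$ exists globally in time and is unique, with $$\underline u^h\in\mathcal C\left(\mathbb R_+;H^s(\mathbb T^1_v)\right)\cap L^2\left(\mathbb R_+;H^{s+1}(\mathbb T^1_v)\right)\quad\text{and}\quad\underline U^4\in\mathcal C\left(\mathbb R_+;H^s(\mathbb T^1_v)\right).$$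
   Context: Fix $a_1,a_2,a_3>0$ and $\nu>0$. $\mathbb T^3=\prod_{i=1}^3\mathbb R/(2\pi a_i\mathbb Z)$; $\mathbb T^2_h$ and $\mathbb T^1_v$ are the tori in $x_h=(x_1,x_2)$ and in $x_3$. All initial data are four-component fields $U_0=(u_0,U_0^4)$ with zero mean over $\mathbb T^3$ and $\operatorname{div}u_0=0$ where $u_0=(U_0^1,U_0^2,U_0^3)$. The horizontal average is $\underline A(x_3)=\frac1{4\pi^2a_1a_2}\int_{\mathbb T^2_h}A(y_h,x_3)\,dy_h$; because of the divergence-free and zero-mean conditions its third component vanishes. The superscript $h$ denotes the first two components. *)

theory Defs
  imports "HOL-Analysis.Analysis"
begin

text \<open>
  The torus $\prod_b \mathbf{R}/(2\pi a_b\mathbf{Z})$ is described by the vector \<open>a\<close> of its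
  positive scale factors in an arbitrary Euclidean space. A function on the torus is a
  periodic function on the whole space, and integrals over the torus are integrals over one
  period cell. Elements of the function spaces below are representatives: as functions on the
  torus they are to be identified when they agree almost everywhere. Three-dimensional space is
  \<open>(real \<times> real) \<times> real\<close>, a point being \<open>(x\<^sub>h, x\<^sub>3)\<close> with \<open>x\<^sub>h = (x\<^sub>1, x\<^sub>2)\<close>.
\<close>

definition torus_periodic :: "'a::euclidean_space \<Rightarrow> ('a \<Rightarrow> 'b) \<Rightarrow> bool" where
  "torus_periodic a f \<longleftrightarrow> (\<forall>x. \<forall>b\<in>Basis. f (x + (2 * pi * (a \<bullet> b)) *\<^sub>R b) = f x)"

definition torus_cell :: "'a::euclidean_space \<Rightarrow> 'a set" where
  "torus_cell a = cbox 0 ((2 * pi) *\<^sub>R a)"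

text \<open>The frequencies $\check n = (n_b/a_b)_b$ with integers $n_b$.\<close>

definition torus_freqs :: "'a::euclidean_space \<Rightarrow> 'a set" where
  "torus_freqs a = {\<xi>. \<forall>b\<in>Basis. (\<xi> \<bullet> b) * (a \<bullet> b) \<in> \<int>}"

definition fourier_coeff :: "'a::euclidean_space \<Rightarrow> ('a \<Rightarrow> real) \<Rightarrow> 'a \<Rightarrow> complex" where
  "fourier_coeff a f \<xi> =
     (LINT x:torus_cell a|lebesgue. of_real (f x) * cis (- (\<xi> \<bullet> x)))
       / of_real (measure lebesgue (torus_cell a))"

text \<open>The squared norm
  $\|f\|_{H^s}^2 = \sum_{\check n} (1 + |\check n|^2)^s\, |\hat f_n|^2 \in [0,\infty]$.\<close>

definition Hs_norm_sq :: "'a::euclidean_space \<Rightarrow> real \<Rightarrow> ('a \<Rightarrow> real) \<Rightarrow> ennreal" where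
  "Hs_norm_sq a s f =
     (\<integral>\<^sup>+ \<xi>. ennreal ((1 + (norm \<xi>)\<^sup>2) powr s * (norm (fourier_coeff a f \<xi>))\<^sup>2)
        \<partial>count_space (torus_freqs a))"

definition torus_L2 :: "'a::euclidean_space \<Rightarrow> ('a \<Rightarrow> real) set" where
  "torus_L2 a = {f. torus_periodic a f \<and> f \<in> borel_measurable lebesgue \<and>
     set_integrable lebesgue (torus_cell a) (\<lambda>x. (f x)\<^sup>2)}"

text \<open>This describes the Sobolev space $H^s$ of real-valued functions for \<open>s \<ge> 0\<close> only; for
  negative \<open>s\<close> the elements of $H^s$ need not be functions.\<close>

definition Hs :: "'a::euclidean_space \<Rightarrow> real \<Rightarrow> ('a \<Rightarrow> real) set" where
  "Hs a s = {f \<in> torus_L2 a. Hs_norm_sq a s f < \<infinity>}"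

text \<open>$\mathcal C(\mathbf{R}_+; H^s)$ and $L^2(\mathbf{R}_+; H^s)$, where
  $\mathbf{R}_+ = [0,\infty)$. The latter is the Bochner space: strong measurability means being
  the limit, for almost every time, of simple functions with values in $H^s$.\<close>

definition C_Hs :: "'a::euclidean_space \<Rightarrow> real \<Rightarrow> (real \<Rightarrow> 'a \<Rightarrow> real) set" where
  "C_Hs a s = {u. \<forall>t\<ge>0. u t \<in> Hs a s \<and>
     ((\<lambda>r. Hs_norm_sq a s (\<lambda>x. u r x - u t x)) \<longlongrightarrow> 0) (at t within {0..})}"

definition L2_Hs :: "'a::euclidean_space \<Rightarrow> real \<Rightarrow> (real \<Rightarrow> 'a \<Rightarrow> real) set" where
  "L2_Hs a s = {u.
     (\<exists>\<sigma>. (\<forall>n::nat. simple_function (lebesgue_on {0..}) (\<sigma> n) \<and> (\<forall>t\<ge>0. \<sigma> n t \<in> Hs a s)) \<and>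
        (AE t in lebesgue_on {0..}. u t \<in> Hs a s \<and>
           (\<lambda>n. Hs_norm_sq a s (\<lambda>x. \<sigma> n t x - u t x)) \<longlonglongrightarrow> 0)) \<and>
     (\<integral>\<^sup>+ t. Hs_norm_sq a s (u t) \<partial>lebesgue_on {0..}) < \<infinity>}"

primrec C_k :: "nat \<Rightarrow> ('a::euclidean_space \<Rightarrow> real) \<Rightarrow> bool" where
  "C_k 0 f \<longleftrightarrow> continuous_on UNIV f"
| "C_k (Suc k) f \<longleftrightarrow>
     (\<exists>g. (\<forall>x. (f has_derivative (\<lambda>h. g x \<bullet> h)) (at x)) \<and> (\<forall>b\<in>Basis. C_k k (\<lambda>x. g x \<bullet> b)))"

definition C_infinity :: "('a::euclidean_space \<Rightarrow> real) \<Rightarrow> bool" where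
  "C_infinity f \<longleftrightarrow> (\<forall>k. C_k k f)"

text \<open>\<open>div v = 0\<close> in the sense of distributions: the integrand is $v\cdot\nabla\phi$.\<close>

definition divergence_free :: "'a::euclidean_space \<Rightarrow> ('a \<Rightarrow> 'a) \<Rightarrow> bool" where
  "divergence_free a v \<longleftrightarrow>
     (\<forall>\<phi>. C_infinity \<phi> \<and> torus_periodic a \<phi> \<longrightarrow>
        (LINT x:torus_cell a|lebesgue. frechet_derivative \<phi> (at x) (v x)) = 0)"

definition horizontal_average ::
  "real \<Rightarrow> real \<Rightarrow> ((real \<times> real) \<times> real \<Rightarrow> real ^ 4) \<Rightarrow> real \<Rightarrow> real ^ 4" where
  "horizontal_average a1 a2 A x3 =
     (1 / (4 * pi\<^sup>2 * a1 * a2)) *\<^sub>R (LINT y:torus_cell (a1, a2)|lebesgue. A (y, x3))"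

text \<open>Weak (distributional) solutions of $\partial_t u - \nu\,\partial_x^2 u = 0$ on
  $[0,\infty)$ times the one-dimensional torus with initial value \<open>u 0\<close>, tested against smooth
  functions of time and space. The time integral makes sense for $u \in \mathcal C(\mathbf{R}_+; L^2)$, and
  this is the only case in which the notion is used.\<close>

definition weak_heat_solution :: "real \<Rightarrow> real \<Rightarrow> (real \<Rightarrow> real \<Rightarrow> real) \<Rightarrow> bool" where
  "weak_heat_solution a \<nu> u \<longleftrightarrow>
     (\<forall>\<Psi> :: real \<times> real \<Rightarrow> real.
        C_infinity \<Psi> \<and> (\<forall>t. torus_periodic a (\<lambda>x. \<Psi> (t, x))) \<longrightarrow>
        (\<forall>t\<ge>0. (LINT x:torus_cell a|lebesgue. u t x * \<Psi> (t, x)) =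
            (LINT x:torus_cell a|lebesgue. u 0 x * \<Psi> (0, x)) +
            (LINT r:{0..t}|lebesgue. LINT x:torus_cell a|lebesgue.
               u r x * (deriv (\<lambda>r. \<Psi> (r, x)) r + \<nu> * (deriv ^^ 2) (\<lambda>y. \<Psi> (r, y)) x))))"

text \<open>The limit system for $\underline U = (\underline u^h, 0, \underline U^4)$ on
  $\mathbf{R}_+$ with initial datum \<open>W\<close>. The only regularity imposed on $\underline u^h$ is
  $\mathcal C(\mathbf{R}_+; L^2)$, where $L^2 = H^0$, so that uniqueness of solutions in this sense contains uniqueness
  among the solutions with any higher Sobolev regularity.\<close>

definition averaged_system_solution ::
  "real \<Rightarrow> real \<Rightarrow> (real \<Rightarrow> real ^ 4) \<Rightarrow> (real \<Rightarrow> real \<Rightarrow> real ^ 4) \<Rightarrow> bool" where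
  "averaged_system_solution a3 \<nu> W U \<longleftrightarrow>
     (\<forall>i\<in>{1, 2}. (\<lambda>t x3. U t x3 $ i) \<in> C_Hs a3 0 \<and>
        weak_heat_solution a3 \<nu> (\<lambda>t x3. U t x3 $ i) \<and>
        (AE x3 in lebesgue. U 0 x3 $ i = W x3 $ i)) \<and>
     (\<forall>t\<ge>0. AE x3 in lebesgue. U t x3 $ 3 = 0) \<and>
     (\<forall>t\<ge>0. AE x3 in lebesgue. U t x3 $ 4 = W x3 $ 4)"

end

theory Submission
  imports Defs
begin

text \<open>
On the one-dimensional torus the heat equation is diagonal in Fourier modes. A datum \<open>w\<close> with
coefficients \<open>c \<xi>\<close> has the flow \<open>heat_flow\<close> whose coefficients at time \<open>t\<close> are
\<open>exp (- \<nu> \<xi>\<^sup>2 t) * c \<xi>\<close>. For \<open>t > 0\<close> these are absolutely summable, because the \<open>c \<xi>\<close> are bounded,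
so the flow is an honest continuous function given by a uniformly convergent series; at
\<open>t = 0\<close> it is the datum itself. Hence no function has to be constructed from merely
square-summable coefficients.

All Sobolev statements then concern sums over the frequencies. Continuity in \<open>H\<^sup>s\<close> is
dominated convergence. Square integrability in time with values in \<open>H\<^sup>s\<^sup>+\<^sup>1\<close> holds because
\<open>exp (- 2 \<nu> \<xi>\<^sup>2 t)\<close> has integral \<open>1 / (2 \<nu> \<xi>\<^sup>2)\<close>, which pays for the extra factor
\<open>1 + \<xi>\<^sup>2\<close> at every nonzero frequency; the frequency zero is absent since the datum has mean
zero. Strong measurability follows from continuity at positive times, by rounding the time to
a dyadic number.

For the weak formulation with a smooth test function \<open>\<Psi>\<close>, integrating against \<open>\<Psi>\<close> becomes a
sum over modes (\<open>integral_mult_twice_differentiable\<close>). Each summand satisfies the identity by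
the fundamental theorem of calculus, and the sum may be exchanged with the time integral
because the coefficients of a function with two continuous derivatives decay like
\<open>1 / (1 + \<xi>\<^sup>2)\<close>. For uniqueness, the test functions \<open>exp (\<nu> \<xi>\<^sup>2 t) cos (\<xi> x)\<close> and
\<open>exp (\<nu> \<xi>\<^sup>2 t) sin (\<xi> x)\<close> solve the backward equation, so that the time integral drops out
and the coefficients of any weak solution are those of the flow
(\<open>weak_heat_solution_fourier_coeff\<close>).

What turns equality of coefficients into equality almost everywhere is
\<open>fourier_coeff_zero_imp_AE_zero\<close>: an integrable function on the circle orthogonal to all modes
is orthogonal to all continuous functions by the Weierstrass theorem, hence has integral zero
over all compact sets. It also shows that a \<open>C\<^sup>2\<close> function is the sum of its Fourier series, and
that the third component of the average vanishes: testing the divergence condition with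
\<open>cos (\<xi> x\<^sub>3)\<close> and \<open>sin (\<xi> x\<^sub>3)\<close> kills its coefficients for \<open>\<xi> \<noteq> 0\<close>, the zero mean the remaining one.

Finally, by Fubini, the coefficient of the average at \<open>\<xi>\<close> is the coefficient of the datum at
\<open>(0, 0, \<xi>)\<close> (\<open>fourier_coeff_average\<close>), so the average inherits \<open>H\<^sup>s\<close> and the zero mean.
\<close>

section \<open>Lebesgue integration\<close>

lemma set_integrable_continuous_Icc:
  fixes f :: "real \<Rightarrow> 'b::euclidean_space"
  assumes "continuous_on {a..b} f"
  shows "set_integrable lebesgue {a..b} f"
  using absolutely_integrable_continuous[of a b f] assms by (simp add: cbox_interval)

lemma set_integral_FTC:
  fixes F :: "real \<Rightarrow> 'b::euclidean_space"
  assumes "a \<le> b" "continuous_on {a..b} f"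
    and "\<And>x. a \<le> x \<Longrightarrow> x \<le> b \<Longrightarrow> (F has_vector_derivative f x) (at x within {a..b})"
  shows "(LINT x:{a..b}|lebesgue. f x) = F b - F a"
proof -
  have "(f has_integral (F b - F a)) {a..b}"
    using assms by (intro fundamental_theorem_of_calculus) auto
  then show ?thesis
    using set_lebesgue_integral_eq_integral(2)[OF set_integrable_continuous_Icc[OF assms(2)]]
    by (simp add: integral_unique)
qed

lemma set_integrable_of_real:
  "set_integrable M A f \<Longrightarrow> set_integrable M A (\<lambda>x. of_real (f x) :: 'b::{real_normed_algebra_1,banach,second_countable_topology})"
  using integrable_of_real[where 'a='b, of M "\<lambda>x. indicat_real A x *\<^sub>R f x"]
  by (simp add: set_integrable_def scaleR_conv_of_real)

lemma set_integrable_mult_bounded: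
  fixes w :: "'a \<Rightarrow> 'b::{real_normed_algebra,second_countable_topology,banach}"
  assumes w: "set_integrable M A w" and g: "g \<in> borel_measurable M" "\<And>x. norm (g x) \<le> B"
  shows "set_integrable M A (\<lambda>x. w x * g x)"
proof -
  have i: "integrable M (\<lambda>x. indicat_real A x *\<^sub>R w x)" using w by (simp add: set_integrable_def)
  then have [measurable]: "(\<lambda>x. indicat_real A x *\<^sub>R w x) \<in> borel_measurable M" by simp
  note g(1)[measurable]
  have "integrable M (\<lambda>x. (indicat_real A x *\<^sub>R w x) * g x)"
  proof (rule Bochner_Integration.integrable_bound[where f="\<lambda>x. B * norm (indicat_real A x *\<^sub>R w x)"])
    show "AE x in M. norm (indicat_real A x *\<^sub>R w x * g x) \<le> norm (B * norm (indicat_real A x *\<^sub>R w x))"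
    proof (intro AE_I2)
      fix x
      have "norm (indicat_real A x *\<^sub>R w x * g x) \<le> norm (indicat_real A x *\<^sub>R w x) * norm (g x)"
        by (rule norm_mult_ineq)
      also have "\<dots> \<le> norm (indicat_real A x *\<^sub>R w x) * B" by (intro mult_left_mono g) auto
      also have "\<dots> \<le> norm (B * norm (indicat_real A x *\<^sub>R w x))" by (simp add: mult.commute)
      finally show "norm (indicat_real A x *\<^sub>R w x * g x) \<le> norm (B * norm (indicat_real A x *\<^sub>R w x))" .
    qed
    show "(\<lambda>x. (indicat_real A x *\<^sub>R w x) * g x) \<in> borel_measurable M" by measurable
    show "integrable M (\<lambda>x. B * norm (indicat_real A x *\<^sub>R w x))"
      using i by (intro integrable_mult_right integrable_norm)
  qed
  then show ?thesis by (simp add: set_integrable_def)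
qed

text \<open>
The weight \<open>h\<close> serves two uses: for the modes in space it is the modulus of the function that they are
tested against, for the modes in time it is constant.
\<close>

lemma set_integral_sums_dominated:
  fixes f :: "nat \<Rightarrow> 'a \<Rightarrow> 'b::{banach,second_countable_topology}"
  assumes f: "\<And>n. set_integrable M A (f n)" and h: "set_integrable M A h"
    and le: "\<And>n x. x \<in> A \<Longrightarrow> norm (f n x) \<le> b n * h x" and b: "summable b"
  shows "(\<lambda>n. LINT x:A|M. f n x) sums (LINT x:A|M. (\<Sum>n. f n x))"
    and "set_integrable M A (\<lambda>x. \<Sum>n. f n x)"
proof -
  have s: "summable (\<lambda>n. norm (f n x))" if "x \<in> A" for x
    using summable_comparison_test'[of "\<lambda>n. b n * h x" 0 "\<lambda>n. norm (f n x)"] le[OF that] b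
    by (auto intro: summable_mult2)
  have i: "integrable M (\<lambda>x. indicat_real A x *\<^sub>R f n x)" for n
    using f by (simp add: set_integrable_def)
  have ae: "AE x in M. summable (\<lambda>n. norm (indicat_real A x *\<^sub>R f n x))"
    by (intro AE_I2) (auto simp: indicator_def s)
  have le': "norm (\<integral>x. norm (indicat_real A x *\<^sub>R f n x) \<partial>M) \<le> b n * (LINT x:A|M. h x)" for n
  proof -
    have "(\<integral>x. norm (indicat_real A x *\<^sub>R f n x) \<partial>M) \<le> (\<integral>x. b n * (indicat_real A x *\<^sub>R h x) \<partial>M)"
      using h le by (intro integral_mono integrable_norm i integrable_mult_right)
         (auto simp: set_integrable_def indicator_def)
    then show ?thesis by (simp add: set_lebesgue_integral_def)
  qed
  have sm: "summable (\<lambda>n. \<integral>x. norm (indicat_real A x *\<^sub>R f n x) \<partial>M)"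
    by (rule summable_comparison_test'[OF summable_mult2[OF b]]) (rule le')
  have eq: "(\<Sum>n. indicat_real A x *\<^sub>R f n x) = indicat_real A x *\<^sub>R (\<Sum>n. f n x)" for x
    by (cases "x \<in> A") auto
  show "(\<lambda>n. LINT x:A|M. f n x) sums (LINT x:A|M. (\<Sum>n. f n x))"
    using sums_integral[OF i ae sm] unfolding eq set_lebesgue_integral_def .
  show "set_integrable M A (\<lambda>x. \<Sum>n. f n x)"
    using integrable_suminf[OF i ae sm] unfolding eq set_integrable_def .
qed

text \<open>
The Cauchy--Schwarz inequality against the constant function, read off from the nonnegativity of
the variance around the mean value \<open>m\<close>.
\<close>

lemma set_integral_power2_le:
  fixes f :: "'a \<Rightarrow> real"
  assumes f: "set_integrable M A f" "set_integrable M A (\<lambda>x. (f x)\<^sup>2)"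
    and A: "A \<in> sets M" "emeasure M A < \<infinity>" "measure M A > 0"
  shows "(LINT x:A|M. f x)\<^sup>2 \<le> measure M A * (LINT x:A|M. (f x)\<^sup>2)"
proof -
  define I where "I = (LINT x:A|M. f x)"
  define m where "m = I / measure M A"
  have c: "set_integrable M A (\<lambda>x. c)" for c :: real using A by (simp add: set_integrable_def)
  have eq: "(f x - m)\<^sup>2 = (f x)\<^sup>2 + ((- 2 * m) * f x + m\<^sup>2)" for x by (simp add: power2_eq_square algebra_simps)
  have i: "set_integrable M A (\<lambda>x. (- 2 * m) * f x)" by (intro set_integrable_mult_right impI f)
  have "0 \<le> (LINT x:A|M. (f x - m)\<^sup>2)"
    unfolding set_lebesgue_integral_def by (intro integral_nonneg_AE AE_I2) auto
  also have "\<dots> = (LINT x:A|M. (f x)\<^sup>2) + ((- 2 * m) * I + (LINT x:A|M. m\<^sup>2))"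
    unfolding eq I_def
    by (simp only: set_integral_add(2)[OF f(2) set_integral_add(1)[OF i c]] set_integral_add(2)[OF i c] set_integral_mult_right)
  also have "(LINT x:A|M. m\<^sup>2) = m\<^sup>2 * measure M A" using A by (simp add: set_lebesgue_integral_def)
  finally show ?thesis
    using A unfolding I_def[symmetric] m_def
    by (simp add: power2_eq_square field_simps)
qed

lemma integrable_vec:
  fixes f :: "'a \<Rightarrow> real ^ 'n"
  assumes "\<And>i. integrable M (\<lambda>x. f x $ i)"
  shows "integrable M f"
proof -
  have "integrable M (\<lambda>x. \<Sum>i\<in>UNIV. (f x $ i) *\<^sub>R axis i (1::real))"
    by (intro Bochner_Integration.integrable_sum integrable_scaleR_left) (rule assms)
  moreover have "(\<Sum>i\<in>UNIV. (f x $ i) *\<^sub>R axis i (1::real)) = f x" for x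
    by (simp add: vec_eq_iff axis_def if_distrib[of "\<lambda>u. _ * u"] cong: if_cong)
  ultimately show ?thesis by simp
qed

lemma set_integral_vec_nth:
  fixes f :: "'a \<Rightarrow> real ^ 'n"
  assumes "\<And>i. set_integrable M A (\<lambda>x. f x $ i)"
  shows "(LINT x:A|M. f x) $ i = (LINT x:A|M. f x $ i)"
proof -
  have "integrable M (\<lambda>x. indicat_real A x *\<^sub>R f x)"
    using assms by (intro integrable_vec) (simp add: set_integrable_def)
  from integral_bounded_linear[OF bounded_linear_vec_nth this, of i] show ?thesis
    by (simp add: set_lebesgue_integral_def)
qed

lemma continuous_imp_lebesgue_measurable:
  "continuous_on UNIV (f::'a::euclidean_space \<Rightarrow> 'b::euclidean_space) \<Longrightarrow> f \<in> borel_measurable lebesgue"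
  by (intro measurable_completion) (simp add: borel_measurable_continuous_onI)

lemma AE_lebesgue_iff_negligible:
  "(AE x in lebesgue. P x) \<longleftrightarrow> negligible {x. \<not> P (x :: 'a::euclidean_space)}"
proof
  assume "AE x in lebesgue. P x"
  then obtain N where "N \<in> null_sets lebesgue" "{x. \<not> P x} \<subseteq> N"
    by (auto simp: eventually_ae_filter)
  then show "negligible {x. \<not> P x}"
    using negligible_iff_null_sets negligible_subset by blast
next
  assume "negligible {x. \<not> P x}"
  then have "{x. \<not> P x} \<in> null_sets lebesgue" by (simp add: negligible_iff_null_sets)
  from AE_not_in[OF this] show "AE x in lebesgue. P x" by simp
qed

text \<open>
Fubini's theorem for the completed measure. A Lebesgue measurable function has sections that are
measurable only for almost every parameter, so everything is transferred from a Borel function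
that agrees with it almost everywhere.
\<close>

lemma
  fixes f :: "'a::euclidean_space \<times> 'b::euclidean_space \<Rightarrow> real"
  assumes f: "integrable lebesgue f"
  shows AE_integrable_section: "AE x in lebesgue. integrable lebesgue (\<lambda>y. f (y, x))"
    and integrable_lebesgue_snd: "integrable lebesgue (\<lambda>x. \<integral>y. f (y, x) \<partial>lebesgue)"
    and integral_lebesgue_snd: "(\<integral>x. (\<integral>y. f (y, x) \<partial>lebesgue) \<partial>lebesgue) = integral\<^sup>L lebesgue f"
proof -
  obtain g where g: "g \<in> borel_measurable lborel" and fg: "AE z in lborel. f z = g z"
    using completion_ex_borel_measurable_real[OF borel_measurable_integrable[OF f]] by blast
  have fg': "AE z in lebesgue. f z = g z" using fg by (rule AE_completion)
  have g_leb: "g \<in> borel_measurable lebesgue" using g by (rule measurable_completion)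
  have "integrable lebesgue g"
    by (rule integrable_cong_AE_imp[OF f g_leb]) (use fg' in \<open>auto elim: eventually_mono\<close>)
  then have "integrable (lborel \<Otimes>\<^sub>M lborel) g"
    using g by (simp add: integrable_completion lborel_prod)
  then have gi: "integrable (lborel \<Otimes>\<^sub>M lborel) (case_prod (\<lambda>y x. g (y, x)))" by simp
  obtain N where N: "N \<in> null_sets (lborel \<Otimes>\<^sub>M lborel)" "{z. f z \<noteq> g z} \<subseteq> N"
    using fg unfolding lborel_prod[symmetric] by (auto simp: eventually_ae_filter space_pair_measure)
  \<comment> \<open>exchanging the order of the two quantifiers needs a measurable exceptional set, hence \<open>N\<close> instead of \<open>{z. f z \<noteq> g z}\<close>\<close>
  have "AE z in lborel \<Otimes>\<^sub>M lborel. z \<notin> N" using N(1) by (rule AE_not_in)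
  then have "AE z in lborel \<Otimes>\<^sub>M lborel. (\<lambda>y x. (y, x) \<notin> N) (fst z) (snd z)" by simp
  from lborel_pair.AE_pair[OF this] have "AE y in lborel. AE x in lborel. (y, x) \<notin> N" by simp
  moreover have "{z \<in> space (lborel \<Otimes>\<^sub>M lborel). (fst z, snd z) \<notin> N} \<in> sets (lborel \<Otimes>\<^sub>M lborel)"
  proof -
    have "{z \<in> space (lborel \<Otimes>\<^sub>M lborel). (fst z, snd z) \<notin> N} = space (lborel \<Otimes>\<^sub>M lborel) - N" by auto
    then show ?thesis using sets.Diff[OF sets.top null_setsD2[OF N(1)]] by (simp only:)
  qed
  ultimately have "AE x in lborel. AE y in lborel. (y, x) \<notin> N"
    using lborel_pair.AE_commute[of "\<lambda>y x. (y, x) \<notin> N"] by blast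
  then have sec: "AE x in lborel. AE y in lebesgue. f (y, x) = g (y, x)"
    by eventually_elim (rule AE_completion, use N(2) in \<open>auto elim: eventually_mono\<close>)
  have gsec: "(\<lambda>y. g (y, x)) \<in> borel_measurable lborel" for x
    using g unfolding lborel_prod[symmetric] by measurable
  have fsec: "(\<lambda>y. f (y, x)) \<in> borel_measurable lebesgue" if "AE y in lebesgue. f (y, x) = g (y, x)" for x
    using that by (intro borel_measurable_AE[OF measurable_completion[OF gsec[of x]]]) (auto elim: eventually_mono)
  have "AE x in lborel. integrable lebesgue (\<lambda>y. f (y, x))"
    using sec lborel_pair.AE_integrable_snd[OF gi]
  proof eventually_elim
    case (elim x)
    then have "integrable lebesgue (\<lambda>y. g (y, x))"
      by (subst integrable_completion[OF gsec])
    then show ?case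
      by (rule integrable_cong_AE_imp[OF _ fsec[OF elim(1)]]) (use elim(1) in \<open>auto elim: eventually_mono\<close>)
  qed
  then show "AE x in lebesgue. integrable lebesgue (\<lambda>y. f (y, x))" by (rule AE_completion)
  have "AE x in lborel. (\<integral>y. f (y, x) \<partial>lebesgue) = (\<integral>y. g (y, x) \<partial>lborel)"
    using sec
  proof eventually_elim
    case (elim x)
    have "(\<integral>y. f (y, x) \<partial>lebesgue) = (\<integral>y. g (y, x) \<partial>lebesgue)"
      by (rule integral_cong_AE[OF fsec[OF elim] measurable_completion[OF gsec] elim])
    then show ?case by (simp add: integral_completion[OF gsec])
  qed
  then have int_eq: "AE x in lebesgue. (\<integral>y. g (y, x) \<partial>lborel) = (\<integral>y. f (y, x) \<partial>lebesgue)"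
    by (intro AE_completion) (auto elim: eventually_mono)
  note gint = lborel_pair.integrable_snd[OF gi]
  have gint_leb: "integrable lebesgue (\<lambda>x. \<integral>y. g (y, x) \<partial>lborel)"
    using gint by (subst integrable_completion) auto
  have fint: "(\<lambda>x. \<integral>y. f (y, x) \<partial>lebesgue) \<in> borel_measurable lebesgue"
    by (rule borel_measurable_AE[OF borel_measurable_integrable[OF gint_leb] int_eq])
  show "integrable lebesgue (\<lambda>x. \<integral>y. f (y, x) \<partial>lebesgue)"
    by (rule integrable_cong_AE_imp[OF gint_leb fint int_eq])
  have "(\<integral>x. (\<integral>y. f (y, x) \<partial>lebesgue) \<partial>lebesgue) = (\<integral>x. (\<integral>y. g (y, x) \<partial>lborel) \<partial>lebesgue)"
    by (intro integral_cong_AE fint borel_measurable_integrable[OF gint_leb]) (use int_eq in \<open>auto elim: eventually_mono\<close>)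
  also have "\<dots> = (\<integral>x. (\<integral>y. g (y, x) \<partial>lborel) \<partial>lborel)"
    using gint by (subst integral_completion) auto
  also have "\<dots> = integral\<^sup>L lborel g"
    using lborel_pair.integral_snd[OF gi] by (simp add: lborel_prod)
  also have "\<dots> = integral\<^sup>L lebesgue g" using g by (simp add: integral_completion)
  also have "\<dots> = integral\<^sup>L lebesgue f"
    by (intro integral_cong_AE g_leb borel_measurable_integrable[OF f]) (use fg' in \<open>auto elim: eventually_mono\<close>)
  finally show "(\<integral>x. (\<integral>y. f (y, x) \<partial>lebesgue) \<partial>lebesgue) = integral\<^sup>L lebesgue f" .
qed

lemma
  fixes f :: "'a::euclidean_space \<times> 'b::euclidean_space \<Rightarrow> real"
  assumes f: "set_integrable lebesgue (A \<times> C) f"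
  shows AE_set_integrable_section: "AE x in lebesgue. x \<in> C \<longrightarrow> set_integrable lebesgue A (\<lambda>y. f (y, x))"
    and set_integrable_lebesgue_snd: "set_integrable lebesgue C (\<lambda>x. LINT y:A|lebesgue. f (y, x))"
    and set_integral_lebesgue_snd: "(LINT x:C|lebesgue. LINT y:A|lebesgue. f (y, x)) = (LINT z:A \<times> C|lebesgue. f z)"
proof -
  have f': "integrable lebesgue (\<lambda>z. indicat_real (A \<times> C) z *\<^sub>R f z)" using f by (simp add: set_integrable_def)
  have eq: "indicat_real (A \<times> C) (y, x) *\<^sub>R f (y, x) = indicat_real C x *\<^sub>R (indicat_real A y *\<^sub>R f (y, x))" for x y
    by (auto simp: indicator_def)
  have eq2: "(\<integral>y. indicat_real (A \<times> C) (y, x) *\<^sub>R f (y, x) \<partial>lebesgue) = indicat_real C x *\<^sub>R (LINT y:A|lebesgue. f (y, x))" for x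
    unfolding eq set_lebesgue_integral_def by (rule integral_scaleR_right)
  show "AE x in lebesgue. x \<in> C \<longrightarrow> set_integrable lebesgue A (\<lambda>y. f (y, x))"
    using AE_integrable_section[OF f'] unfolding eq
    by eventually_elim (auto simp: set_integrable_def)
  show "set_integrable lebesgue C (\<lambda>x. LINT y:A|lebesgue. f (y, x))"
    using integrable_lebesgue_snd[OF f'] unfolding eq2 by (simp add: set_integrable_def)
  show "(LINT x:C|lebesgue. LINT y:A|lebesgue. f (y, x)) = (LINT z:A \<times> C|lebesgue. f z)"
    using integral_lebesgue_snd[OF f'] unfolding eq2 by (simp add: set_lebesgue_integral_def)
qed

section \<open>Periodic functions and the period cell\<close>

lemma torus_cell_real: "torus_cell (a::real) = {0..2 * pi * a}"
  by (simp add: torus_cell_def cbox_interval)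

lemma sets_lebesgue_torus_cell [measurable, simp]: "torus_cell a \<in> sets lebesgue"
  by (simp add: torus_cell_def)

lemma measure_torus_cell_real: "a > 0 \<Longrightarrow> measure lebesgue (torus_cell a) = 2 * pi * (a::real)"
  by (simp add: torus_cell_real)

lemma torus_cell_Pair: "torus_cell (a, b) = torus_cell a \<times> torus_cell b"
  by (simp add: torus_cell_def cbox_Pair_eq zero_prod_def)

lemma torus_freqs_Pair: "(\<xi>, \<eta>) \<in> torus_freqs (a, b) \<longleftrightarrow> \<xi> \<in> torus_freqs a \<and> \<eta> \<in> torus_freqs b"
  by (simp add: torus_freqs_def Basis_prod_def ball_Un)

lemma measure_torus_cell_Pair:
  "measure lebesgue (torus_cell (a, b)) = measure lebesgue (torus_cell a) * measure lebesgue (torus_cell b)"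
  by (simp add: torus_cell_def zero_prod_def content_Pair measure_completion)

lemma torus_periodic_real_iff: "torus_periodic (a::real) f \<longleftrightarrow> (\<forall>x. f (x + 2 * pi * a) = f x)"
  by (simp add: torus_periodic_def mult.assoc)

lemma torus_periodic_Pair:
  assumes "torus_periodic (a, b) f"
  shows "torus_periodic b (\<lambda>x. f (y, x))"
proof -
  have "f ((y, x) + (2 * pi * ((a, b) \<bullet> (0, c))) *\<^sub>R (0, c)) = f (y, x)" if "c \<in> Basis" for x c
    using assms that unfolding torus_periodic_def Basis_prod_def by blast
  then show ?thesis by (simp add: torus_periodic_def)
qed

lemma torus_freqs_uminus: "\<xi> \<in> torus_freqs (a::real) \<Longrightarrow> - \<xi> \<in> torus_freqs a"
  by (auto simp: torus_freqs_def)

lemma torus_freqs_diff: "\<xi> \<in> torus_freqs (a::real) \<Longrightarrow> \<eta> \<in> torus_freqs a \<Longrightarrow> \<xi> - \<eta> \<in> torus_freqs a"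
  by (auto simp: torus_freqs_def left_diff_distrib)

lemma torus_freqs_add: "\<xi> \<in> torus_freqs (a::real) \<Longrightarrow> \<eta> \<in> torus_freqs a \<Longrightarrow> \<xi> + \<eta> \<in> torus_freqs a"
  by (auto simp: torus_freqs_def distrib_right)

lemma torus_periodic_trig:
  fixes a q :: "'a::euclidean_space"
  assumes "q \<in> torus_freqs a"
  shows "torus_periodic a (\<lambda>x. \<alpha> * cos (q \<bullet> x) + \<beta> * sin (q \<bullet> x))"
  unfolding torus_periodic_def
proof (intro allI ballI)
  fix x b :: 'a assume "b \<in> Basis"
  then obtain k where k: "(q \<bullet> b) * (a \<bullet> b) = of_int k" using assms by (auto simp: torus_freqs_def Ints_def)
  have "q \<bullet> (x + (2 * pi * (a \<bullet> b)) *\<^sub>R b) = q \<bullet> x + 2 * pi * of_int k"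
    unfolding k[symmetric] by (simp add: inner_add_right)
  moreover have "cis (q \<bullet> x + 2 * pi * of_int k) = cis (q \<bullet> x)"
    by (simp add: cis_multiple_2pi flip: cis_mult)
  ultimately show "\<alpha> * cos (q \<bullet> (x + (2 * pi * (a \<bullet> b)) *\<^sub>R b)) + \<beta> * sin (q \<bullet> (x + (2 * pi * (a \<bullet> b)) *\<^sub>R b)) =
      \<alpha> * cos (q \<bullet> x) + \<beta> * sin (q \<bullet> x)"
    by (simp only: complex_eq_iff cis.sel)
qed

lemma torus_L2_integrable:
  fixes a :: "'a::euclidean_space"
  assumes "f \<in> torus_L2 a"
  shows "set_integrable lebesgue (torus_cell a) f"
proof -
  have m: "f \<in> borel_measurable lebesgue" and i: "set_integrable lebesgue (torus_cell a) (\<lambda>x. (f x)\<^sup>2)"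
    using assms by (auto simp: torus_L2_def)
  have one: "set_integrable lebesgue (torus_cell a) (\<lambda>x. 1 :: real)"
    unfolding torus_cell_def by (intro absolutely_integrable_continuous continuous_intros)
  have s: "set_integrable lebesgue (torus_cell a) (\<lambda>x. 1 + (f x)\<^sup>2)"
    by (rule set_integral_add(1)[OF one i])
  show ?thesis
    unfolding set_integrable_def
  proof (rule Bochner_Integration.integrable_bound)
    show "integrable lebesgue (\<lambda>x. indicat_real (torus_cell a) x *\<^sub>R (1 + (f x)\<^sup>2))"
      using s by (simp add: set_integrable_def)
    show "(\<lambda>x. indicat_real (torus_cell a) x *\<^sub>R f x) \<in> borel_measurable lebesgue"
      using m by (intro borel_measurable_scaleR borel_measurable_indicator) auto
    have "\<bar>y\<bar> \<le> 1 + y\<^sup>2" for y :: real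
      using zero_le_power2[of "\<bar>y\<bar> - 1"] abs_ge_zero[of y] unfolding power2_diff power2_abs by (simp add: power2_eq_square) 
    then show "AE x in lebesgue. norm (indicat_real (torus_cell a) x *\<^sub>R f x) \<le> norm (indicat_real (torus_cell a) x *\<^sub>R (1 + (f x)\<^sup>2))"
      by (intro AE_I2) (auto simp: indicator_def)
  qed
qed

text \<open>
Countably many translates of the period cell cover the line, and translations preserve null sets.
\<close>

lemma AE_torus_cell_imp_AE:
  fixes a :: real
  assumes a: "a > 0" and per: "torus_periodic a P" and cell: "AE x in lebesgue. x \<in> torus_cell a \<longrightarrow> P x"
  shows "AE x in lebesgue. P x"
proof -
  define L where "L = 2 * pi * a"
  have L: "L > 0" using a by (simp add: L_def)
  have step: "P (x + L) = P x" for x using per by (simp add: torus_periodic_real_iff L_def)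
  have nat_shift: "P (x + real n * L) = P x" for x n
  proof (induction n)
    case (Suc n)
    then show ?case using step[of "x + real n * L"] by (simp add: algebra_simps)
  qed simp
  have int_shift: "P (x + of_int k * L) = P x" for x k
  proof (cases "k \<ge> 0")
    case True
    then show ?thesis using nat_shift[of x "nat k"] by simp
  next
    case False
    then show ?thesis using nat_shift[of "x + of_int k * L" "nat (- k)"] by simp
  qed
  let ?N = "{x \<in> torus_cell a. \<not> P x}"
  have "negligible ?N"
    using cell by (simp add: AE_lebesgue_iff_negligible conj_commute)
  then have "negligible (\<Union>k::int. (+) (of_int k * L) ` ?N)"
    by (intro negligible_countable_Union) (auto intro: negligible_translation)
  moreover have "{x. \<not> P x} \<subseteq> (\<Union>k::int. (+) (of_int k * L) ` ?N)"
  proof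
    fix x assume x: "x \<in> {x. \<not> P x}"
    \<comment> \<open>\<open>k\<close> is the number of the cell that contains \<open>x\<close>\<close>
    define k where "k = \<lfloor>x / L\<rfloor>"
    have "of_int k \<le> x / L" "x / L < of_int k + 1" by (auto simp: k_def)
    then have "of_int k * L \<le> x" "x \<le> of_int k * L + L" using L by (auto simp: field_simps)
    then have "x - of_int k * L \<in> torus_cell a" by (simp add: torus_cell_real flip: L_def)
    moreover have "\<not> P (x - of_int k * L)" using x int_shift[of "x - of_int k * L" k] by simp
    ultimately show "x \<in> (\<Union>k::int. (+) (of_int k * L) ` ?N)"
      by (intro UN_I[of k] image_eqI[of _ _ "x - of_int k * L"]) auto
  qed
  ultimately show ?thesis
    using AE_lebesgue_iff_negligible negligible_subset by blast
qed

text \<open>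
Reducing a point to the period cell is a Borel map, so the measurability of a periodic function
is decided on one cell. The detour over a Borel version is necessary because composing a
Lebesgue measurable function with a Borel map need not be measurable.
\<close>

lemma periodic_borel_measurable:
  fixes f :: "real \<Rightarrow> real"
  assumes a: "a > 0" and per: "torus_periodic a f" and m: "(\<lambda>x. indicat_real (torus_cell a) x * f x) \<in> borel_measurable lebesgue"
  shows "f \<in> borel_measurable lebesgue"
proof -
  define L where "L = 2 * pi * a"
  have L: "L > 0" using a by (simp add: L_def)
  obtain g where g: "g \<in> borel_measurable lborel" "AE x in lborel. indicat_real (torus_cell a) x * f x = g x"
    using completion_ex_borel_measurable_real[OF m] by blast
  \<comment> \<open>the representative of \<open>x\<close> in \<open>{0..<L}\<close>\<close>
  define r where "r x = x - of_int \<lfloor>x / L\<rfloor> * L" for x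
  have r_borel: "r \<in> borel_measurable borel" unfolding r_def by measurable
  have r_per: "r (x + L) = r x" for x
    using L by (simp add: r_def add_divide_distrib algebra_simps)
  have r_cell: "r x = x" if "x \<in> torus_cell a" "x \<noteq> L" for x
    using that L by (simp add: r_def torus_cell_real flip: L_def) (simp add: floor_eq_iff divide_simps)
  have "(\<lambda>x. g (r x)) \<in> borel_measurable borel"
    using measurable_compose[OF r_borel, of g borel] g(1) by simp
  then have gr: "(\<lambda>x. g (r x)) \<in> borel_measurable lebesgue" by (simp add: measurable_completion)
  have "AE x in lebesgue. g (r x) = f x"
  proof (rule AE_torus_cell_imp_AE[OF a])
    show "torus_periodic a (\<lambda>x. g (r x) = f x)"
      using per r_per by (simp add: torus_periodic_real_iff flip: L_def)
    have "AE x in lebesgue. x \<noteq> L"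
      by (rule AE_completion[OF AE_lborel_singleton])
    then show "AE x in lebesgue. x \<in> torus_cell a \<longrightarrow> g (r x) = f x"
      using AE_completion[OF g(2)] by eventually_elim (auto simp: r_cell)
  qed
  then show ?thesis by (rule borel_measurable_AE[OF gr])
qed

lemma Hs_norm_sq_mono:
  assumes "s \<le> s'" shows "Hs_norm_sq a s f \<le> Hs_norm_sq a s' f"
  unfolding Hs_norm_sq_def
  using assms by (intro nn_integral_mono ennreal_leI mult_right_mono powr_mono) auto

section \<open>Smooth functions\<close>

text \<open>
Every order of differentiability provides its own gradient; they all coincide by uniqueness of the
derivative, hence one gradient has smooth components.
\<close>

lemma C_infinity_gradient:
  fixes f :: "'a::euclidean_space \<Rightarrow> real"
  assumes "C_infinity f"
  obtains g where "\<And>x. (f has_derivative (\<lambda>h. g x \<bullet> h)) (at x)"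
    and "\<And>b. b \<in> Basis \<Longrightarrow> C_infinity (\<lambda>x. g x \<bullet> b)"
proof -
  have C: "C_k (Suc k) f" for k using assms by (simp only: C_infinity_def)
  obtain g where g: "\<And>x. (f has_derivative (\<lambda>h. g x \<bullet> h)) (at x)"
    using C[of 0] by auto
  have "C_k k (\<lambda>x. g x \<bullet> b)" if b: "b \<in> Basis" for b k
  proof -
    obtain g' where g': "\<And>x. (f has_derivative (\<lambda>h. g' x \<bullet> h)) (at x)"
      "\<And>b. b \<in> Basis \<Longrightarrow> C_k k (\<lambda>x. g' x \<bullet> b)"
      using C[of k] by auto
    have "(\<lambda>h. g x \<bullet> h) = (\<lambda>h. g' x \<bullet> h)" for x
      using g g'(1) has_derivative_unique by blast
    from fun_cong[OF this] have "g x \<bullet> b = g' x \<bullet> b" for x .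
    then show ?thesis using g'(2)[OF b] by simp
  qed
  then show thesis using g by (intro that[of g]) (auto simp: C_infinity_def)
qed

lemma C_infinity_continuous: "C_infinity f \<Longrightarrow> continuous_on S f"
  unfolding C_infinity_def using C_k.simps(1) continuous_on_subset by blast

lemma C_infinity_partials:
  fixes \<Psi> :: "real \<times> real \<Rightarrow> real"
  assumes "C_infinity \<Psi>"
  obtains \<Psi>t \<Psi>x where "C_infinity \<Psi>t" "C_infinity \<Psi>x"
    "\<And>t x. ((\<lambda>r. \<Psi> (r, x)) has_real_derivative \<Psi>t (t, x)) (at t)"
    "\<And>t x. ((\<lambda>y. \<Psi> (t, y)) has_real_derivative \<Psi>x (t, x)) (at x)"
proof -
  obtain g where g: "\<And>z. (\<Psi> has_derivative (\<lambda>h. g z \<bullet> h)) (at z)"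
    "\<And>b. b \<in> Basis \<Longrightarrow> C_infinity (\<lambda>z. g z \<bullet> b)"
    using C_infinity_gradient[OF assms] by blast
  have "((\<lambda>r. \<Psi> (r, x)) has_derivative (\<lambda>h. g (t, x) \<bullet> (h, 0))) (at t)" for t x
    by (rule has_derivative_compose[OF _ g(1), where f="\<lambda>r. (r, x)"]) (auto intro!: derivative_eq_intros)
  moreover have "((\<lambda>y. \<Psi> (t, y)) has_derivative (\<lambda>h. g (t, x) \<bullet> (0, h))) (at x)" for t x
    by (rule has_derivative_compose[OF _ g(1), where f="\<lambda>y. (t, y)"]) (auto intro!: derivative_eq_intros)
  moreover have "(\<lambda>h. g z \<bullet> (h, 0)) = (*) (g z \<bullet> (1, 0))" "(\<lambda>h. g z \<bullet> (0, h)) = (*) (g z \<bullet> (0, 1))" for z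
    by (auto simp: fun_eq_iff inner_prod_def)
  ultimately show thesis
    using g(2) by (intro that[of "\<lambda>z. g z \<bullet> (1, 0)" "\<lambda>z. g z \<bullet> (0, 1)"])
      (auto simp: has_field_derivative_def Basis_prod_def)
qed

lemma C_infinity_partial_snd:
  fixes \<Psi> :: "real \<times> real \<Rightarrow> real"
  assumes "C_infinity \<Psi>"
  obtains \<Psi>x where "C_infinity \<Psi>x" "\<And>t x. ((\<lambda>y. \<Psi> (t, y)) has_real_derivative \<Psi>x (t, x)) (at x)"
  by (rule C_infinity_partials[OF assms], rule that)

text \<open>
These functions contain all test functions that are needed, and the class is closed under partial
derivatives, which only change \<open>\<alpha>\<close> and \<open>\<beta>\<close>.
\<close>

lemma C_k_exp_trig:
  fixes p q :: "'a::euclidean_space"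
  shows "C_k k (\<lambda>z. exp (p \<bullet> z) * (\<alpha> * cos (q \<bullet> z) + \<beta> * sin (q \<bullet> z)))"
proof (induction k arbitrary: \<alpha> \<beta>)
  case 0
  show ?case by (auto intro!: continuous_intros)
next
  case (Suc k)
  let ?g = "\<lambda>z. (exp (p \<bullet> z) * (\<alpha> * cos (q \<bullet> z) + \<beta> * sin (q \<bullet> z))) *\<^sub>R p +
      (exp (p \<bullet> z) * (\<beta> * cos (q \<bullet> z) - \<alpha> * sin (q \<bullet> z))) *\<^sub>R q"
  have "((\<lambda>z. exp (p \<bullet> z) * (\<alpha> * cos (q \<bullet> z) + \<beta> * sin (q \<bullet> z))) has_derivative (\<lambda>h. ?g z \<bullet> h)) (at z)" for z
  proof -
    have E: "((\<lambda>z. exp (p \<bullet> z)) has_derivative (\<lambda>h. exp (p \<bullet> z) * (p \<bullet> h))) (at z)"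
      and C: "((\<lambda>z. cos (q \<bullet> z)) has_derivative (\<lambda>h. - sin (q \<bullet> z) * (q \<bullet> h))) (at z)"
      and S: "((\<lambda>z. sin (q \<bullet> z)) has_derivative (\<lambda>h. cos (q \<bullet> z) * (q \<bullet> h))) (at z)"
      by (auto intro!: derivative_eq_intros)
    have "((\<lambda>z. exp (p \<bullet> z) * (\<alpha> * cos (q \<bullet> z) + \<beta> * sin (q \<bullet> z))) has_derivative
       (\<lambda>h. exp (p \<bullet> z) * (\<alpha> * (- sin (q \<bullet> z) * (q \<bullet> h)) + \<beta> * (cos (q \<bullet> z) * (q \<bullet> h))) +
         exp (p \<bullet> z) * (p \<bullet> h) * (\<alpha> * cos (q \<bullet> z) + \<beta> * sin (q \<bullet> z)))) (at z)"
      by (intro has_derivative_mult has_derivative_add has_derivative_mult_right E C S)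
    then show ?thesis
      by (rule has_derivative_eq_rhs) (auto simp: fun_eq_iff inner_add_left algebra_simps)
  qed
  moreover have "C_k k (\<lambda>z. ?g z \<bullet> b)" for b
  proof -
    have "(\<lambda>z. ?g z \<bullet> b) = (\<lambda>z. exp (p \<bullet> z) * ((\<alpha> * (p \<bullet> b) + \<beta> * (q \<bullet> b)) * cos (q \<bullet> z) + (\<beta> * (p \<bullet> b) - \<alpha> * (q \<bullet> b)) * sin (q \<bullet> z)))"
      by (auto simp: fun_eq_iff inner_add_left algebra_simps)
    then show ?thesis using Suc by simp
  qed
  ultimately show ?case by (auto intro!: exI[of _ ?g])
qed

lemma C_infinity_exp_trig:
  "C_infinity (\<lambda>z. exp (p \<bullet> z) * (\<alpha> * cos (q \<bullet> z) + \<beta> * sin (q \<bullet> z)))"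
  by (simp add: C_infinity_def C_k_exp_trig)

section \<open>Fourier coefficients\<close>

text \<open>
The frequencies are enumerated by natural numbers, so that Fourier series are ordinary series.
The order is immaterial since only absolutely convergent sums occur.
\<close>

definition freq :: "real \<Rightarrow> nat \<Rightarrow> real" where
  "freq a n = of_int (int_decode n) / a"

lemma bij_betw_freq:
  assumes "a > 0"
  shows "bij_betw (freq a) UNIV (torus_freqs a)"
proof -
  have "inj (freq a)"
    using assms by (auto simp: freq_def inj_on_def dest: injD[OF inj_int_decode])
  moreover have "range (freq a) = torus_freqs a"
  proof
    show "range (freq a) \<subseteq> torus_freqs a"
      using assms by (auto simp: freq_def torus_freqs_def)
    show "torus_freqs a \<subseteq> range (freq a)"
    proof
      fix x assume "x \<in> torus_freqs a"
      then obtain k where "x * a = of_int k"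
        by (auto simp: torus_freqs_def Ints_def)
      then have "x = freq a (int_encode k)"
        using assms by (simp add: freq_def field_simps)
      then show "x \<in> range (freq a)" by blast
    qed
  qed
  ultimately show ?thesis by (simp add: bij_betw_def)
qed

lemma freq_in_torus_freqs: "a > 0 \<Longrightarrow> freq a n \<in> torus_freqs a"
  using bij_betw_freq[of a] by (auto simp: bij_betw_def)

lemma freq_eq_iff: "a > 0 \<Longrightarrow> freq a m = freq a n \<longleftrightarrow> m = n"
  using bij_betw_freq[of a] by (auto simp: bij_betw_def inj_on_def)

lemma ex_freq: "a > 0 \<Longrightarrow> \<xi> \<in> torus_freqs a \<Longrightarrow> \<exists>n. \<xi> = freq a n"
  using bij_betw_freq[of a] by (auto simp: bij_betw_def)

lemma summable_inverse_freq:
  assumes "a > 0"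
  shows "summable (\<lambda>n. 1 / (1 + (freq a n)\<^sup>2))"
proof (rule summable_comparison_test')
  show "summable (\<lambda>n. 4 * a\<^sup>2 * inverse ((real n)\<^sup>2))"
    by (intro summable_mult inverse_power_summable) auto
  fix n :: nat assume n: "1 \<le> n"
  \<comment> \<open>the enumeration of the integers alternates between signs, hence grows like \<open>n / 2\<close>\<close>
  have "real n \<le> 2 * \<bar>of_int (int_decode n)\<bar>"
    by (auto simp: int_decode_def sum_decode_def elim!: evenE oddE)
  then have "(real n)\<^sup>2 \<le> (2 * \<bar>of_int (int_decode n)\<bar>)\<^sup>2"
    by (intro power_mono) auto
  also have "\<dots> = 4 * a\<^sup>2 * (freq a n)\<^sup>2"
    using assms by (simp add: freq_def power_mult_distrib power_divide)
  also have "\<dots> \<le> 4 * a\<^sup>2 * (1 + (freq a n)\<^sup>2)"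
    by (intro mult_left_mono) auto
  finally show "norm (1 / (1 + (freq a n)\<^sup>2)) \<le> 4 * a\<^sup>2 * inverse ((real n)\<^sup>2)"
    using n by (simp add: divide_simps add_pos_nonneg)
qed

lemma Hs_norm_sq_suminf:
  fixes a :: real
  assumes a: "a > 0"
  shows "Hs_norm_sq a s f = (\<Sum>n. ennreal ((1 + (freq a n)\<^sup>2) powr s * (norm (fourier_coeff a f (freq a n)))\<^sup>2))"
  unfolding Hs_norm_sq_def
  by (subst nn_integral_bij_count_space[OF bij_betw_freq[OF a], symmetric])
     (simp add: nn_integral_count_space_nat)

lemma set_integrable_fourier:
  fixes w :: "real \<Rightarrow> real"
  assumes "set_integrable lebesgue (torus_cell a) w"
  shows "set_integrable lebesgue (torus_cell a) (\<lambda>x. of_real (w x) * cis (- (\<xi> * x)))"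
  by (rule set_integrable_mult_bounded[OF set_integrable_of_real[OF assms], where B=1])
     (auto intro!: continuous_imp_lebesgue_measurable continuous_intros)

lemma fourier_coeff_real:
  fixes f :: "real \<Rightarrow> real"
  assumes "a > 0"
  shows "fourier_coeff a f \<xi> = (LINT x:torus_cell a|lebesgue. of_real (f x) * cis (- (\<xi> * x))) / of_real (2 * pi * a)"
  using assms by (simp add: fourier_coeff_def measure_torus_cell_real mult.assoc)

lemma fourier_coeff_cos_sin:
  fixes f :: "'a::euclidean_space \<Rightarrow> real"
  assumes f: "set_integrable lebesgue (torus_cell a) f"
  shows "fourier_coeff a f \<xi> = (of_real (LINT x:torus_cell a|lebesgue. f x * cos (\<xi> \<bullet> x)) -
     \<i> * of_real (LINT x:torus_cell a|lebesgue. f x * sin (\<xi> \<bullet> x))) / of_real (measure lebesgue (torus_cell a))"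
proof -
  have i: "set_integrable lebesgue (torus_cell a) (\<lambda>x. of_real (f x) * cis (- (\<xi> \<bullet> x)))"
    by (rule set_integrable_mult_bounded[OF set_integrable_of_real[OF f], where B=1])
       (auto intro!: continuous_imp_lebesgue_measurable continuous_intros)
  have re: "Re (LINT x:torus_cell a|lebesgue. of_real (f x) * cis (- (\<xi> \<bullet> x))) = (LINT x:torus_cell a|lebesgue. f x * cos (\<xi> \<bullet> x))"
    using i unfolding set_integrable_def set_lebesgue_integral_def by (subst integral_Re[symmetric]) auto
  have im: "Im (LINT x:torus_cell a|lebesgue. of_real (f x) * cis (- (\<xi> \<bullet> x))) = - (LINT x:torus_cell a|lebesgue. f x * sin (\<xi> \<bullet> x))"
    using i unfolding set_integrable_def set_lebesgue_integral_def by (subst integral_Im[symmetric]) auto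
  have "(LINT x:torus_cell a|lebesgue. of_real (f x) * cis (- (\<xi> \<bullet> x))) = of_real (LINT x:torus_cell a|lebesgue. f x * cos (\<xi> \<bullet> x)) -
     \<i> * of_real (LINT x:torus_cell a|lebesgue. f x * sin (\<xi> \<bullet> x))"
    using re im by (simp add: complex_eq_iff)
  then show ?thesis by (simp add: fourier_coeff_def)
qed

lemma fourier_coeff_add:
  fixes a :: real
  assumes "set_integrable lebesgue (torus_cell a) f" "set_integrable lebesgue (torus_cell a) g"
  shows "fourier_coeff a (\<lambda>x. f x + g x) \<xi> = fourier_coeff a f \<xi> + fourier_coeff a g \<xi>"
  using set_integral_add(2)[OF set_integrable_fourier[OF assms(1)] set_integrable_fourier[OF assms(2)], of \<xi> \<xi>]
  by (simp add: fourier_coeff_def distrib_right add_divide_distrib)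

lemma fourier_coeff_diff:
  fixes a :: real
  assumes "set_integrable lebesgue (torus_cell a) f" "set_integrable lebesgue (torus_cell a) g"
  shows "fourier_coeff a (\<lambda>x. f x - g x) \<xi> = fourier_coeff a f \<xi> - fourier_coeff a g \<xi>"
  using set_integral_diff(2)[OF set_integrable_fourier[OF assms(1)] set_integrable_fourier[OF assms(2)], of \<xi> \<xi>]
  by (simp add: fourier_coeff_def left_diff_distrib diff_divide_distrib)

lemma fourier_coeff_cong_AE:
  fixes a :: real
  assumes f: "f \<in> torus_L2 a" and g: "g \<in> torus_L2 a" and eq: "AE x in lebesgue. f x = g x"
  shows "fourier_coeff a f \<xi> = fourier_coeff a g \<xi>"
proof -
  have "(\<lambda>x. indicat_real (torus_cell a) x *\<^sub>R (of_real (h x) * cis (- (\<xi> * x)))) \<in> borel_measurable lebesgue"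
    if "h \<in> torus_L2 a" for h
    using set_integrable_fourier[OF torus_L2_integrable[OF that]] unfolding set_integrable_def
    by (rule borel_measurable_integrable)
  then have "(LINT x:torus_cell a|lebesgue. of_real (f x) * cis (- (\<xi> * x))) = (LINT x:torus_cell a|lebesgue. of_real (g x) * cis (- (\<xi> * x)))"
    unfolding set_lebesgue_integral_def
    by (intro integral_cong_AE) (use f g eq in \<open>auto elim: eventually_mono\<close>)
  then show ?thesis by (simp add: fourier_coeff_def)
qed

lemma norm_fourier_coeff_le:
  fixes a :: real
  assumes a: "a > 0" and w: "set_integrable lebesgue (torus_cell a) w"
  shows "norm (fourier_coeff a w \<xi>) \<le> (LINT x:torus_cell a|lebesgue. \<bar>w x\<bar>) / (2 * pi * a)"
proof -
  have "norm (LINT x:torus_cell a|lebesgue. of_real (w x) * cis (- (\<xi> * x))) \<le>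
     (LINT x:torus_cell a|lebesgue. norm (of_real (w x) * cis (- (\<xi> * x))))"
    by (intro set_integral_norm_bound set_integrable_fourier w)
  also have "\<dots> = (LINT x:torus_cell a|lebesgue. \<bar>w x\<bar>)"
    by (simp only: norm_mult norm_of_real norm_cis mult_1_right)
  finally show ?thesis using a
    by (simp add: fourier_coeff_real norm_divide norm_mult divide_right_mono)
qed

lemma fourier_coeff_uminus_freq: "fourier_coeff a w (- \<xi>) = cnj (fourier_coeff a w \<xi>)"
proof -
  have "(\<integral>x. cnj (indicator (torus_cell a) x *\<^sub>R (of_real (w x) * cis (- (\<xi> \<bullet> x)))) \<partial>lebesgue) =
    cnj (\<integral>x. indicator (torus_cell a) x *\<^sub>R (of_real (w x) * cis (- (\<xi> \<bullet> x))) \<partial>lebesgue)"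
    by (rule Bochner_Integration.integral_cnj)
  then show ?thesis by (simp add: fourier_coeff_def set_lebesgue_integral_def cis_cnj)
qed

text \<open>
The condition on coefficients that corresponds to a real-valued function.
\<close>

definition conj_symmetric :: "real \<Rightarrow> (nat \<Rightarrow> complex) \<Rightarrow> bool" where
  "conj_symmetric a d \<longleftrightarrow> (\<forall>m n. freq a m = - freq a n \<longrightarrow> d m = cnj (d n))"

lemma conj_symmetric_fourier_coeff: "conj_symmetric a (\<lambda>n. fourier_coeff a w (freq a n))"
  by (simp add: conj_symmetric_def fourier_coeff_uminus_freq)

section \<open>Absolutely convergent Fourier series in one dimension\<close>

lemma cis_torus_freq:
  assumes "a > 0" "\<xi> \<in> torus_freqs a"
  shows "cis (\<xi> * (2 * pi * a)) = 1"
proof -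
  obtain k where "\<xi> * a = of_int k" using assms by (auto simp: torus_freqs_def Ints_def)
  then have "\<xi> * (2 * pi * a) = 2 * pi * of_int k" by (simp add: algebra_simps)
  then show ?thesis by (simp only: cis_multiple_2pi Ints_of_int)
qed

lemma has_vector_derivative_cis_mult:
  "((\<lambda>x. cis (\<xi> * x)) has_vector_derivative \<i> * of_real \<xi> * cis (\<xi> * x)) (at x within S)"
proof -
  have "((\<lambda>z. exp (\<i> * of_real \<xi> * z)) has_field_derivative
      \<i> * of_real \<xi> * exp (\<i> * of_real \<xi> * of_real x)) (at (of_real x))"
    by (auto intro!: derivative_eq_intros)
  from has_vector_derivative_real_field[OF this, of S] show ?thesis
    by (simp add: cis_conv_exp mult.assoc)
qed

lemma integral_cis_torus:
  assumes "a > 0" "\<xi> \<in> torus_freqs a"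
  shows "(LINT x:torus_cell a|lebesgue. cis (\<xi> * x)) = (if \<xi> = 0 then of_real (2 * pi * a) else 0)"
proof (cases "\<xi> = 0")
  case True
  have "(LINT x:{0..2 * pi * a}|lebesgue. (1::complex)) = of_real (2 * pi * a) - of_real 0"
    using assms
    by (intro set_integral_FTC) (auto intro!: derivative_eq_intros)
  then show ?thesis using True by (simp add: torus_cell_real)
next
  case False
  have "(LINT x:{0..2 * pi * a}|lebesgue. cis (\<xi> * x)) =
    (\<lambda>x. - (\<i> / of_real \<xi>) * cis (\<xi> * x)) (2 * pi * a) - (\<lambda>x. - (\<i> / of_real \<xi>) * cis (\<xi> * x)) 0"
  proof (rule set_integral_FTC)
    show "continuous_on {0..2 * pi * a} (\<lambda>x. cis (\<xi> * x))"
      by (intro continuous_intros)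
    fix x
    have "((\<lambda>x. - (\<i> / of_real \<xi>) * cis (\<xi> * x)) has_vector_derivative
        - (\<i> / of_real \<xi>) * (\<i> * of_real \<xi> * cis (\<xi> * x))) (at x within {0..2 * pi * a})"
      by (intro has_vector_derivative_mult_right has_vector_derivative_cis_mult)
    then show "((\<lambda>x. - (\<i> / of_real \<xi>) * cis (\<xi> * x)) has_vector_derivative cis (\<xi> * x)) (at x within {0..2 * pi * a})"
      using False by (simp add: field_simps)
  qed (use assms in auto)
  also have "\<dots> = 0" using cis_torus_freq[OF assms] by simp
  finally show ?thesis using False by (simp add: torus_cell_real)
qed

lemma set_integrable_torus_cis: "set_integrable lebesgue (torus_cell (a::real)) (\<lambda>x. c * cis (\<xi> * x))"
  unfolding torus_cell_real by (intro set_integrable_continuous_Icc continuous_intros)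

text \<open>
Taking real parts termwise gives a real function without a rearrangement of the series that
pairs \<open>\<xi>\<close> with \<open>- \<xi>\<close>; for conjugate symmetric coefficients it changes nothing.
\<close>

definition fourier_series :: "real \<Rightarrow> (nat \<Rightarrow> complex) \<Rightarrow> real \<Rightarrow> real" where
  "fourier_series a d x = (\<Sum>n. Re (d n * cis (freq a n * x)))"

lemma abs_fourier_mode_le: "\<bar>Re (d * cis \<theta>)\<bar> \<le> norm d"
  using abs_Re_le_cmod[of "d * cis \<theta>"] by (simp add: norm_mult)

lemma summable_fourier_series:
  assumes "summable (\<lambda>n. norm (d n))"
  shows "summable (\<lambda>n. Re (d n * cis (freq a n * x)))"
  by (rule summable_comparison_test'[OF assms]) (simp only: real_norm_def abs_fourier_mode_le)

lemma continuous_on_fourier_series: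
  assumes "summable (\<lambda>n. norm (d n))"
  shows "continuous_on S (fourier_series a d)"
proof -
  have "uniform_limit S (\<lambda>n x. \<Sum>i<n. Re (d i * cis (freq a i * x))) (fourier_series a d) sequentially"
    unfolding fourier_series_def
    by (rule Weierstrass_m_test[OF _ assms]) (simp only: real_norm_def abs_fourier_mode_le)
  then show ?thesis
    by (rule uniform_limit_theorem[rotated]) (auto intro!: continuous_intros always_eventually)
qed

lemma fourier_series_periodic:
  assumes "a > 0" shows "torus_periodic a (fourier_series a d)"
proof -
  have "cis (freq a n * (x + 2 * pi * a)) = cis (freq a n * x)" for n x
    using cis_torus_freq[OF assms freq_in_torus_freqs[OF assms], of n]
    by (simp add: distrib_left flip: cis_mult)
  then show ?thesis by (simp add: torus_periodic_def fourier_series_def)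
qed

lemma fourier_series_pairing_sums:
  fixes w :: "real \<Rightarrow> complex"
  assumes w: "set_integrable lebesgue (torus_cell a) w" and d: "summable (\<lambda>n. norm (d n))"
  shows "(\<lambda>n. LINT x:torus_cell a|lebesgue. w x * of_real (Re (d n * cis (freq a n * x)))) sums
    (LINT x:torus_cell a|lebesgue. w x * of_real (fourier_series a d x))"
proof -
  have "(\<lambda>n. LINT x:torus_cell a|lebesgue. w x * of_real (Re (d n * cis (freq a n * x)))) sums
    (LINT x:torus_cell a|lebesgue. (\<Sum>n. w x * of_real (Re (d n * cis (freq a n * x)))))"
  proof (rule set_integral_sums_dominated(1)[OF _ _ _ d])
    fix n
    show "set_integrable lebesgue (torus_cell a) (\<lambda>x. w x * of_real (Re (d n * cis (freq a n * x))))"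
    proof (rule set_integrable_mult_bounded[OF w])
      show "norm (complex_of_real (Re (d n * cis (freq a n * x)))) \<le> norm (d n)" for x
        by (simp only: norm_of_real abs_fourier_mode_le)
    qed (intro continuous_imp_lebesgue_measurable continuous_intros)
    show "set_integrable lebesgue (torus_cell a) (\<lambda>x. norm (w x))"
      using w by (rule set_integrable_norm)
    show "norm (w x * of_real (Re (d n * cis (freq a n * x)))) \<le> norm (d n) * norm (w x)" for x
      using mult_left_mono[OF abs_fourier_mode_le[of "d n" "freq a n * x"] norm_ge_zero[of "w x"]]
      by (simp only: norm_mult norm_of_real mult.commute[of "norm (d n)"])
  qed
  moreover have "(\<Sum>n. w x * of_real (Re (d n * cis (freq a n * x)))) = w x * of_real (fourier_series a d x)" for x
  proof -
    note s = summable_fourier_series[OF d, of a x]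
    have "(\<Sum>n. w x * complex_of_real (Re (d n * cis (freq a n * x)))) = w x * (\<Sum>n. complex_of_real (Re (d n * cis (freq a n * x))))"
      using s by (intro suminf_mult summable_of_real)
    also have "(\<Sum>n. complex_of_real (Re (d n * cis (freq a n * x)))) = of_real (fourier_series a d x)"
      using s by (simp only: suminf_of_real fourier_series_def)
    finally show ?thesis .
  qed
  ultimately show ?thesis by simp
qed

text \<open>
A real mode is half the sum of two complex modes of opposite frequency, and both contribute when
\<open>n = m\<close> is the frequency zero.
\<close>

lemma integral_mode_cis:
  assumes a: "a > 0"
  shows "(LINT x:torus_cell a|lebesgue. cis (- (freq a m * x)) * of_real (Re (d * cis (freq a n * x)))) =
    (if n = m then of_real (pi * a) * d else 0) + (if freq a n = - freq a m then of_real (pi * a) * cnj d else 0)"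
proof -
  have "cis (- (freq a m * x)) * of_real (Re (d * cis (freq a n * x))) =
      d / 2 * cis ((freq a n - freq a m) * x) + cnj d / 2 * cis (- (freq a n + freq a m) * x)" for x
  proof -
    have "of_real (Re (d * cis (freq a n * x))) = (d * cis (freq a n * x) + cnj d * cis (- (freq a n * x))) / 2"
      using complex_add_cnj[of "d * cis (freq a n * x)"] by (simp add: cis_cnj)
    moreover have "cis ((freq a n - freq a m) * x) = cis (freq a n * x) * cis (- (freq a m * x))"
      "cis (- (freq a n + freq a m) * x) = cis (- (freq a n * x)) * cis (- (freq a m * x))"
      by (simp_all add: cis_mult algebra_simps)
    moreover have "R * ((e * P + D * Q) / 2) = e / 2 * (P * R) + D / 2 * (Q * R)" for R e P D Q :: complex
      by (simp add: field_simps)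
    ultimately show ?thesis by (simp only:)
  qed
  then have "(LINT x:torus_cell a|lebesgue. cis (- (freq a m * x)) * of_real (Re (d * cis (freq a n * x)))) =
    (LINT x:torus_cell a|lebesgue. d / 2 * cis ((freq a n - freq a m) * x)) +
    (LINT x:torus_cell a|lebesgue. cnj d / 2 * cis (- (freq a n + freq a m) * x))"
    by (simp only: set_integral_add[OF set_integrable_torus_cis set_integrable_torus_cis])
  also have "\<dots> = d / 2 * (if freq a n - freq a m = 0 then of_real (2 * pi * a) else 0) +
    cnj d / 2 * (if - (freq a n + freq a m) = 0 then of_real (2 * pi * a) else 0)"
    using a by (simp only: set_integral_mult_right integral_cis_torus torus_freqs_uminus torus_freqs_diff torus_freqs_add freq_in_torus_freqs)
  finally show ?thesis using a by (auto simp: freq_eq_iff)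
qed

text \<open>
The mode at \<open>m\<close> and the mode at the opposite frequency each contribute one half of \<open>d m\<close>, the
latter by conjugate symmetry.
\<close>

lemma fourier_coeff_fourier_series:
  assumes a: "a > 0" and d: "summable (\<lambda>n. norm (d n))" "conj_symmetric a d"
  shows "fourier_coeff a (fourier_series a d) (freq a m) = d m"
proof -
  obtain m' where m': "- freq a m = freq a m'"
    using ex_freq[OF a torus_freqs_uminus[OF freq_in_torus_freqs[OF a]]] by blast
  have dm: "cnj (d m') = d m"
    using d(2) m' unfolding conj_symmetric_def by (metis minus_minus)
  have "(\<lambda>n. (if n = m then of_real (pi * a) * d n else 0) + (if n = m' then of_real (pi * a) * cnj (d n) else 0)) sums
    (of_real (pi * a) * d m + of_real (pi * a) * cnj (d m'))"
    by (intro sums_add sums_single)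
  moreover have "(\<lambda>n. (if n = m then of_real (pi * a) * d n else 0) + (if n = m' then of_real (pi * a) * cnj (d n) else 0)) sums
    (LINT x:torus_cell a|lebesgue. cis (- (freq a m * x)) * of_real (fourier_series a d x))"
  proof -
    have "set_integrable lebesgue (torus_cell a) (\<lambda>x. cis (- (freq a m * x)))"
      using set_integrable_torus_cis[of a 1 "- freq a m"] by simp
    from fourier_series_pairing_sums[OF this d(1)]
    show ?thesis unfolding integral_mode_cis[OF a] m' by (simp add: freq_eq_iff[OF a])
  qed
  ultimately have "(LINT x:torus_cell a|lebesgue. cis (- (freq a m * x)) * of_real (fourier_series a d x)) =
     of_real (pi * a) * d m + of_real (pi * a) * cnj (d m')"
    by (rule sums_unique2[symmetric])
  also have "\<dots> = of_real (2 * pi * a) * d m" using dm by simp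
  finally show ?thesis using a by (simp add: fourier_coeff_real mult.commute)
qed

lemma integral_mult_fourier_series:
  fixes w :: "real \<Rightarrow> real"
  assumes a: "a > 0" and w: "set_integrable lebesgue (torus_cell a) w" and d: "summable (\<lambda>n. norm (d n))"
  shows "(LINT x:torus_cell a|lebesgue. w x * fourier_series a d x) =
    2 * pi * a * (\<Sum>n. Re (d n * cnj (fourier_coeff a w (freq a n))))"
    and "summable (\<lambda>n. Re (d n * cnj (fourier_coeff a w (freq a n))))"
proof -
  have wc: "set_integrable lebesgue (torus_cell a) (\<lambda>x. complex_of_real (w x))"
    using w by (rule set_integrable_of_real)
  have t: "(LINT x:torus_cell a|lebesgue. complex_of_real (w x) * of_real (Re (d n * cis (freq a n * x)))) =
     of_real (2 * pi * a * Re (d n * cnj (fourier_coeff a w (freq a n))))" for n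
  proof -
    have i: "set_integrable lebesgue (torus_cell a) (\<lambda>x. of_real (w x) * cis (- (freq a n * x)))"
      by (rule set_integrable_mult_bounded[OF wc, where B=1])
         (auto intro!: continuous_imp_lebesgue_measurable continuous_intros)
    have "(LINT x:torus_cell a|lebesgue. complex_of_real (w x) * of_real (Re (d n * cis (freq a n * x)))) =
       (LINT x:torus_cell a|lebesgue. of_real (Re (cnj (d n) * (of_real (w x) * cis (- (freq a n * x))))))"
      by (intro set_lebesgue_integral_cong) (auto simp: algebra_simps)
    also have "\<dots> = of_real (LINT x:torus_cell a|lebesgue. Re (cnj (d n) * (of_real (w x) * cis (- (freq a n * x)))))"
      by (simp only: set_integral_complex_of_real)
    also have "(LINT x:torus_cell a|lebesgue. Re (cnj (d n) * (of_real (w x) * cis (- (freq a n * x))))) =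
        Re (LINT x:torus_cell a|lebesgue. cnj (d n) * (of_real (w x) * cis (- (freq a n * x))))"
      using set_integrable_mult_right[OF i, of "cnj (d n)"] unfolding set_integrable_def set_lebesgue_integral_def
      by (subst integral_Re[symmetric]) auto
    also have "\<dots> = Re (cnj (d n) * (of_real (2 * pi * a) * fourier_coeff a w (freq a n)))"
      using a by (simp add: fourier_coeff_real)
    also have "\<dots> = 2 * pi * a * Re (d n * cnj (fourier_coeff a w (freq a n)))"
      by (simp add: algebra_simps)
    finally show ?thesis .
  qed
  have "(\<lambda>n. complex_of_real (2 * pi * a * Re (d n * cnj (fourier_coeff a w (freq a n))))) sums
     (LINT x:torus_cell a|lebesgue. of_real (w x * fourier_series a d x))"
    using fourier_series_pairing_sums[OF wc d] unfolding t by simp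
  then have *: "(\<lambda>n. 2 * pi * a * Re (d n * cnj (fourier_coeff a w (freq a n)))) sums
     (LINT x:torus_cell a|lebesgue. w x * fourier_series a d x)"
    unfolding set_integral_complex_of_real sums_of_real_iff .
  then have **: "(\<lambda>n. Re (d n * cnj (fourier_coeff a w (freq a n)))) sums
     ((LINT x:torus_cell a|lebesgue. w x * fourier_series a d x) / (2 * pi * a))"
    using a sums_divide[OF *, of "2 * pi * a"] by simp
  show "(LINT x:torus_cell a|lebesgue. w x * fourier_series a d x) =
    2 * pi * a * (\<Sum>n. Re (d n * cnj (fourier_coeff a w (freq a n))))"
    unfolding sums_unique[OF **, symmetric] using a by simp
  show "summable (\<lambda>n. Re (d n * cnj (fourier_coeff a w (freq a n))))"
    using ** by (rule sums_summable)
qed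

section \<open>Fourier coefficients determine a periodic function\<close>

text \<open>
Presented by generators and sums, so that closure under products is an induction on both factors
instead of a reindexing of double sums.
\<close>

inductive trig_poly :: "real \<Rightarrow> (real \<Rightarrow> complex) \<Rightarrow> bool" for a where
  mode: "\<xi> \<in> torus_freqs a \<Longrightarrow> trig_poly a (\<lambda>x. c * cis (\<xi> * x))"
| add: "trig_poly a p \<Longrightarrow> trig_poly a q \<Longrightarrow> trig_poly a (\<lambda>x. p x + q x)"

lemma trig_poly_mult:
  assumes "trig_poly a p" "trig_poly a q"
  shows "trig_poly a (\<lambda>x. p x * q x)"
  using assms
proof (induction p arbitrary: q)
  case (mode \<xi> c)
  from mode(2,1) show ?case
  proof (induction q)
    case (mode \<eta> d)
    then have "trig_poly a (\<lambda>x. (c * d) * cis ((\<xi> + \<eta>) * x))"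
      by (intro trig_poly.mode torus_freqs_add)
    then show ?case by (simp add: algebra_simps flip: cis_mult)
  next
    case (add p q)
    then show ?case by (auto simp: distrib_left intro!: trig_poly.add)
  qed
next
  case (add p p')
  then show ?case by (auto simp: distrib_right intro!: trig_poly.add)
qed

text \<open>
This is the link to the Weierstrass theorem on the unit circle: a real polynomial in \<open>Re z\<close> and
\<open>Im z\<close>, restricted to \<open>z = cis (x / a)\<close>, is a trigonometric polynomial.
\<close>

lemma trig_poly_real_polynomial:
  assumes a: "a > 0" and g: "real_polynomial_function (g :: complex \<Rightarrow> real)"
  shows "trig_poly a (\<lambda>x. of_real (g (cis (x / a))))"
  using g
proof induction
  case (linear f)
  interpret bounded_linear f by fact
  have f: "of_real (f (cis (x / a))) =
     (of_real (f 1 / 2) * cis (1 / a * x) + of_real (f 1 / 2) * cis (- 1 / a * x)) +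
     ((- \<i> / 2 * of_real (f \<i>)) * cis (1 / a * x) + (\<i> / 2 * of_real (f \<i>)) * cis (- 1 / a * x))" for x
  proof -
    have "cis (x / a) = cos (x / a) *\<^sub>R 1 + sin (x / a) *\<^sub>R \<i>"
      by (simp add: complex_eq_iff)
    then have "f (cis (x / a)) = cos (x / a) * f 1 + sin (x / a) * f \<i>"
      by (simp only: add scaleR) simp
    then show ?thesis
      by (simp add: complex_eq_iff)
  qed
  have m: "1 / a \<in> torus_freqs a" "- 1 / a \<in> torus_freqs a"
    using a by (auto simp: torus_freqs_def)
  show ?case unfolding f by (intro trig_poly.intros m)
next
  case (const c)
  have "trig_poly a (\<lambda>x. of_real c * cis (0 * x))"
    by (intro trig_poly.mode) (simp add: torus_freqs_def)
  then show ?case by simp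
next
  case (add f g)
  then show ?case by (simp add: trig_poly.add)
next
  case (mult f g)
  then show ?case by (simp add: trig_poly_mult)
qed

context
  fixes a :: real and w :: "real \<Rightarrow> real"
  assumes a: "a > 0" and w: "set_integrable lebesgue (torus_cell a) w"
    and zero: "\<And>\<xi>. \<xi> \<in> torus_freqs a \<Longrightarrow> fourier_coeff a w \<xi> = 0"
begin

lemma integral_trig_poly_zero:
  assumes "trig_poly a p"
  shows "set_integrable lebesgue (torus_cell a) (\<lambda>x. of_real (w x) * p x) \<and>
    (LINT x:torus_cell a|lebesgue. of_real (w x) * p x) = 0"
  using assms
proof induction
  case (mode \<xi> c)
  have "set_integrable lebesgue (torus_cell a) (\<lambda>x. of_real (w x) * (c * cis (\<xi> * x)))"
    by (rule set_integrable_mult_bounded[OF set_integrable_of_real[OF w], where B="norm c"])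
       (auto intro!: continuous_imp_lebesgue_measurable continuous_intros simp: norm_mult)
  moreover have "(LINT x:torus_cell a|lebesgue. of_real (w x) * cis (\<xi> * x)) = 0"
    using zero[OF torus_freqs_uminus[OF mode]] a by (simp add: fourier_coeff_real)
  then have "(LINT x:torus_cell a|lebesgue. c * (of_real (w x) * cis (\<xi> * x))) = 0"
    by (simp only: set_integral_mult_right mult_zero_right)
  ultimately show ?case by (simp add: mult_ac)
next
  case (add p q)
  then show ?case by (simp add: distrib_left set_integral_add)
qed

text \<open>
Approximate \<open>g\<close> uniformly on the unit circle by real polynomials.
\<close>

lemma integral_continuous_circle_zero:
  fixes g :: "complex \<Rightarrow> real"
  assumes g: "continuous_on UNIV g"
  shows "(LINT x:torus_cell a|lebesgue. w x * g (cis (x / a))) = 0"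
proof -
  let ?I = "LINT x:torus_cell a|lebesgue. norm (w x)"
  have comp: "continuous_on UNIV (\<lambda>x. h (cis (x / a)))" if "continuous_on UNIV h" for h :: "complex \<Rightarrow> real"
    using a by (intro continuous_on_compose2[OF that] continuous_intros) auto
  have bd: "\<exists>B. \<forall>x. norm (h (cis (x / a))) \<le> B" if "continuous_on UNIV h" for h :: "complex \<Rightarrow> real"
  proof -
    have "compact (h ` sphere 0 1)"
      by (intro compact_continuous_image continuous_on_subset[OF that]) auto
    then obtain B where "\<forall>y\<in>h ` sphere 0 1. norm y \<le> B" using compact_imp_bounded bounded_iff by metis
    then show ?thesis by (intro exI[of _ B]) auto
  qed
  have int: "set_integrable lebesgue (torus_cell a) (\<lambda>x. w x * h (cis (x / a)))" if "continuous_on UNIV h" for h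
    using set_integrable_mult_bounded[OF w continuous_imp_lebesgue_measurable[OF comp[OF that]]] bd[OF that] by blast
  have "\<bar>LINT x:torus_cell a|lebesgue. w x * g (cis (x / a))\<bar> \<le> e * ?I" if e: "e > 0" for e
  proof -
    have "compact (sphere 0 1 :: complex set)" by simp
    from Stone_Weierstrass_real_polynomial_function[OF this continuous_on_subset[OF g subset_UNIV] e]
    obtain h where h: "real_polynomial_function h" "\<And>z. z \<in> sphere 0 1 \<Longrightarrow> \<bar>g z - h z\<bar> < e" by blast
    have hc: "continuous_on UNIV h"
      using h(1) continuous_on_polymonial_function real_polynomial_function_eq by blast
    have "(LINT x:torus_cell a|lebesgue. complex_of_real (w x * h (cis (x / a)))) = 0"
      using integral_trig_poly_zero[OF trig_poly_real_polynomial[OF a h(1)]] by simp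
    then have h0: "(LINT x:torus_cell a|lebesgue. w x * h (cis (x / a))) = 0"
      by (simp only: set_integral_complex_of_real of_real_eq_0_iff)
    have d: "set_integrable lebesgue (torus_cell a) (\<lambda>x. w x * g (cis (x / a)) - w x * h (cis (x / a)))"
      by (intro set_integral_diff int g hc)
    have "(LINT x:torus_cell a|lebesgue. w x * g (cis (x / a))) =
      (LINT x:torus_cell a|lebesgue. w x * g (cis (x / a)) - w x * h (cis (x / a)))"
      using h0 by (simp add: set_integral_diff(2)[OF int[OF g] int[OF hc]])
    also have "\<bar>\<dots>\<bar> \<le> (LINT x:torus_cell a|lebesgue. norm (w x * g (cis (x / a)) - w x * h (cis (x / a))))"
      using set_integral_norm_bound[OF d] by simp
    also have "\<dots> \<le> (LINT x:torus_cell a|lebesgue. e * norm (w x))"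
    proof (rule set_integral_mono[OF set_integrable_norm[OF d]])
      show "set_integrable lebesgue (torus_cell a) (\<lambda>x. e * norm (w x))"
        by (intro set_integrable_mult_right impI set_integrable_norm w)
      fix x
      have "\<bar>w x\<bar> * \<bar>g (cis (x / a)) - h (cis (x / a))\<bar> \<le> \<bar>w x\<bar> * e"
        by (intro mult_left_mono less_imp_le[OF h(2)]) auto
      then show "norm (w x * g (cis (x / a)) - w x * h (cis (x / a))) \<le> e * norm (w x)"
        by (simp add: abs_mult mult.commute flip: right_diff_distrib)
    qed
    finally show ?thesis by simp
  qed
  note le = this
  have I: "?I \<ge> 0" unfolding set_lebesgue_integral_def by (intro integral_nonneg_AE AE_I2) auto
  show ?thesis
  proof (rule ccontr)
    let ?J = "\<bar>LINT x:torus_cell a|lebesgue. w x * g (cis (x / a))\<bar>"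
    assume "\<not> ?thesis"
    then have "?J > 0" by simp
    \<comment> \<open>this choice of \<open>e\<close> makes the bound at most half of \<open>?J\<close>; the summand 1 avoids a division by zero\<close>
    with I have "?J / (2 * (?I + 1)) > 0" by simp
    from le[OF this] have "?J \<le> ?J * (?I / (2 * (?I + 1)))" by simp
    also have "\<dots> \<le> ?J * (1 / 2)"
      using I by (intro mult_left_mono) (auto simp: divide_simps)
    finally show False using \<open>?J > 0\<close> by simp
  qed
qed

text \<open>
\<open>x \<mapsto> cis (x / a)\<close> is injective on the half-open cell, so a compact \<open>T\<close> there is the preimage of a
compact subset \<open>K\<close> of the circle, whose indicator is a limit of continuous functions.
\<close>

lemma integral_compact_zero:
  assumes T: "compact T" "T \<subseteq> {0..<2 * pi * a}"
  shows "(LINT x:T|lebesgue. w x) = 0"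
proof (cases "T = {}")
  case False
  define K where "K = (\<lambda>x. cis (x / a)) ` T"
  have "compact K" unfolding K_def using a by (intro compact_continuous_image T continuous_intros) auto
  then have K: "closed K" "K \<noteq> {}" using False by (auto simp: K_def compact_imp_closed)
  define g where "g m z = max 0 (1 - real m * infdist z K)" for m :: nat and z
  have inj: "cis (x / a) \<in> K \<longleftrightarrow> x \<in> T" if "x \<in> {0..<2 * pi * a}" for x
  proof
    assume "cis (x / a) \<in> K"
    then obtain y where y: "y \<in> T" "cis (x / a) = cis (y / a)" by (auto simp: K_def)
    have "0 \<le> x / a" "x / a < 2 * pi" "0 \<le> y / a" "y / a < 2 * pi"
      using that T(2) y(1) a by (auto simp: divide_simps)
    with y(2) have "x / a = y / a"
      by (metis Arg2pi_unique mult_1 norm_one of_real_1 cis_conv_exp zero_less_one)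
    then show "x \<in> T" using a y(1) by simp
  qed (auto simp: K_def)
  have gc: "continuous_on UNIV (g m)" for m
    unfolding g_def by (intro continuous_intros)
  have gl: "(\<lambda>m. g m z) \<longlonglongrightarrow> indicator K z" for z
  proof (cases "z \<in> K")
    case True
    then show ?thesis by (simp add: g_def)
  next
    case False
    then have pos: "infdist z K > 0" using K infdist_pos_not_in_closed by blast
    obtain N where "real N > 1 / infdist z K" using reals_Archimedean2 by blast
    have "g m z = 0" if "m \<ge> N" for m
    proof -
      have "1 / infdist z K < real m" using \<open>real N > 1 / infdist z K\<close> that by linarith
      then show ?thesis using pos by (simp add: g_def divide_simps)
    qed
    then have "eventually (\<lambda>m. g m z = indicator K z) sequentially"
      using False by (auto simp: eventually_sequentially)
    then show ?thesis by (rule tendsto_eventually)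
  qed
  have gb: "norm (g m z) \<le> 1" for m z by (simp add: g_def infdist_nonneg)
  have Tm: "T \<in> sets lebesgue" using T(1) by (simp add: compact_imp_closed lmeasurable_compact fmeasurableD)
  have eq: "indicat_real (torus_cell a) x *\<^sub>R (w x * indicat_real K (cis (x / a))) = indicat_real T x *\<^sub>R w x"
    if "x \<noteq> 2 * pi * a" for x
    using that inj[of x] T(2) by (auto simp: indicator_def torus_cell_real)
  have wi: "integrable lebesgue (\<lambda>x. indicat_real (torus_cell a) x *\<^sub>R w x)" using w by (simp add: set_integrable_def)
  have wm: "(\<lambda>x. indicat_real (torus_cell a) x * w x) \<in> borel_measurable lebesgue"
    using borel_measurable_integrable[OF wi] by simp
  have gm: "(\<lambda>x. g m (cis (x / a))) \<in> borel_measurable lebesgue" for m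
    using a by (intro continuous_imp_lebesgue_measurable continuous_on_compose2[OF gc] continuous_intros) auto
  \<comment> \<open>the right end point has the same image on the circle as the left one\<close>
  have ae: "AE x in lebesgue. x \<noteq> 2 * pi * a"
    using AE_not_in[of "{2 * pi * a}" lebesgue] by (simp add: negligible_iff_null_sets[symmetric])
  have meas1: "(\<lambda>x. indicat_real (torus_cell a) x *\<^sub>R (w x * g m (cis (x / a)))) \<in> borel_measurable lebesgue" for m
    using borel_measurable_times[OF wm gm[of m]] by (simp add: mult.assoc)
  have "(\<lambda>m. LINT x:torus_cell a|lebesgue. w x * g m (cis (x / a))) \<longlonglongrightarrow> (LINT x:T|lebesgue. w x)"
    unfolding set_lebesgue_integral_def
  proof (rule integral_dominated_convergence[where w="\<lambda>x. norm (indicat_real (torus_cell a) x *\<^sub>R w x)"])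
    have "set_integrable lebesgue T w"
      by (rule set_integrable_subset[OF w Tm]) (use T(2) in \<open>auto simp: torus_cell_real\<close>)
    then show "(\<lambda>x. indicat_real T x *\<^sub>R w x) \<in> borel_measurable lebesgue"
      unfolding set_integrable_def by (rule borel_measurable_integrable)
    show "integrable lebesgue (\<lambda>x. norm (indicat_real (torus_cell a) x *\<^sub>R w x))"
      using wi by (rule integrable_norm)
    show "AE x in lebesgue. (\<lambda>m. indicat_real (torus_cell a) x *\<^sub>R (w x * g m (cis (x / a)))) \<longlonglongrightarrow> indicat_real T x *\<^sub>R w x"
      using ae
    proof eventually_elim
      case (elim x)
      have "(\<lambda>m. indicat_real (torus_cell a) x *\<^sub>R (w x * g m (cis (x / a)))) \<longlonglongrightarrow>
         indicat_real (torus_cell a) x *\<^sub>R (w x * indicat_real K (cis (x / a)))"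
        by (intro tendsto_intros gl)
      then show ?case unfolding eq[OF elim] .
    qed
    show "AE x in lebesgue. norm (indicat_real (torus_cell a) x *\<^sub>R (w x * g m (cis (x / a)))) \<le>
       norm (indicat_real (torus_cell a) x *\<^sub>R w x)" for m
      using gb[of m] by (intro AE_I2) (auto simp: abs_mult indicator_def intro!: mult_left_le)
  qed (rule meas1)
  then have "(\<lambda>m. 0) \<longlonglongrightarrow> (LINT x:T|lebesgue. w x)"
    using integral_continuous_circle_zero[OF gc] by simp
  then show ?thesis by (simp add: LIMSEQ_const_iff)
qed (simp add: set_lebesgue_integral_def)

text \<open>
By inner regularity the set where \<open>w\<close> is positive is exhausted by compact sets, up to measure zero.
On each of them the integral of the positive function \<open>w\<close> vanishes, so each is a null set.
\<close>

lemma AE_nonpos_of_fourier_coeff_zero: "AE x in lebesgue. x \<in> torus_cell a \<longrightarrow> w x \<le> 0"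
proof -
  define S where "S = {x. indicat_real {0..<2 * pi * a} x * (indicat_real (torus_cell a) x *\<^sub>R w x) > 0}"
  have S_eq: "S = {x. 0 \<le> x \<and> x < 2 * pi * a \<and> w x > 0}"
    by (auto simp: S_def torus_cell_real indicator_def split: if_splits)
  have wi: "integrable lebesgue (\<lambda>x. indicat_real (torus_cell a) x *\<^sub>R w x)" using w by (simp add: set_integrable_def)
  note borel_measurable_integrable[OF wi, measurable]
  have "S \<in> sets lebesgue" 
  proof -
    have "(\<lambda>x. indicat_real {0..<2 * pi * a} x * (indicat_real (torus_cell a) x *\<^sub>R w x)) \<in> borel_measurable lebesgue"
      by (intro borel_measurable_times borel_measurable_integrable[OF wi] borel_measurable_indicator) auto
    from measurable_sets[OF this, of "{0<..}"] show ?thesis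
      by (simp add: S_def vimage_def)
  qed
  have "emeasure lebesgue S \<le> ennreal e" if e: "e > 0" for e
  proof -
    obtain T where T: "closed T" "T \<subseteq> S" "S - T \<in> lmeasurable" "emeasure lebesgue (S - T) < ennreal e"
      using sets_lebesgue_inner_closed[OF \<open>S \<in> sets lebesgue\<close> e] .
    have TL: "T \<subseteq> {0..<2 * pi * a}" using T(2) S_eq by auto
    have "bounded T" by (rule bounded_subset[OF _ TL]) simp
    then have cT: "compact T" using T(1) compact_eq_bounded_closed by blast
    have Tm: "T \<in> sets lebesgue" using T(1) by simp
    have "set_integrable lebesgue T w"
      by (rule set_integrable_subset[OF w Tm]) (use TL in \<open>auto simp: torus_cell_real\<close>)
    moreover have "(\<integral>x. indicat_real T x *\<^sub>R w x \<partial>lebesgue) = 0"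
      using integral_compact_zero[OF cT TL] by (simp add: set_lebesgue_integral_def)
    moreover have "AE x in lebesgue. 0 \<le> indicat_real T x *\<^sub>R w x"
      using T(2) S_eq by (intro AE_I2) (auto simp: indicator_def intro: less_imp_le)
    ultimately have "AE x in lebesgue. indicat_real T x *\<^sub>R w x = 0"
      by (simp add: set_integrable_def integral_nonneg_eq_0_iff_AE)
    then have "AE x in lebesgue. x \<notin> T"
      by eventually_elim (use T(2) S_eq in \<open>auto simp: indicator_def\<close>)
    then have "emeasure lebesgue T = 0" using Tm by (simp add: AE_iff_null_sets null_setsD1)
    moreover have "emeasure lebesgue S \<le> emeasure lebesgue T + emeasure lebesgue (S - T)"
      using emeasure_subadditive[of T lebesgue "S - T"] Tm \<open>S \<in> sets lebesgue\<close> T(2)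
      by (metis Un_Diff_cancel sup.absorb2 sets.Diff)
    ultimately show ?thesis using T(4) by simp
  qed
  then have "emeasure lebesgue S = 0" by (metis ennreal_le_epsilon add.left_neutral le_zero_eq)
  then have "AE x in lebesgue. x \<notin> S" using \<open>S \<in> sets lebesgue\<close> by (intro AE_not_in) auto
  moreover have "AE x in lebesgue. x \<noteq> 2 * pi * a"
    using AE_not_in[of "{2 * pi * a}" lebesgue] by (simp add: negligible_iff_null_sets[symmetric])
  ultimately show ?thesis
    by eventually_elim (auto simp: S_eq torus_cell_real not_less)
qed

end

lemma fourier_coeff_zero_imp_AE_zero:
  fixes a :: real
  assumes a: "a > 0" and w: "set_integrable lebesgue (torus_cell a) w"
    and zero: "\<And>\<xi>. \<xi> \<in> torus_freqs a \<Longrightarrow> fourier_coeff a w \<xi> = 0"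
  shows "AE x in lebesgue. x \<in> torus_cell a \<longrightarrow> w x = 0"
proof -
  have "AE x in lebesgue. x \<in> torus_cell a \<longrightarrow> - w x \<le> 0"
  proof (rule AE_nonpos_of_fourier_coeff_zero[OF a])
    show "set_integrable lebesgue (torus_cell a) (\<lambda>x. - w x)"
      using set_integrable_mult_right[of "-1" lebesgue "torus_cell a" w] w by simp
    show "fourier_coeff a (\<lambda>x. - w x) \<xi> = 0" if "\<xi> \<in> torus_freqs a" for \<xi>
      using zero[OF that] a by (simp add: fourier_coeff_real set_lebesgue_integral_def)
  qed
  with AE_nonpos_of_fourier_coeff_zero[OF a w zero] show ?thesis by auto
qed

lemma fourier_coeff_eq_imp_AE_eq:
  fixes a :: real
  assumes a: "a > 0" and f: "set_integrable lebesgue (torus_cell a) f" and g: "set_integrable lebesgue (torus_cell a) g"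
    and eq: "\<And>\<xi>. \<xi> \<in> torus_freqs a \<Longrightarrow> fourier_coeff a f \<xi> = fourier_coeff a g \<xi>"
  shows "AE x in lebesgue. x \<in> torus_cell a \<longrightarrow> f x = g x"
  using fourier_coeff_zero_imp_AE_zero[OF a set_integral_diff(1)[OF f g]] fourier_coeff_diff[OF f g] eq
  by simp

lemma torus_L2_fourier_coeff_eq_imp_AE_eq:
  fixes a :: real
  assumes a: "a > 0" and f: "f \<in> torus_L2 a" and g: "g \<in> torus_L2 a"
    and eq: "\<And>\<xi>. \<xi> \<in> torus_freqs a \<Longrightarrow> fourier_coeff a f \<xi> = fourier_coeff a g \<xi>"
  shows "AE x in lebesgue. f x = g x"
proof (rule AE_torus_cell_imp_AE[OF a])
  show "torus_periodic a (\<lambda>x. f x = g x)"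
    using f g by (simp add: torus_L2_def torus_periodic_real_iff)
  show "AE x in lebesgue. x \<in> torus_cell a \<longrightarrow> f x = g x"
    by (rule fourier_coeff_eq_imp_AE_eq[OF a torus_L2_integrable[OF f] torus_L2_integrable[OF g] eq])
qed

section \<open>Periodic functions with two continuous derivatives\<close>

lemma periodic_derivative:
  fixes a :: real
  assumes "torus_periodic a \<phi>" "\<And>x. (\<phi> has_real_derivative \<phi>' x) (at x)"
  shows "torus_periodic a \<phi>'"
  unfolding torus_periodic_real_iff
proof
  fix x
  have "((\<lambda>y. \<phi> (y + 2 * pi * a)) has_real_derivative \<phi>' (x + 2 * pi * a)) (at x)"
    using assms(2) DERIV_shift by blast
  moreover have "(\<lambda>y. \<phi> (y + 2 * pi * a)) = \<phi>"
    using assms(1) by (simp add: torus_periodic_real_iff)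
  ultimately have "(\<phi> has_real_derivative \<phi>' (x + 2 * pi * a)) (at x)" by (simp only:)
  then show "\<phi>' (x + 2 * pi * a) = \<phi>' x" using assms(2)[of x] by (rule DERIV_unique)
qed

text \<open>
Integrating by parts twice at once: \<open>(\<phi>' + \<i> \<xi> \<phi>) exp (- \<i> \<xi> x)\<close> is a periodic antiderivative of
\<open>(\<phi>'' + \<xi>\<^sup>2 \<phi>) exp (- \<i> \<xi> x)\<close>.
\<close>

lemma fourier_coeff_second_derivative:
  fixes \<phi> :: "real \<Rightarrow> real"
  assumes a: "a > 0" and \<xi>: "\<xi> \<in> torus_freqs a" and per: "torus_periodic a \<phi>"
    and d1: "\<And>x. (\<phi> has_real_derivative \<phi>' x) (at x)"
    and d2: "\<And>x. (\<phi>' has_real_derivative \<phi>'' x) (at x)"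
    and c: "continuous_on UNIV \<phi>''"
  shows "fourier_coeff a \<phi>'' \<xi> = - of_real (\<xi>\<^sup>2) * fourier_coeff a \<phi> \<xi>"
proof -
  define L where "L = 2 * pi * a"
  have L: "L > 0" using a by (simp add: L_def)
  have per1: "\<phi> (x + L) = \<phi> x" for x using per by (simp add: torus_periodic_real_iff L_def)
  have "(\<phi> has_real_derivative \<phi>' L) (at 0)"
    using d1[of L] DERIV_shift[of \<phi> "\<phi>' L" 0 L] by (simp add: per1)
  then have per2: "\<phi>' L = \<phi>' 0" using d1[of 0] DERIV_unique by blast
  have c0: "continuous_on S \<phi>" and c1: "continuous_on S \<phi>'" for S
    using d1 d2 by (meson DERIV_continuous continuous_at_imp_continuous_on)+
  have c2: "continuous_on S \<phi>''" for S using c continuous_on_subset by blast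
  let ?e = "\<lambda>x. cis (- \<xi> * x)"
  let ?F = "\<lambda>x. (of_real (\<phi>' x) + \<i> * of_real \<xi> * of_real (\<phi> x)) * ?e x"
  have vd: "((\<lambda>x. complex_of_real (h x)) has_vector_derivative of_real h') (at x within S)"
    if "(h has_real_derivative h') (at x)" for h h' x S
    using that by (intro has_vector_derivative_of_real has_vector_derivative_at_within)
      (simp add: has_real_derivative_iff_has_vector_derivative)
  have "(?F has_vector_derivative
      (of_real (\<phi>' x) + \<i> * of_real \<xi> * of_real (\<phi> x)) * (\<i> * of_real (- \<xi>) * ?e x) +
      (of_real (\<phi>'' x) + \<i> * of_real \<xi> * of_real (\<phi>' x)) * ?e x) (at x within {0..L})" for x
    by (intro has_vector_derivative_mult has_vector_derivative_add has_vector_derivative_mult_right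
        has_vector_derivative_cis_mult vd d1 d2)
  moreover have "(of_real (\<phi>' x) + \<i> * of_real \<xi> * of_real (\<phi> x)) * (\<i> * of_real (- \<xi>) * ?e x) +
      (of_real (\<phi>'' x) + \<i> * of_real \<xi> * of_real (\<phi>' x)) * ?e x =
      of_real (\<phi>'' x) * ?e x + of_real (\<xi>\<^sup>2) * (of_real (\<phi> x) * ?e x)" for x
    by (simp add: algebra_simps power2_eq_square)
  ultimately have "(?F has_vector_derivative of_real (\<phi>'' x) * ?e x + of_real (\<xi>\<^sup>2) * (of_real (\<phi> x) * ?e x)) (at x within {0..L})" for x
    by simp
  then have "(LINT x:{0..L}|lebesgue. of_real (\<phi>'' x) * ?e x + of_real (\<xi>\<^sup>2) * (of_real (\<phi> x) * ?e x)) = ?F L - ?F 0"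
    using L by (intro set_integral_FTC continuous_intros c0 c2) auto
  also have "\<dots> = 0"
    using cis_torus_freq[OF a torus_freqs_uminus[OF \<xi>]] per1[of 0] per2 by (simp add: L_def)
  also have "(LINT x:{0..L}|lebesgue. of_real (\<phi>'' x) * ?e x + of_real (\<xi>\<^sup>2) * (of_real (\<phi> x) * ?e x)) =
    (LINT x:{0..L}|lebesgue. of_real (\<phi>'' x) * ?e x) + (LINT x:{0..L}|lebesgue. of_real (\<xi>\<^sup>2) * (of_real (\<phi> x) * ?e x))"
    by (intro set_integral_add set_integrable_continuous_Icc continuous_intros c0 c2)
  finally have "(LINT x:{0..L}|lebesgue. of_real (\<phi>'' x) * ?e x) = - of_real (\<xi>\<^sup>2) * (LINT x:{0..L}|lebesgue. of_real (\<phi> x) * ?e x)"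
    by (simp add: add_eq_0_iff2)
  then show ?thesis
    using a by (simp add: fourier_coeff_real torus_cell_real L_def)
qed

text \<open>
\<open>(1 + \<xi>\<^sup>2)\<close> times the coefficient of \<open>\<phi>\<close> is the coefficient of \<open>\<phi> - \<phi>''\<close>.
\<close>

lemma norm_fourier_coeff_twice_differentiable_le:
  fixes \<phi> :: "real \<Rightarrow> real"
  assumes a: "a > 0" and \<xi>: "\<xi> \<in> torus_freqs a" and per: "torus_periodic a \<phi>"
    and d1: "\<And>x. (\<phi> has_real_derivative \<phi>' x) (at x)"
    and d2: "\<And>x. (\<phi>' has_real_derivative \<phi>'' x) (at x)"
    and c: "continuous_on UNIV \<phi>''"
    and B: "\<And>x. x \<in> torus_cell a \<Longrightarrow> \<bar>\<phi> x\<bar> + \<bar>\<phi>'' x\<bar> \<le> B"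
  shows "norm (fourier_coeff a \<phi> \<xi>) \<le> B * (1 / (1 + \<xi>\<^sup>2))"
proof -
  have c0: "continuous_on S \<phi>" for S
    using d1 by (meson DERIV_continuous continuous_at_imp_continuous_on)
  have c2: "continuous_on S \<phi>''" for S using c continuous_on_subset by blast
  have i: "set_integrable lebesgue (torus_cell a) \<phi>" "set_integrable lebesgue (torus_cell a) \<phi>''"
    unfolding torus_cell_real by (intro set_integrable_continuous_Icc c0 c2)+
  have "(1 + \<xi>\<^sup>2) * norm (fourier_coeff a \<phi> \<xi>) = norm (fourier_coeff a \<phi> \<xi>) + norm (fourier_coeff a \<phi>'' \<xi>)"
    using fourier_coeff_second_derivative[OF a \<xi> per d1 d2 c] by (simp add: norm_mult norm_power distrib_right)
  also have "\<dots> \<le> (LINT x:torus_cell a|lebesgue. \<bar>\<phi> x\<bar>) / (2 * pi * a) + (LINT x:torus_cell a|lebesgue. \<bar>\<phi>'' x\<bar>) / (2 * pi * a)"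
    by (intro add_mono norm_fourier_coeff_le a i)
  also have "\<dots> = (LINT x:torus_cell a|lebesgue. \<bar>\<phi> x\<bar> + \<bar>\<phi>'' x\<bar>) / (2 * pi * a)"
    by (simp add: set_integral_add(2)[OF set_integrable_abs[OF i(1)] set_integrable_abs[OF i(2)]] add_divide_distrib)
  also have "\<dots> \<le> (LINT x:torus_cell a|lebesgue. B) / (2 * pi * a)"
    using a i by (intro divide_right_mono set_integral_mono set_integral_add(1) set_integrable_abs i B)
       (auto simp: torus_cell_real intro!: set_integrable_continuous_Icc continuous_intros)
  also have "\<dots> = B"
    using a by (simp add: set_lebesgue_integral_def measure_torus_cell_real)
  finally show ?thesis by (simp add: divide_simps add_pos_nonneg mult_ac)
qed

text \<open>
Parseval's identity for an integrable function paired with a regular one. The series of \<open>\<phi>\<close>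
converges uniformly, its sum has the coefficients of \<open>\<phi>\<close>, and hence it equals \<open>\<phi>\<close> almost everywhere.
\<close>

lemma integral_mult_twice_differentiable:
  fixes \<phi> w :: "real \<Rightarrow> real"
  assumes a: "a > 0" and w: "set_integrable lebesgue (torus_cell a) w" and per: "torus_periodic a \<phi>"
    and d1: "\<And>x. (\<phi> has_real_derivative \<phi>' x) (at x)"
    and d2: "\<And>x. (\<phi>' has_real_derivative \<phi>'' x) (at x)"
    and c: "continuous_on UNIV \<phi>''"
  shows "(LINT x:torus_cell a|lebesgue. w x * \<phi> x) =
    2 * pi * a * (\<Sum>n. Re (fourier_coeff a \<phi> (freq a n) * cnj (fourier_coeff a w (freq a n))))"
    and "summable (\<lambda>n. Re (fourier_coeff a \<phi> (freq a n) * cnj (fourier_coeff a w (freq a n))))"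
proof -
  let ?d = "\<lambda>n. fourier_coeff a \<phi> (freq a n)"
  have c0: "continuous_on S \<phi>" for S
    using d1 by (meson DERIV_continuous continuous_at_imp_continuous_on)
  have c2: "continuous_on S \<phi>''" for S using c continuous_on_subset by blast
  have "compact ((\<lambda>x. \<bar>\<phi> x\<bar> + \<bar>\<phi>'' x\<bar>) ` {0..2 * pi * a})"
    by (intro compact_continuous_image continuous_intros c0 c2) auto
  then obtain B where "\<forall>y\<in>(\<lambda>x. \<bar>\<phi> x\<bar> + \<bar>\<phi>'' x\<bar>) ` {0..2 * pi * a}. norm y \<le> B"
    using compact_imp_bounded bounded_iff by metis
  then have B: "\<bar>\<phi> x\<bar> + \<bar>\<phi>'' x\<bar> \<le> B" if "x \<in> torus_cell a" for x
    using that by (force simp: torus_cell_real)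
  have s: "summable (\<lambda>n. norm (?d n))"
    by (rule summable_comparison_test'[OF summable_mult[OF summable_inverse_freq[OF a], of B], of 0])
       (use norm_fourier_coeff_twice_differentiable_le[OF a freq_in_torus_freqs[OF a] per d1 d2 c B] in simp)
  have i: "set_integrable lebesgue (torus_cell a) \<phi>" "set_integrable lebesgue (torus_cell a) (fourier_series a ?d)"
    unfolding torus_cell_real by (intro set_integrable_continuous_Icc c0 continuous_on_fourier_series s)+
  have "AE x in lebesgue. x \<in> torus_cell a \<longrightarrow> \<phi> x = fourier_series a ?d x"
  proof (rule fourier_coeff_eq_imp_AE_eq[OF a i])
    fix \<xi> assume "\<xi> \<in> torus_freqs a"
    then obtain n where "\<xi> = freq a n" using ex_freq[OF a] by blast
    then show "fourier_coeff a \<phi> \<xi> = fourier_coeff a (fourier_series a ?d) \<xi>"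
      by (simp add: fourier_coeff_fourier_series[OF a s conj_symmetric_fourier_coeff])
  qed
  moreover have m: "(\<lambda>x. indicat_real (torus_cell a) x *\<^sub>R (w x * g x)) \<in> borel_measurable lebesgue"
    if g: "continuous_on UNIV g" for g
  proof -
    have "(\<lambda>x. (indicat_real (torus_cell a) x *\<^sub>R w x) * g x) \<in> borel_measurable lebesgue"
      using w unfolding set_integrable_def
      by (rule borel_measurable_times[OF borel_measurable_integrable continuous_imp_lebesgue_measurable[OF g]])
    then show ?thesis by (simp add: mult.assoc)
  qed
  ultimately have "(LINT x:torus_cell a|lebesgue. w x * \<phi> x) = (LINT x:torus_cell a|lebesgue. w x * fourier_series a ?d x)"
    unfolding set_lebesgue_integral_def
    by (intro integral_cong_AE m c0 continuous_on_fourier_series s) (auto simp: indicator_def elim: eventually_mono)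
  then show "(LINT x:torus_cell a|lebesgue. w x * \<phi> x) =
    2 * pi * a * (\<Sum>n. Re (?d n * cnj (fourier_coeff a w (freq a n))))"
    using integral_mult_fourier_series(1)[OF a w s] by simp
  show "summable (\<lambda>n. Re (?d n * cnj (fourier_coeff a w (freq a n))))"
    by (rule integral_mult_fourier_series(2)[OF a w s])
qed

section \<open>The heat flow on the one-dimensional torus\<close>

definition heat_coeff :: "real \<Rightarrow> real \<Rightarrow> (real \<Rightarrow> real) \<Rightarrow> real \<Rightarrow> nat \<Rightarrow> complex" where
  "heat_coeff a \<nu> W t n = of_real (exp (- (\<nu> * (freq a n)\<^sup>2 * t))) * fourier_coeff a W (freq a n)"

text \<open>
At time zero the series need not converge, so there the flow is the datum by definition; the value at
negative times is a convention.
\<close>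

definition heat_flow :: "real \<Rightarrow> real \<Rightarrow> (real \<Rightarrow> real) \<Rightarrow> real \<Rightarrow> real \<Rightarrow> real" where
  "heat_flow a \<nu> W t = (if t \<le> 0 then W else fourier_series a (heat_coeff a \<nu> W t))"

lemma conj_symmetric_heat_coeff: "conj_symmetric a (heat_coeff a \<nu> W t)"
  by (simp add: conj_symmetric_def heat_coeff_def fourier_coeff_uminus_freq)

text \<open>
The exponential damping absorbs one factor \<open>1 + \<xi>\<^sup>2\<close>, both for the absolute convergence of the
flow and for its gain of one derivative.
\<close>

lemma one_plus_le_exp:
  fixes y :: real
  assumes "c > 0" "y \<ge> 0"
  shows "(1 + y) * exp (- (c * y)) \<le> max 1 (1 / c)"
proof -
  have "1 + y \<le> max 1 (1 / c) * (1 + c * y)"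
  proof -
    have "max 1 (1 / c) * (c * y) \<ge> (1 / c) * (c * y)"
      using assms by (intro mult_right_mono) auto
    then show ?thesis using assms by (auto simp: distrib_left)
  qed
  also have "\<dots> \<le> max 1 (1 / c) * exp (c * y)"
    by (intro mult_left_mono exp_ge_add_one_self) auto
  finally show ?thesis by (simp add: exp_minus field_simps)
qed

context
  fixes a \<nu> :: real and W :: "real \<Rightarrow> real"
  assumes a: "a > 0" and \<nu>: "\<nu> > 0" and W: "W \<in> torus_L2 a"
begin

lemma summable_heat_coeff:
  assumes t: "t > 0"
  shows "summable (\<lambda>n. norm (heat_coeff a \<nu> W t n))"
proof -
  define M where "M = (LINT x:torus_cell a|lebesgue. \<bar>W x\<bar>) / (2 * pi * a)"
  define C where "C = max 1 (1 / (\<nu> * t))"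
  have M: "norm (fourier_coeff a W \<xi>) \<le> M" for \<xi>
    unfolding M_def by (rule norm_fourier_coeff_le[OF a torus_L2_integrable[OF W]])
  show ?thesis
  proof (rule summable_comparison_test')
    show "summable (\<lambda>n. (C * M) * (1 / (1 + (freq a n)\<^sup>2)))"
      by (intro summable_mult summable_inverse_freq a)
    fix n
    let ?y = "(freq a n)\<^sup>2"
    have "(1 + ?y) * exp (- ((\<nu> * t) * ?y)) \<le> C"
      unfolding C_def using \<nu> t by (intro one_plus_le_exp) auto
    then have "exp (- (\<nu> * ?y * t)) \<le> C * (1 / (1 + ?y))"
      by (simp add: divide_simps add_pos_nonneg mult_ac)
    moreover have "C * (1 / (1 + ?y)) \<ge> 0" by (simp add: C_def le_max_iff_disj)
    ultimately have "exp (- (\<nu> * ?y * t)) * norm (fourier_coeff a W (freq a n)) \<le> (C * (1 / (1 + ?y))) * M"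
      using M by (intro mult_mono) auto
    then have "norm (heat_coeff a \<nu> W t n) \<le> (C * (1 / (1 + ?y))) * M"
      by (simp only: heat_coeff_def norm_mult norm_of_real abs_exp_cancel)
    then show "norm (norm (heat_coeff a \<nu> W t n)) \<le> (C * M) * (1 / (1 + ?y))"
      by (simp add: mult_ac)
  qed
qed

lemma heat_flow_L2: "heat_flow a \<nu> W t \<in> torus_L2 a"
proof (cases "t \<le> 0")
  case False
  then have s: "summable (\<lambda>n. norm (heat_coeff a \<nu> W t n))" using summable_heat_coeff by simp
  show ?thesis
    using False a s unfolding heat_flow_def torus_L2_def torus_cell_real
    by (auto intro!: set_integrable_continuous_Icc continuous_intros continuous_on_fourier_series
        continuous_imp_lebesgue_measurable fourier_series_periodic)
qed (simp add: heat_flow_def W)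

lemma fourier_coeff_heat_flow:
  assumes "t \<ge> 0" "\<xi> \<in> torus_freqs a"
  shows "fourier_coeff a (heat_flow a \<nu> W t) \<xi> = of_real (exp (- (\<nu> * \<xi>\<^sup>2 * t))) * fourier_coeff a W \<xi>"
proof (cases "t = 0")
  case False
  then have t: "t > 0" using assms by simp
  obtain n where n: "\<xi> = freq a n" using ex_freq[OF a assms(2)] by blast
  show ?thesis
    using t fourier_coeff_fourier_series[OF a summable_heat_coeff[OF t] conj_symmetric_heat_coeff]
    by (simp add: heat_flow_def n heat_coeff_def)
qed (simp add: heat_flow_def)

lemma Hs_norm_sq_heat_flow:
  assumes "t \<ge> 0"
  shows "Hs_norm_sq a s (heat_flow a \<nu> W t) =
    (\<integral>\<^sup>+ \<xi>. ennreal ((1 + \<xi>\<^sup>2) powr s * (exp (- (\<nu> * \<xi>\<^sup>2 * t)) * norm (fourier_coeff a W \<xi>))\<^sup>2) \<partial>count_space (torus_freqs a))"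
  unfolding Hs_norm_sq_def
  by (intro nn_integral_cong) (simp add: fourier_coeff_heat_flow assms norm_mult)

lemma Hs_norm_sq_heat_flow_diff:
  assumes "t \<ge> 0" "r \<ge> 0"
  shows "Hs_norm_sq a s (\<lambda>x. heat_flow a \<nu> W r x - heat_flow a \<nu> W t x) =
    (\<integral>\<^sup>+ \<xi>. ennreal ((1 + \<xi>\<^sup>2) powr s * ((exp (- (\<nu> * \<xi>\<^sup>2 * r)) - exp (- (\<nu> * \<xi>\<^sup>2 * t))) * norm (fourier_coeff a W \<xi>))\<^sup>2) \<partial>count_space (torus_freqs a))"
  unfolding Hs_norm_sq_def
proof (intro nn_integral_cong)
  fix \<xi> assume "\<xi> \<in> space (count_space (torus_freqs a))"
  then have \<xi>: "\<xi> \<in> torus_freqs a" by simp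
  have "fourier_coeff a (\<lambda>x. heat_flow a \<nu> W r x - heat_flow a \<nu> W t x) \<xi> =
     of_real (exp (- (\<nu> * \<xi>\<^sup>2 * r)) - exp (- (\<nu> * \<xi>\<^sup>2 * t))) * fourier_coeff a W \<xi>"
    by (simp add: fourier_coeff_diff[OF torus_L2_integrable[OF heat_flow_L2] torus_L2_integrable[OF heat_flow_L2]]
        fourier_coeff_heat_flow assms \<xi> left_diff_distrib)
  then have "norm (fourier_coeff a (\<lambda>x. heat_flow a \<nu> W r x - heat_flow a \<nu> W t x) \<xi>) =
     \<bar>exp (- (\<nu> * \<xi>\<^sup>2 * r)) - exp (- (\<nu> * \<xi>\<^sup>2 * t))\<bar> * norm (fourier_coeff a W \<xi>)"
    by (simp only: norm_mult norm_of_real)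
  then show "ennreal ((1 + (norm \<xi>)\<^sup>2) powr s * (norm (fourier_coeff a (\<lambda>x. heat_flow a \<nu> W r x - heat_flow a \<nu> W t x) \<xi>))\<^sup>2) =
     ennreal ((1 + \<xi>\<^sup>2) powr s * ((exp (- (\<nu> * \<xi>\<^sup>2 * r)) - exp (- (\<nu> * \<xi>\<^sup>2 * t))) * norm (fourier_coeff a W \<xi>))\<^sup>2)"
    by (simp add: power_mult_distrib)
qed

lemma Hs_norm_sq_heat_flow_antimono:
  assumes "0 \<le> \<tau>" "\<tau> \<le> t"
  shows "Hs_norm_sq a s (heat_flow a \<nu> W t) \<le> Hs_norm_sq a s (heat_flow a \<nu> W \<tau>)"
proof -
  have "t \<ge> 0" using assms by simp
  show ?thesis
    unfolding Hs_norm_sq_heat_flow[OF \<open>t \<ge> 0\<close>] Hs_norm_sq_heat_flow[OF assms(1)]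
    using assms \<nu> by (intro nn_integral_mono ennreal_leI mult_left_mono power_mono mult_right_mono)
      (auto intro!: mult_left_mono)
qed

text \<open>
Stated with a lower bound \<open>\<tau>\<close> for the times so that it covers two cases: \<open>\<tau> = 0\<close> in the Sobolev space of
the datum, and \<open>\<tau> > 0\<close> in the smaller space that the flow enters at once.
\<close>

lemma tendsto_heat_flow_diff:
  assumes \<tau>: "0 \<le> \<tau>" "\<tau> \<le> t" "\<And>j. \<tau> \<le> r j" and r: "r \<longlonglongrightarrow> t"
    and fin: "Hs_norm_sq a s (heat_flow a \<nu> W \<tau>) < \<infinity>"
  shows "(\<lambda>j. Hs_norm_sq a s (\<lambda>x. heat_flow a \<nu> W (r j) x - heat_flow a \<nu> W t x)) \<longlonglongrightarrow> 0"
proof -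
  have t: "0 \<le> t" and rj: "0 \<le> r j" for j using \<tau> order_trans by blast+
  let ?c = "\<lambda>\<xi>. norm (fourier_coeff a W \<xi>)"
  have "(\<lambda>j. \<integral>\<^sup>+ \<xi>. ennreal ((1 + \<xi>\<^sup>2) powr s * ((exp (- (\<nu> * \<xi>\<^sup>2 * r j)) - exp (- (\<nu> * \<xi>\<^sup>2 * t))) * ?c \<xi>)\<^sup>2) \<partial>count_space (torus_freqs a))
    \<longlonglongrightarrow> (\<integral>\<^sup>+ \<xi>. 0 \<partial>count_space (torus_freqs a))"
  proof (rule nn_integral_dominated_convergence[where w="\<lambda>\<xi>. ennreal ((1 + \<xi>\<^sup>2) powr s * (exp (- (\<nu> * \<xi>\<^sup>2 * \<tau>)) * ?c \<xi>)\<^sup>2)"])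
    show "(\<integral>\<^sup>+ \<xi>. ennreal ((1 + \<xi>\<^sup>2) powr s * (exp (- (\<nu> * \<xi>\<^sup>2 * \<tau>)) * ?c \<xi>)\<^sup>2) \<partial>count_space (torus_freqs a)) < \<infinity>"
      using fin by (simp add: Hs_norm_sq_heat_flow[OF \<tau>(1)])
    show "AE \<xi> in count_space (torus_freqs a). ennreal ((1 + \<xi>\<^sup>2) powr s * ((exp (- (\<nu> * \<xi>\<^sup>2 * r j)) - exp (- (\<nu> * \<xi>\<^sup>2 * t))) * ?c \<xi>)\<^sup>2)
       \<le> ennreal ((1 + \<xi>\<^sup>2) powr s * (exp (- (\<nu> * \<xi>\<^sup>2 * \<tau>)) * ?c \<xi>)\<^sup>2)" for j
    proof (intro AE_I2 ennreal_leI mult_left_mono)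
      fix \<xi>
      have e: "exp (- (\<nu> * \<xi>\<^sup>2 * r j)) \<le> exp (- (\<nu> * \<xi>\<^sup>2 * \<tau>))" "exp (- (\<nu> * \<xi>\<^sup>2 * t)) \<le> exp (- (\<nu> * \<xi>\<^sup>2 * \<tau>))"
        using \<tau> \<nu> by (auto intro!: mult_left_mono)
      have "\<bar>(exp (- (\<nu> * \<xi>\<^sup>2 * r j)) - exp (- (\<nu> * \<xi>\<^sup>2 * t))) * ?c \<xi>\<bar> \<le> exp (- (\<nu> * \<xi>\<^sup>2 * \<tau>)) * ?c \<xi>"
        unfolding abs_mult abs_norm_cancel
        using e exp_ge_zero[of "- (\<nu> * \<xi>\<^sup>2 * r j)"] exp_ge_zero[of "- (\<nu> * \<xi>\<^sup>2 * t)"]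
        by (intro mult_right_mono norm_ge_zero) linarith
      then show "((exp (- (\<nu> * \<xi>\<^sup>2 * r j)) - exp (- (\<nu> * \<xi>\<^sup>2 * t))) * ?c \<xi>)\<^sup>2 \<le> (exp (- (\<nu> * \<xi>\<^sup>2 * \<tau>)) * ?c \<xi>)\<^sup>2"
        by (metis abs_le_square_iff abs_of_nonneg exp_ge_zero mult_nonneg_nonneg norm_ge_zero)
    qed auto
    show "AE \<xi> in count_space (torus_freqs a). (\<lambda>j. ennreal ((1 + \<xi>\<^sup>2) powr s * ((exp (- (\<nu> * \<xi>\<^sup>2 * r j)) - exp (- (\<nu> * \<xi>\<^sup>2 * t))) * ?c \<xi>)\<^sup>2)) \<longlonglongrightarrow> 0"
    proof (intro AE_I2)
      fix \<xi>
      have "(\<lambda>j. (1 + \<xi>\<^sup>2) powr s * ((exp (- (\<nu> * \<xi>\<^sup>2 * r j)) - exp (- (\<nu> * \<xi>\<^sup>2 * t))) * ?c \<xi>)\<^sup>2) \<longlonglongrightarrow>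
         (1 + \<xi>\<^sup>2) powr s * ((exp (- (\<nu> * \<xi>\<^sup>2 * t)) - exp (- (\<nu> * \<xi>\<^sup>2 * t))) * ?c \<xi>)\<^sup>2"
        by (intro tendsto_mult tendsto_const tendsto_power tendsto_diff tendsto_exp tendsto_minus r)
      from tendsto_ennrealI[OF this]
      show "(\<lambda>j. ennreal ((1 + \<xi>\<^sup>2) powr s * ((exp (- (\<nu> * \<xi>\<^sup>2 * r j)) - exp (- (\<nu> * \<xi>\<^sup>2 * t))) * ?c \<xi>)\<^sup>2)) \<longlonglongrightarrow> 0"
        by simp
    qed
  qed auto
  then show ?thesis by (simp add: Hs_norm_sq_heat_flow_diff[OF t rj])
qed

lemma heat_flow_C_Hs:
  assumes "Hs_norm_sq a s W < \<infinity>"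
  shows "heat_flow a \<nu> W \<in> C_Hs a s"
  unfolding C_Hs_def
proof (intro CollectI allI impI conjI)
  have W0: "heat_flow a \<nu> W 0 = W" by (simp add: heat_flow_def)
  fix t :: real assume t: "t \<ge> 0"
  show "heat_flow a \<nu> W t \<in> Hs a s"
    using Hs_norm_sq_heat_flow_antimono[of 0 t s] t assms heat_flow_L2 by (auto simp: Hs_def W0 intro: le_less_trans)
  show "((\<lambda>r. Hs_norm_sq a s (\<lambda>x. heat_flow a \<nu> W r x - heat_flow a \<nu> W t x)) \<longlongrightarrow> 0) (at t within {0..})"
    unfolding tendsto_at_iff_sequentially comp_def
    using t assms by (auto intro!: tendsto_heat_flow_diff[of 0] simp: W0)
qed

lemma heat_flow_gains_derivative:
  assumes "Hs_norm_sq a s W < \<infinity>" and t: "t > 0"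
  shows "Hs_norm_sq a (s + 1) (heat_flow a \<nu> W t) < \<infinity>"
proof -
  define C where "C = max 1 (1 / (2 * \<nu> * t))"
  have C: "C \<ge> 0" by (simp add: C_def)
  have le: "(1 + \<xi>\<^sup>2) powr (s + 1) * (exp (- (\<nu> * \<xi>\<^sup>2 * t)) * c)\<^sup>2 \<le> C * ((1 + \<xi>\<^sup>2) powr s * c\<^sup>2)" for \<xi> c :: real
  proof -
    have p: "(1 + \<xi>\<^sup>2) powr (s + 1) = (1 + \<xi>\<^sup>2) powr s * (1 + \<xi>\<^sup>2)"
      by (simp add: powr_add add_pos_nonneg)
    have e: "(exp (- (\<nu> * \<xi>\<^sup>2 * t)))\<^sup>2 = exp (- ((2 * \<nu> * t) * \<xi>\<^sup>2))"
      by (simp add: power2_eq_square flip: exp_add)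
    have "(1 + \<xi>\<^sup>2) * exp (- ((2 * \<nu> * t) * \<xi>\<^sup>2)) \<le> C"
      unfolding C_def using \<nu> t by (intro one_plus_le_exp) auto
    then have "((1 + \<xi>\<^sup>2) * exp (- ((2 * \<nu> * t) * \<xi>\<^sup>2))) * ((1 + \<xi>\<^sup>2) powr s * c\<^sup>2) \<le> C * ((1 + \<xi>\<^sup>2) powr s * c\<^sup>2)"
      by (intro mult_right_mono) auto
    then show ?thesis unfolding p power_mult_distrib e by (simp only: mult_ac)
  qed
  have "Hs_norm_sq a (s + 1) (heat_flow a \<nu> W t) \<le> (\<integral>\<^sup>+ \<xi>. ennreal C * ennreal ((1 + (norm \<xi>)\<^sup>2) powr s * (norm (fourier_coeff a W \<xi>))\<^sup>2) \<partial>count_space (torus_freqs a))"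
    unfolding Hs_norm_sq_heat_flow[OF less_imp_le[OF t]]
    using C le by (intro nn_integral_mono) (simp flip: ennreal_mult)
  also have "\<dots> = ennreal C * Hs_norm_sq a s W"
    by (simp add: nn_integral_cmult Hs_norm_sq_def)
  also have "\<dots> < \<infinity>" using assms by (simp add: ennreal_mult_less_top)
  finally show ?thesis .
qed

end

lemma nn_integral_exp_decay:
  fixes l :: real
  assumes l: "l > 0"
  shows "(\<integral>\<^sup>+ t. ennreal (exp (- (l * t))) \<partial>lebesgue_on {0..}) = ennreal (1 / l)"
proof -
  have "(\<integral>\<^sup>+ t. ennreal (exp (- (l * t))) \<partial>lebesgue_on {0..}) =
     (\<integral>\<^sup>+ t. ennreal (exp (- (l * t))) * indicator {0..} t \<partial>lborel)"
    by (simp add: nn_integral_restrict_space nn_integral_completion)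
  also have "\<dots> = ennreal (0 - (- exp (- (l * 0)) / l))"
  proof (rule nn_integral_FTC_atLeast)
    show "((\<lambda>t. - exp (- (l * t)) / l) has_real_derivative exp (- (l * x))) (at x)" for x
      using l by (auto intro!: derivative_eq_intros)
    have "filterlim (\<lambda>t. l * t) at_top at_top"
      using l by (rule filterlim_tendsto_pos_mult_at_top[OF tendsto_const _ filterlim_ident])
    then have "((\<lambda>t. exp (- (l * t))) \<longlongrightarrow> 0) at_top"
      by (intro filterlim_compose[OF exp_at_bot] filterlim_compose[OF filterlim_uminus_at_bot_at_top])
    from tendsto_divide[OF tendsto_minus[OF this] tendsto_const, of l]
    show "((\<lambda>t. - exp (- (l * t)) / l) \<longlongrightarrow> 0) at_top" using l by simp
  qed auto
  finally show ?thesis by simp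
qed

text \<open>
On \<open>{0..}\<close> this takes finitely many values and converges pointwise to the identity. Rounding upwards
keeps the values positive, where the flow lies in the smaller Sobolev space.
\<close>

definition dyadic_above :: "nat \<Rightarrow> real \<Rightarrow> real" where
  "dyadic_above n t = (if t \<le> real n then (of_int \<lfloor>2 ^ n * t\<rfloor> + 1) / 2 ^ n else 1)"

lemma dyadic_above_pos: "t \<ge> 0 \<Longrightarrow> dyadic_above n t > 0"
  by (auto simp: dyadic_above_def intro!: divide_pos_pos add_nonneg_pos)

lemma dyadic_above_tendsto: "(\<lambda>n. dyadic_above n t) \<longlonglongrightarrow> t"
proof -
  have "(\<lambda>n. dyadic_above n t - t) \<longlonglongrightarrow> 0"
  proof (rule tendsto_0_le[where K=1])
    show "(\<lambda>n. (1 / 2 :: real) ^ n) \<longlonglongrightarrow> 0" by (intro LIMSEQ_power_zero) auto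
    obtain N where N: "t \<le> real N" using real_arch_simple by blast
    show "eventually (\<lambda>n. norm (dyadic_above n t - t) \<le> norm ((1 / 2 :: real) ^ n) * 1) sequentially"
      using eventually_ge_at_top[of N]
    proof eventually_elim
      case (elim n)
      have "of_int \<lfloor>2 ^ n * t\<rfloor> \<le> 2 ^ n * t" "2 ^ n * t < of_int \<lfloor>2 ^ n * t\<rfloor> + 1" by linarith+
      then have "\<bar>(of_int \<lfloor>2 ^ n * t\<rfloor> + 1) - 2 ^ n * t\<bar> \<le> 1" by linarith
      moreover have "dyadic_above n t - t = ((of_int \<lfloor>2 ^ n * t\<rfloor> + 1) - 2 ^ n * t) / 2 ^ n"
        using elim N by (simp add: dyadic_above_def field_simps)
      ultimately show ?case by (simp add: abs_divide divide_right_mono power_one_over)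
    qed
  qed
  then show ?thesis by (simp add: LIM_zero_iff)
qed

lemma simple_function_dyadic_above: "simple_function (lebesgue_on {0..}) (dyadic_above n)"
proof (rule simple_function_borel_measurable)
  have "dyadic_above n \<in> borel_measurable borel"
    unfolding dyadic_above_def by measurable
  then have "dyadic_above n \<in> borel_measurable lebesgue"
    by (simp add: measurable_completion)
  then show "dyadic_above n \<in> borel_measurable (lebesgue_on {0..})"
    by (rule measurable_restrict_space1)
  have "dyadic_above n ` {0..} \<subseteq> insert 1 ((\<lambda>k. (of_int k + 1) / 2 ^ n) ` {0..\<lfloor>2 ^ n * real n\<rfloor>})"
    by (auto simp: dyadic_above_def intro!: imageI floor_mono mult_left_mono)
  then show "finite (dyadic_above n ` space (lebesgue_on {0..}))"
    by (simp add: finite_subset)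
qed

text \<open>
The energy estimate, one mode at a time. The zero mean is indispensable: a nonzero coefficient at
frequency zero is constant in time and not square integrable over the half-line.
\<close>

lemma heat_flow_L2_Hs:
  assumes a: "a > 0" and \<nu>: "\<nu> > 0" and W: "W \<in> torus_L2 a"
    and fin: "Hs_norm_sq a s W < \<infinity>" and mean: "fourier_coeff a W 0 = 0"
  shows "heat_flow a \<nu> W \<in> L2_Hs a (s + 1)"
  unfolding L2_Hs_def
proof (intro CollectI conjI exI[of _ "\<lambda>n t. heat_flow a \<nu> W (dyadic_above n t)"] allI impI)
  note smooth = heat_flow_gains_derivative[OF a \<nu> W fin]
  show "simple_function (lebesgue_on {0..}) (\<lambda>t. heat_flow a \<nu> W (dyadic_above n t))" for n
    by (rule simple_function_compose1[OF simple_function_dyadic_above])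
  have Hs: "heat_flow a \<nu> W t \<in> Hs a (s + 1)" if "t > 0" for t
    using heat_flow_L2[OF a \<nu> W] smooth[OF that] by (simp add: Hs_def)
  then show "heat_flow a \<nu> W (dyadic_above n t) \<in> Hs a (s + 1)" if "t \<ge> 0" for n t
    using dyadic_above_pos[OF that] by simp
  have conv: "(\<lambda>n. Hs_norm_sq a (s + 1) (\<lambda>x. heat_flow a \<nu> W (dyadic_above n t) x - heat_flow a \<nu> W t x)) \<longlonglongrightarrow> 0"
    if t: "t > 0" for t
  proof -
    have "eventually (\<lambda>n. t / 2 < dyadic_above n t) sequentially"
      using order_tendstoD(1)[OF dyadic_above_tendsto, of "t / 2" t] t by simp
    then obtain N where N: "\<And>n. n \<ge> N \<Longrightarrow> t / 2 < dyadic_above n t" by (auto simp: eventually_sequentially)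
    have "(\<lambda>n. Hs_norm_sq a (s + 1) (\<lambda>x. heat_flow a \<nu> W (dyadic_above (n + N) t) x - heat_flow a \<nu> W t x)) \<longlonglongrightarrow> 0"
      using t N by (intro tendsto_heat_flow_diff[OF a \<nu> W, of "t / 2"] smooth LIMSEQ_ignore_initial_segment dyadic_above_tendsto)
        (auto intro: less_imp_le)
    then show ?thesis by (rule LIMSEQ_offset)
  qed
  have "AE t in lebesgue_on {0..}. t \<noteq> (0::real)"
  proof -
    have "AE t in lebesgue. t \<noteq> (0::real)"
      using AE_not_in[of "{0::real}" lebesgue] by (simp add: negligible_iff_null_sets[symmetric])
    then show ?thesis
      by (subst AE_restrict_space_iff) (auto elim: eventually_mono)
  qed
  moreover have "AE t in lebesgue_on {0..}. t \<ge> (0::real)"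
    by (simp add: AE_restrict_space_iff)
  ultimately show "AE t in lebesgue_on {0..}. heat_flow a \<nu> W t \<in> Hs a (s + 1) \<and>
     (\<lambda>n. Hs_norm_sq a (s + 1) (\<lambda>x. heat_flow a \<nu> W (dyadic_above n t) x - heat_flow a \<nu> W t x)) \<longlonglongrightarrow> 0"
    by eventually_elim (simp add: Hs conv)
  \<comment> \<open>\<open>(1 + \<xi>\<^sup>2) / \<xi>\<^sup>2 \<le> 1 + a\<^sup>2\<close> since nonzero frequencies satisfy \<open>\<bar>\<xi>\<bar> \<ge> 1 / a\<close>\<close>
  define C where "C = (1 + a\<^sup>2) / (2 * \<nu>)"
  have C: "C \<ge> 0" using \<nu> by (simp add: C_def)
  define c where "c n = norm (fourier_coeff a W (freq a n))" for n
  have modes: "(\<integral>\<^sup>+ t. ennreal ((1 + (freq a n)\<^sup>2) powr (s + 1) * (exp (- (\<nu> * (freq a n)\<^sup>2 * t)) * c n)\<^sup>2) \<partial>lebesgue_on {0..})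
      \<le> ennreal C * ennreal ((1 + (freq a n)\<^sup>2) powr s * (c n)\<^sup>2)" for n
  proof (cases "freq a n = 0")
    case True
    then show ?thesis using mean by (simp add: c_def)
  next
    case False
    define y where "y = (freq a n)\<^sup>2"
    have y: "y > 0" using False by (simp add: y_def)
    define A where "A = (1 + y) powr s * (1 + y) * (c n)\<^sup>2"
    have A: "A \<ge> 0" using y by (simp add: A_def)
    have "(\<integral>\<^sup>+ t. ennreal ((1 + y) powr (s + 1) * (exp (- (\<nu> * y * t)) * c n)\<^sup>2) \<partial>lebesgue_on {0..})
       = (\<integral>\<^sup>+ t. ennreal A * ennreal (exp (- ((2 * \<nu> * y) * t))) \<partial>lebesgue_on {0..})"
    proof (intro nn_integral_cong)
      fix t :: real
      have "(1 + y) powr (s + 1) * (exp (- (\<nu> * y * t)) * c n)\<^sup>2 = A * exp (- ((2 * \<nu> * y) * t))"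
        using y by (simp add: A_def powr_add power_mult_distrib power2_eq_square mult_ac flip: exp_add)
      then show "ennreal ((1 + y) powr (s + 1) * (exp (- (\<nu> * y * t)) * c n)\<^sup>2) = ennreal A * ennreal (exp (- ((2 * \<nu> * y) * t)))"
        using A by (simp only: ennreal_mult exp_ge_zero)
    qed
    also have "\<dots> = ennreal A * (\<integral>\<^sup>+ t. ennreal (exp (- ((2 * \<nu> * y) * t))) \<partial>lebesgue_on {0..})"
    proof (rule nn_integral_cmult)
      have "(\<lambda>t. exp (- ((2 * \<nu> * y) * t))) \<in> borel_measurable lebesgue"
        by (intro continuous_imp_lebesgue_measurable continuous_intros)
      from measurable_restrict_space1[OF this]
      show "(\<lambda>t. ennreal (exp (- ((2 * \<nu> * y) * t)))) \<in> borel_measurable (lebesgue_on {0..})"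
        by measurable
    qed
    also have "\<dots> = ennreal (A * (1 / (2 * \<nu> * y)))"
    proof -
      have "(\<integral>\<^sup>+ t. ennreal (exp (- ((2 * \<nu> * y) * t))) \<partial>lebesgue_on {0..}) = ennreal (1 / (2 * \<nu> * y))"
        by (rule nn_integral_exp_decay) (use y \<nu> in simp)
      moreover have "0 \<le> 1 / (2 * \<nu> * y)" using y \<nu> by simp
      ultimately show ?thesis using A by (simp only: ennreal_mult)
    qed
    also have "\<dots> \<le> ennreal (C * ((1 + y) powr s * (c n)\<^sup>2))"
    proof (rule ennreal_leI)
      have "(1 + y) / y \<le> 1 + a\<^sup>2"
      proof -
        have "int_decode n \<noteq> 0" using False by (auto simp: freq_def)
        then have "(1::int) \<le> (int_decode n)\<^sup>2" by (metis int_one_le_iff_zero_less zero_less_power2)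
        then have "(1::real) \<le> (of_int (int_decode n))\<^sup>2" by (metis of_int_1_le_iff of_int_power)
        then have "1 \<le> a\<^sup>2 * y" using a by (simp add: y_def freq_def power_divide)
        then show ?thesis using y by (simp add: divide_simps algebra_simps)
      qed
      then have "(1 + y) / y / (2 * \<nu>) \<le> C" using \<nu> unfolding C_def by (intro divide_right_mono) auto
      then have "((1 + y) / y / (2 * \<nu>)) * ((1 + y) powr s * (c n)\<^sup>2) \<le> C * ((1 + y) powr s * (c n)\<^sup>2)"
        by (intro mult_right_mono) auto
      then show "A * (1 / (2 * \<nu> * y)) \<le> C * ((1 + y) powr s * (c n)\<^sup>2)"
        by (simp add: A_def mult_ac)
    qed
    finally show ?thesis using C by (simp add: y_def ennreal_mult)
  qed
  have "(\<integral>\<^sup>+ t. Hs_norm_sq a (s + 1) (heat_flow a \<nu> W t) \<partial>lebesgue_on {0..}) =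
    (\<integral>\<^sup>+ t. (\<Sum>n. ennreal ((1 + (freq a n)\<^sup>2) powr (s + 1) * (exp (- (\<nu> * (freq a n)\<^sup>2 * t)) * c n)\<^sup>2)) \<partial>lebesgue_on {0..})"
    by (intro nn_integral_cong)
       (simp add: Hs_norm_sq_suminf[OF a] fourier_coeff_heat_flow[OF a \<nu> W] freq_in_torus_freqs[OF a] norm_mult c_def)
  also have "\<dots> = (\<Sum>n. \<integral>\<^sup>+ t. ennreal ((1 + (freq a n)\<^sup>2) powr (s + 1) * (exp (- (\<nu> * (freq a n)\<^sup>2 * t)) * c n)\<^sup>2) \<partial>lebesgue_on {0..})"
  proof (rule nn_integral_suminf)
    fix n
    have "(\<lambda>t. (1 + (freq a n)\<^sup>2) powr (s + 1) * (exp (- (\<nu> * (freq a n)\<^sup>2 * t)) * c n)\<^sup>2) \<in> borel_measurable lebesgue"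
      by (intro continuous_imp_lebesgue_measurable continuous_intros)
    from measurable_restrict_space1[OF this]
    show "(\<lambda>t. ennreal ((1 + (freq a n)\<^sup>2) powr (s + 1) * (exp (- (\<nu> * (freq a n)\<^sup>2 * t)) * c n)\<^sup>2)) \<in> borel_measurable (lebesgue_on {0..})"
      by measurable
  qed
  also have "\<dots> \<le> (\<Sum>n. ennreal C * ennreal ((1 + (freq a n)\<^sup>2) powr s * (c n)\<^sup>2))"
    by (intro suminf_le modes) auto
  also have "\<dots> = ennreal C * Hs_norm_sq a s W"
    by (simp add: Hs_norm_sq_suminf[OF a] c_def)
  also have "\<dots> < \<infinity>" using fin by (simp add: ennreal_mult_less_top)
  finally show "(\<integral>\<^sup>+ t. Hs_norm_sq a (s + 1) (heat_flow a \<nu> W t) \<partial>lebesgue_on {0..}) < \<infinity>" .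
qed

section \<open>Weak solutions of the heat equation\<close>

lemma fourier_coeff_eq_integral:
  fixes f :: "real \<Rightarrow> real"
  assumes "a > 0" "continuous_on {0..2 * pi * a} f"
  shows "fourier_coeff a f \<xi> = integral (cbox 0 (2 * pi * a)) (\<lambda>x. of_real (f x) * cis (- (\<xi> * x))) / of_real (2 * pi * a)"
proof -
  have "set_integrable lebesgue {0..2 * pi * a} (\<lambda>x. of_real (f x) * cis (- (\<xi> * x)))"
    by (intro set_integrable_continuous_Icc continuous_intros assms)
  from set_lebesgue_integral_eq_integral(2)[OF this] show ?thesis
    using assms(1) by (simp add: fourier_coeff_real torus_cell_real cbox_interval)
qed

lemma continuous_on_section:
  "continuous_on UNIV F \<Longrightarrow> continuous_on S (\<lambda>x. F (r, x))"
  by (rule continuous_on_compose2[of UNIV F]) (auto intro!: continuous_intros)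

lemma continuous_on_fourier_coeff_param:
  fixes F :: "real \<times> real \<Rightarrow> real"
  assumes a: "a > 0" and F: "continuous_on UNIV F"
  shows "continuous_on S (\<lambda>r. fourier_coeff a (\<lambda>x. F (r, x)) \<xi>)"
proof -
  have "continuous_on (S \<times> cbox 0 (2 * pi * a)) (\<lambda>(r, x). of_real (F (r, x)) * cis (- (\<xi> * x)))"
    unfolding split_beta prod.collapse
    by (intro continuous_intros continuous_on_subset[OF F]) auto
  from integral_continuous_on_param[OF this] show ?thesis
    using a unfolding fourier_coeff_eq_integral[OF a continuous_on_section[OF F]]
    by (intro continuous_on_divide continuous_on_const) auto
qed

lemma fourier_coeff_has_vector_derivative:
  fixes F F' :: "real \<times> real \<Rightarrow> real"
  assumes a: "a > 0" and F: "continuous_on UNIV F" and F': "continuous_on UNIV F'"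
    and d: "\<And>r x. ((\<lambda>r. F (r, x)) has_real_derivative F' (r, x)) (at r)"
  shows "((\<lambda>r. fourier_coeff a (\<lambda>x. F (r, x)) \<xi>) has_vector_derivative fourier_coeff a (\<lambda>x. F' (r, x)) \<xi>) (at r within S)"
proof -
  have "((\<lambda>r. integral (cbox 0 (2 * pi * a)) (\<lambda>x. of_real (F (r, x)) * cis (- (\<xi> * x)))) has_vector_derivative
      integral (cbox 0 (2 * pi * a)) (\<lambda>x. of_real (F' (r, x)) * cis (- (\<xi> * x)))) (at r within UNIV)"
  proof (rule leibniz_rule_vector_derivative)
    fix r x :: real
    have "((\<lambda>r. complex_of_real (F (r, x))) has_vector_derivative of_real (F' (r, x))) (at r within UNIV)"
      using d by (intro has_vector_derivative_of_real) (simp add: has_real_derivative_iff_has_vector_derivative)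
    from has_vector_derivative_mult_left[OF this]
    show "((\<lambda>r. of_real (F (r, x)) * cis (- (\<xi> * x))) has_vector_derivative of_real (F' (r, x)) * cis (- (\<xi> * x))) (at r within UNIV)" .
  next
    fix r :: real
    show "(\<lambda>x. of_real (F (r, x)) * cis (- (\<xi> * x))) integrable_on cbox 0 (2 * pi * a)"
      by (intro integrable_continuous continuous_intros continuous_on_section F)
  next
    show "continuous_on (UNIV \<times> cbox 0 (2 * pi * a)) (\<lambda>(r, x). of_real (F' (r, x)) * cis (- (\<xi> * x)))"
      unfolding split_beta prod.collapse
      by (intro continuous_intros continuous_on_subset[OF F']) auto
  qed auto
  from has_vector_derivative_at_within[OF has_vector_derivative_divide[OF this, of "of_real (2 * pi * a)"], of S]
  show ?thesis
    unfolding fourier_coeff_eq_integral[OF a continuous_on_section[OF F]] fourier_coeff_eq_integral[OF a continuous_on_section[OF F']] .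
qed

text \<open>
Pairing the flow with \<open>\<Psi>\<close> gives the sum of \<open>S n r\<close> over the modes \<open>n\<close>, pairing it with
\<open>G = \<partial>\<^sub>t \<Psi> + \<nu> \<partial>\<^sub>x\<^sup>2 \<Psi>\<close> gives the sum of \<open>R n r\<close>, and \<open>R n\<close> is the derivative of \<open>S n\<close>. The
regularity of \<open>G\<close> in space bounds \<open>R n r\<close> by a summable sequence uniformly for \<open>r\<close> in \<open>{0..t}\<close>.
\<close>

lemma weak_heat_solution_heat_flow:
  assumes a: "a > 0" and \<nu>: "\<nu> > 0" and W: "W \<in> torus_L2 a"
  shows "weak_heat_solution a \<nu> (heat_flow a \<nu> W)"
  unfolding weak_heat_solution_def
proof (intro allI impI, elim conjE)
  fix \<Psi> :: "real \<times> real \<Rightarrow> real" and t :: real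
  assume \<Psi>: "C_infinity \<Psi>" and per: "\<forall>t. torus_periodic a (\<lambda>x. \<Psi> (t, x))" and t: "0 \<le> t"
  obtain \<Psi>t \<Psi>x where P1: "C_infinity \<Psi>t" "C_infinity \<Psi>x"
    "\<And>t x. ((\<lambda>r. \<Psi> (r, x)) has_real_derivative \<Psi>t (t, x)) (at t)"
    "\<And>t x. ((\<lambda>y. \<Psi> (t, y)) has_real_derivative \<Psi>x (t, x)) (at x)"
    by (rule C_infinity_partials[OF \<Psi>], rule that)
  obtain \<Psi>xx where Pxx: "C_infinity \<Psi>xx" "\<And>t x. ((\<lambda>y. \<Psi>x (t, y)) has_real_derivative \<Psi>xx (t, x)) (at x)"
    by (rule C_infinity_partial_snd[OF P1(2)], rule that)
  \<comment> \<open>four space derivatives of \<open>\<Psi>\<close> are needed since \<open>G\<close> contains two and has to have two more\<close>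
  obtain \<Psi>xxx where Pxxx: "C_infinity \<Psi>xxx" "\<And>t x. ((\<lambda>y. \<Psi>xx (t, y)) has_real_derivative \<Psi>xxx (t, x)) (at x)"
    by (rule C_infinity_partial_snd[OF Pxx(1)], rule that)
  obtain \<Psi>xxxx where Pxxxx: "C_infinity \<Psi>xxxx" "\<And>t x. ((\<lambda>y. \<Psi>xxx (t, y)) has_real_derivative \<Psi>xxxx (t, x)) (at x)"
    by (rule C_infinity_partial_snd[OF Pxxx(1)], rule that)
  obtain \<Psi>tx where Ptx: "C_infinity \<Psi>tx" "\<And>t x. ((\<lambda>y. \<Psi>t (t, y)) has_real_derivative \<Psi>tx (t, x)) (at x)"
    by (rule C_infinity_partial_snd[OF P1(1)], rule that)
  obtain \<Psi>txx where Ptxx: "C_infinity \<Psi>txx" "\<And>t x. ((\<lambda>y. \<Psi>tx (t, y)) has_real_derivative \<Psi>txx (t, x)) (at x)"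
    by (rule C_infinity_partial_snd[OF Ptx(1)], rule that)
  note cont = C_infinity_continuous[OF \<Psi>] C_infinity_continuous[OF P1(1)] C_infinity_continuous[OF Pxx(1)]
    C_infinity_continuous[OF Ptxx(1)] C_infinity_continuous[OF Pxxxx(1)]
  define G where "G z = \<Psi>t z + \<nu> * \<Psi>xx z" for z
  define G' where "G' z = \<Psi>tx z + \<nu> * \<Psi>xxx z" for z
  define G'' where "G'' z = \<Psi>txx z + \<nu> * \<Psi>xxxx z" for z
  have G1: "((\<lambda>y. G (r, y)) has_real_derivative G' (r, x)) (at x)" for r x
    unfolding G_def G'_def by (intro DERIV_add DERIV_cmult Ptx Pxxx)
  have G2: "((\<lambda>y. G' (r, y)) has_real_derivative G'' (r, x)) (at x)" for r x
    unfolding G'_def G''_def by (intro DERIV_add DERIV_cmult Ptxx Pxxxx)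
  have contG: "continuous_on S G" "continuous_on S G''" for S
    unfolding G_def G''_def by (intro continuous_intros cont)+
  have per_x: "torus_periodic a (\<lambda>x. \<Psi>xx (r, x))" for r
    by (rule periodic_derivative[OF periodic_derivative[OF per[rule_format] P1(4)] Pxx(2)])
  have per_t: "torus_periodic a (\<lambda>x. \<Psi>t (r, x))" for r
    unfolding torus_periodic_real_iff
  proof
    fix x
    have "(\<lambda>r. \<Psi> (r, x + 2 * pi * a)) = (\<lambda>r. \<Psi> (r, x))"
      using per by (simp add: torus_periodic_real_iff)
    then have "((\<lambda>r. \<Psi> (r, x)) has_real_derivative \<Psi>t (r, x + 2 * pi * a)) (at r)"
      using P1(3)[of "x + 2 * pi * a" r] by (simp only:)
    then show "\<Psi>t (r, x + 2 * pi * a) = \<Psi>t (r, x)"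
      using P1(3)[of x r] by (rule DERIV_unique)
  qed
  have perG: "torus_periodic a (\<lambda>x. G (r, x))" for r
    using per_x[of r] per_t[of r] by (simp add: G_def torus_periodic_real_iff)
  have integrand: "deriv (\<lambda>r. \<Psi> (r, x)) r + \<nu> * (deriv ^^ 2) (\<lambda>y. \<Psi> (r, y)) x = G (r, x)" for r x
  proof -
    have "deriv (\<lambda>y. \<Psi> (r, y)) = (\<lambda>y. \<Psi>x (r, y))" by (rule ext) (rule DERIV_imp_deriv[OF P1(4)])
    moreover have "deriv (\<lambda>y. \<Psi>x (r, y)) x = \<Psi>xx (r, x)" by (rule DERIV_imp_deriv[OF Pxx(2)])
    moreover have "deriv (\<lambda>r. \<Psi> (r, x)) r = \<Psi>t (r, x)" by (rule DERIV_imp_deriv[OF P1(3)])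
    ultimately show ?thesis by (simp add: numeral_2_eq_2 G_def)
  qed
  define \<kappa> where "\<kappa> n = freq a n" for n
  have \<kappa>: "\<kappa> n \<in> torus_freqs a" for n by (simp add: \<kappa>_def freq_in_torus_freqs[OF a])
  define c where "c n = fourier_coeff a W (\<kappa> n)" for n
  define \<psi> where "\<psi> n r = fourier_coeff a (\<lambda>x. \<Psi> (r, x)) (\<kappa> n)" for n r
  define \<gamma> where "\<gamma> n r = fourier_coeff a (\<lambda>x. G (r, x)) (\<kappa> n)" for n r
  define e where "e n r = exp (- (\<nu> * (\<kappa> n)\<^sup>2 * r))" for n r
  define S where "S n r = e n r * Re (\<psi> n r * cnj (c n))" for n r
  define R where "R n r = e n r * Re (\<gamma> n r * cnj (c n))" for n r
  have coeff: "cnj (fourier_coeff a (heat_flow a \<nu> W r) (freq a n)) = of_real (e n r) * cnj (c n)" if "r \<ge> 0" for n r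
    using fourier_coeff_heat_flow[OF a \<nu> W that \<kappa>] by (simp add: e_def c_def \<kappa>_def)
  have pair: "(LINT x:torus_cell a|lebesgue. heat_flow a \<nu> W r x * \<Psi> (r, x)) = 2 * pi * a * (\<Sum>n. S n r)" "summable (\<lambda>n. S n r)"
    if r: "r \<ge> 0" for r
  proof -
    have eq: "Re (\<psi> n r * cnj (fourier_coeff a (heat_flow a \<nu> W r) (freq a n))) = S n r" for n
      unfolding coeff[OF r] S_def by (simp add: algebra_simps)
    note * = a torus_L2_integrable[OF heat_flow_L2[OF a \<nu> W]] per[rule_format] P1(4) Pxx(2)
      continuous_on_section[OF cont(3)]
    have "(LINT x:torus_cell a|lebesgue. heat_flow a \<nu> W r x * \<Psi> (r, x)) =
      2 * pi * a * (\<Sum>n. Re (\<psi> n r * cnj (fourier_coeff a (heat_flow a \<nu> W r) (freq a n))))"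
      unfolding \<psi>_def \<kappa>_def by (rule integral_mult_twice_differentiable(1)[OF *])
    then show "(LINT x:torus_cell a|lebesgue. heat_flow a \<nu> W r x * \<Psi> (r, x)) = 2 * pi * a * (\<Sum>n. S n r)"
      unfolding eq .
    have "summable (\<lambda>n. Re (\<psi> n r * cnj (fourier_coeff a (heat_flow a \<nu> W r) (freq a n))))"
      unfolding \<psi>_def \<kappa>_def by (rule integral_mult_twice_differentiable(2)[OF *])
    then show "summable (\<lambda>n. S n r)" unfolding eq .
  qed
  have pairG: "(LINT x:torus_cell a|lebesgue. heat_flow a \<nu> W r x * G (r, x)) = 2 * pi * a * (\<Sum>n. R n r)"
    if r: "r \<ge> 0" for r
  proof -
    have eq: "Re (\<gamma> n r * cnj (fourier_coeff a (heat_flow a \<nu> W r) (freq a n))) = R n r" for n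
      unfolding coeff[OF r] R_def by (simp add: algebra_simps)
    have "(LINT x:torus_cell a|lebesgue. heat_flow a \<nu> W r x * G (r, x)) =
      2 * pi * a * (\<Sum>n. Re (\<gamma> n r * cnj (fourier_coeff a (heat_flow a \<nu> W r) (freq a n))))"
      unfolding \<gamma>_def \<kappa>_def
      by (rule integral_mult_twice_differentiable(1)[OF a torus_L2_integrable[OF heat_flow_L2[OF a \<nu> W]]
          perG G1 G2 continuous_on_section[OF contG(2)]])
    then show ?thesis unfolding eq .
  qed
  have contR: "continuous_on T (R n)" for n T
    unfolding R_def e_def \<gamma>_def by (intro continuous_intros continuous_on_fourier_coeff_param[OF a contG(1)])
  have S': "(S n has_vector_derivative R n r) (at r within {0..t})" for n r
  proof -
    let ?\<beta> = "fourier_coeff a (\<lambda>x. \<Psi>t (r, x)) (\<kappa> n)"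
    have int: "set_integrable lebesgue (torus_cell a) (\<lambda>x. F (r, x))" if "continuous_on UNIV F" for F :: "real \<times> real \<Rightarrow> real"
      unfolding torus_cell_real by (intro set_integrable_continuous_Icc continuous_on_section that)
    have "fourier_coeff a (\<lambda>x. \<nu> * \<Psi>xx (r, x)) (\<kappa> n) = of_real \<nu> * fourier_coeff a (\<lambda>x. \<Psi>xx (r, x)) (\<kappa> n)"
      by (simp add: fourier_coeff_def mult.assoc)
    moreover have "fourier_coeff a (\<lambda>x. \<Psi>xx (r, x)) (\<kappa> n) = - of_real ((\<kappa> n)\<^sup>2) * \<psi> n r"
      unfolding \<psi>_def
      by (rule fourier_coeff_second_derivative[OF a \<kappa> per[rule_format] P1(4) Pxx(2) continuous_on_section[OF cont(3)]])
    moreover have "\<gamma> n r = ?\<beta> + fourier_coeff a (\<lambda>x. \<nu> * \<Psi>xx (r, x)) (\<kappa> n)"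
      unfolding \<gamma>_def G_def
      by (rule fourier_coeff_add[OF int[OF cont(2)] set_integrable_mult_right[OF int[OF cont(3)]]])
    ultimately have \<gamma>: "\<gamma> n r = ?\<beta> - of_real (\<nu> * (\<kappa> n)\<^sup>2) * \<psi> n r"
      by (simp add: mult.assoc)
    have "((\<lambda>r. \<psi> n r * cnj (c n)) has_vector_derivative ?\<beta> * cnj (c n)) (at r within {0..t})"
      unfolding \<psi>_def
      by (intro has_vector_derivative_mult_left fourier_coeff_has_vector_derivative[OF a cont(1,2) P1(3)])
    from bounded_linear.has_vector_derivative[OF bounded_linear_Re this]
    have "((\<lambda>r. Re (\<psi> n r * cnj (c n))) has_real_derivative Re (?\<beta> * cnj (c n))) (at r within {0..t})"
      by (simp add: has_real_derivative_iff_has_vector_derivative)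
    moreover have "(e n has_real_derivative (- (\<nu> * (\<kappa> n)\<^sup>2) * e n r)) (at r within {0..t})"
      unfolding e_def by (auto intro!: derivative_eq_intros)
    ultimately have "(S n has_real_derivative (- (\<nu> * (\<kappa> n)\<^sup>2) * e n r) * Re (\<psi> n r * cnj (c n)) + Re (?\<beta> * cnj (c n)) * e n r) (at r within {0..t})"
      unfolding S_def by (rule DERIV_mult[rotated])
    moreover have "(- (\<nu> * (\<kappa> n)\<^sup>2) * e n r) * Re (\<psi> n r * cnj (c n)) + Re (?\<beta> * cnj (c n)) * e n r = R n r"
      unfolding R_def \<gamma> by (simp add: algebra_simps)
    ultimately show ?thesis by (simp add: has_real_derivative_iff_has_vector_derivative)
  qed
  have FTC: "(LINT r:{0..t}|lebesgue. R n r) = S n t - S n 0" for n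
    by (rule set_integral_FTC[OF t contR S'])
  define M where "M = (LINT x:torus_cell a|lebesgue. \<bar>W x\<bar>) / (2 * pi * a)"
  have M: "norm (c n) \<le> M" for n
    unfolding M_def c_def by (rule norm_fourier_coeff_le[OF a torus_L2_integrable[OF W]])
  have "compact ((\<lambda>z. \<bar>G z\<bar> + \<bar>G'' z\<bar>) ` ({0..t} \<times> {0..2 * pi * a}))"
    by (intro compact_continuous_image continuous_intros contG compact_Times) auto
  then obtain B where B0: "\<forall>y\<in>(\<lambda>z. \<bar>G z\<bar> + \<bar>G'' z\<bar>) ` ({0..t} \<times> {0..2 * pi * a}). norm y \<le> B"
    using compact_imp_bounded bounded_iff by metis
  have B: "\<bar>G (r, x)\<bar> + \<bar>G'' (r, x)\<bar> \<le> B" if "r \<in> {0..t}" "x \<in> torus_cell a" for r x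
    using bspec[OF B0, of "\<bar>G (r, x)\<bar> + \<bar>G'' (r, x)\<bar>"] that by (force simp: torus_cell_real)
  have \<gamma>_le: "norm (\<gamma> n r) \<le> B * (1 / (1 + (\<kappa> n)\<^sup>2))" if "r \<in> {0..t}" for n r
    unfolding \<gamma>_def
    by (rule norm_fourier_coeff_twice_differentiable_le[OF a \<kappa> perG G1 G2 continuous_on_section[OF contG(2)] B[OF that]])
  have R_le: "norm (R n r) \<le> (B * (1 / (1 + (\<kappa> n)\<^sup>2)) * M) * 1" if r: "r \<in> {0..t}" for n r
  proof -
    have "e n r \<le> 1" using r \<nu> by (simp add: e_def)
    then have "norm (R n r) \<le> 1 * \<bar>Re (\<gamma> n r * cnj (c n))\<bar>"
      unfolding R_def real_norm_def abs_mult by (intro mult_right_mono) (auto simp: e_def)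
    also have "\<dots> \<le> norm (\<gamma> n r) * norm (c n)"
      using abs_Re_le_cmod[of "\<gamma> n r * cnj (c n)"] by (simp only: mult_1 norm_mult complex_mod_cnj)
    also have "\<dots> \<le> B * (1 / (1 + (\<kappa> n)\<^sup>2)) * M"
      using \<gamma>_le[OF r, of n] M[of n] by (intro mult_mono) (auto intro: order_trans[OF norm_ge_zero])
    finally show ?thesis by simp
  qed
  have "(\<lambda>n. LINT r:{0..t}|lebesgue. R n r) sums (LINT r:{0..t}|lebesgue. (\<Sum>n. R n r))"
  proof (rule set_integral_sums_dominated(1)[OF _ _ R_le])
    show "summable (\<lambda>n. B * (1 / (1 + (\<kappa> n)\<^sup>2)) * M)"
      unfolding \<kappa>_def by (intro summable_mult2 summable_mult summable_inverse_freq a)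
  qed (auto intro!: set_integrable_continuous_Icc contR)
  then have "(LINT r:{0..t}|lebesgue. (\<Sum>n. R n r)) = (\<Sum>n. S n t - S n 0)"
    unfolding FTC by (rule sums_unique)
  also have "\<dots> = (\<Sum>n. S n t) - (\<Sum>n. S n 0)"
    using pair(2)[OF t] pair(2)[of 0] by (simp add: suminf_diff)
  finally have *: "(\<Sum>n. S n t) = (\<Sum>n. S n 0) + (LINT r:{0..t}|lebesgue. (\<Sum>n. R n r))" by simp
  have "(LINT r:{0..t}|lebesgue. LINT x:torus_cell a|lebesgue. heat_flow a \<nu> W r x *
      (deriv (\<lambda>r. \<Psi> (r, x)) r + \<nu> * (deriv ^^ 2) (\<lambda>y. \<Psi> (r, y)) x)) =
    (LINT r:{0..t}|lebesgue. 2 * pi * a * (\<Sum>n. R n r))"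
    unfolding integrand by (intro set_lebesgue_integral_cong) (auto simp: pairG)
  also have "\<dots> = 2 * pi * a * (LINT r:{0..t}|lebesgue. (\<Sum>n. R n r))" by (rule set_integral_mult_right)
  finally show "(LINT x:torus_cell a|lebesgue. heat_flow a \<nu> W t x * \<Psi> (t, x)) =
      (LINT x:torus_cell a|lebesgue. heat_flow a \<nu> W 0 x * \<Psi> (0, x)) +
      (LINT r:{0..t}|lebesgue. LINT x:torus_cell a|lebesgue. heat_flow a \<nu> W r x *
        (deriv (\<lambda>r. \<Psi> (r, x)) r + \<nu> * (deriv ^^ 2) (\<lambda>y. \<Psi> (r, y)) x))"
    unfolding pair(1)[OF t] pair(1)[OF order_refl] * by (simp add: distrib_left)
qed

lemma cos_sin_torus_freq:
  assumes "a > 0" "\<xi> \<in> torus_freqs a"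
  shows "cos (\<xi> * (x + 2 * pi * a)) = cos (\<xi> * x)" "sin (\<xi> * (x + 2 * pi * a)) = sin (\<xi> * x)"
proof -
  have "cis (\<xi> * (x + 2 * pi * a)) = cis (\<xi> * x)"
    using cis_torus_freq[OF assms] by (simp add: distrib_left flip: cis_mult)
  then show "cos (\<xi> * (x + 2 * pi * a)) = cos (\<xi> * x)" "sin (\<xi> * (x + 2 * pi * a)) = sin (\<xi> * x)"
    by (simp_all add: complex_eq_iff)
qed

text \<open>
The test function \<open>exp (\<nu> \<xi>\<^sup>2 t) h x\<close>, with \<open>h\<close> a combination of \<open>cos (\<xi> x)\<close> and \<open>sin (\<xi> x)\<close>, is
annihilated by the adjoint heat operator, so its pairing with a weak solution is constant in time.
\<close>

lemma weak_heat_solution_fourier_coeff: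
  assumes a: "a > 0" and \<xi>: "\<xi> \<in> torus_freqs a" and u: "weak_heat_solution a \<nu> u"
    and L2: "\<And>t. t \<ge> 0 \<Longrightarrow> u t \<in> torus_L2 a" and t: "t \<ge> 0"
  shows "fourier_coeff a (u t) \<xi> = of_real (exp (- (\<nu> * \<xi>\<^sup>2 * t))) * fourier_coeff a (u 0) \<xi>"
proof -
  define l where "l = \<nu> * \<xi>\<^sup>2"
  have key: "exp (l * t) * (LINT x:torus_cell a|lebesgue. u t x * (\<alpha> * cos (\<xi> * x) + \<beta> * sin (\<xi> * x))) =
     (LINT x:torus_cell a|lebesgue. u 0 x * (\<alpha> * cos (\<xi> * x) + \<beta> * sin (\<xi> * x)))" for \<alpha> \<beta>
  proof -
    define h where "h x = \<alpha> * cos (\<xi> * x) + \<beta> * sin (\<xi> * x)" for x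
    define h' where "h' x = \<xi> * (\<beta> * cos (\<xi> * x) - \<alpha> * sin (\<xi> * x))" for x
    define \<Psi> where "\<Psi> = (\<lambda>z. exp ((l, 0) \<bullet> z) * (\<alpha> * cos ((0, \<xi>) \<bullet> z) + \<beta> * sin ((0, \<xi>) \<bullet> z)))"
    have \<Psi>: "\<Psi> (r, x) = exp (l * r) * h x" for r x by (simp add: \<Psi>_def h_def)
    have C: "C_infinity \<Psi>" unfolding \<Psi>_def by (rule C_infinity_exp_trig)
    have per: "\<forall>r. torus_periodic a (\<lambda>x. \<Psi> (r, x))"
      by (simp add: torus_periodic_real_iff \<Psi> h_def cos_sin_torus_freq[OF a \<xi>])
    have "deriv (\<lambda>r. \<Psi> (r, x)) r = l * \<Psi> (r, x)" for r x
      by (rule DERIV_imp_deriv) (auto simp: \<Psi> intro!: derivative_eq_intros)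
    moreover have "\<nu> * (deriv ^^ 2) (\<lambda>y. \<Psi> (r, y)) x = - (l * \<Psi> (r, x))" for r x
    proof -
      have "deriv (\<lambda>y. \<Psi> (r, y)) = (\<lambda>y. exp (l * r) * h' y)"
        by (rule ext, rule DERIV_imp_deriv)
           (auto simp: \<Psi> h_def h'_def algebra_simps intro!: derivative_eq_intros)
      moreover have "deriv (\<lambda>y. exp (l * r) * h' y) x = exp (l * r) * (- \<xi>\<^sup>2 * h x)"
        by (rule DERIV_imp_deriv)
           (auto simp: h_def h'_def algebra_simps power2_eq_square intro!: derivative_eq_intros)
      ultimately show ?thesis by (simp add: numeral_2_eq_2 \<Psi> l_def)
    qed
    ultimately have 0: "deriv (\<lambda>r. \<Psi> (r, x)) r + \<nu> * (deriv ^^ 2) (\<lambda>y. \<Psi> (r, y)) x = 0" for r x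
      by (simp only: add.right_inverse)
    have "(LINT x:torus_cell a|lebesgue. u t x * \<Psi> (t, x)) = (LINT x:torus_cell a|lebesgue. u 0 x * \<Psi> (0, x))"
      using u[unfolded weak_heat_solution_def, rule_format, OF conjI[OF C per] t]
      unfolding 0 by (simp add: set_lebesgue_integral_def)
    then have "(LINT x:torus_cell a|lebesgue. exp (l * t) * (u t x * h x)) = (LINT x:torus_cell a|lebesgue. u 0 x * h x)"
      by (simp add: \<Psi> mult_ac)
    then show ?thesis by (simp add: h_def)
  qed
  have c: "exp (l * t) * (LINT x:torus_cell a|lebesgue. u t x * cos (\<xi> * x)) = (LINT x:torus_cell a|lebesgue. u 0 x * cos (\<xi> * x))"
    and s: "exp (l * t) * (LINT x:torus_cell a|lebesgue. u t x * sin (\<xi> * x)) = (LINT x:torus_cell a|lebesgue. u 0 x * sin (\<xi> * x))"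
    using key[of 1 0] key[of 0 1] by simp_all
  have "of_real (exp (l * t)) * fourier_coeff a (u t) \<xi> = fourier_coeff a (u 0) \<xi>"
    unfolding fourier_coeff_cos_sin[OF torus_L2_integrable[OF L2[OF t]]]
      fourier_coeff_cos_sin[OF torus_L2_integrable[OF L2[OF order_refl]]] inner_real_def
      c[symmetric] s[symmetric]
    by (simp add: algebra_simps add_divide_distrib diff_divide_distrib)
  moreover have "complex_of_real (exp (- (l * t))) * of_real (exp (l * t)) = 1"
    by (simp add: exp_minus flip: of_real_mult)
  ultimately show ?thesis
    unfolding l_def[symmetric] by (metis mult.assoc mult_1)
qed

section \<open>The horizontal average\<close>

context
  fixes a1 a2 a3 :: real and U0 :: "(real \<times> real) \<times> real \<Rightarrow> real ^ 4"
  assumes a1: "a1 > 0" and a2: "a2 > 0" and a3: "a3 > 0"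
    and U0: "\<And>i. (\<lambda>x. U0 x $ i) \<in> torus_L2 ((a1, a2), a3)"
begin

abbreviation (input) "average \<equiv> horizontal_average a1 a2 U0"

abbreviation (input) "cell_h \<equiv> torus_cell (a1, a2)"

lemma measure_cell_h: "measure lebesgue cell_h = 4 * pi\<^sup>2 * a1 * a2"
  using a1 a2 by (simp add: measure_torus_cell_Pair measure_torus_cell_real power2_eq_square)

lemma U0_integrable: "set_integrable lebesgue (cell_h \<times> torus_cell a3) (\<lambda>x. U0 x $ i)"
  using torus_L2_integrable[OF U0[of i]] by (simp add: torus_cell_Pair)

text \<open>
Where some component of the section is not integrable, the vector-valued integral is zero in all
components, so the average can be computed componentwise only almost everywhere.
\<close>

lemma AE_average_nth:
  "AE x in lebesgue. x \<in> torus_cell a3 \<longrightarrow>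
     average x $ i = (LINT y:cell_h|lebesgue. U0 (y, x) $ i) / (4 * pi\<^sup>2 * a1 * a2)"
proof -
  have "AE x in lebesgue. \<forall>i. x \<in> torus_cell a3 \<longrightarrow> set_integrable lebesgue cell_h (\<lambda>y. U0 (y, x) $ i)"
    unfolding AE_all_countable using AE_set_integrable_section[OF U0_integrable] by blast
  then show ?thesis
    by eventually_elim (simp add: horizontal_average_def set_integral_vec_nth)
qed

lemma average_periodic: "torus_periodic a3 (\<lambda>x. average x $ i)"
proof -
  have "U0 (y, x + 2 * pi * a3) $ j = U0 (y, x) $ j" for x y j
    using torus_periodic_Pair[of "(a1, a2)" a3 "\<lambda>x. U0 x $ j" y] U0[of j]
    by (simp add: torus_L2_def torus_periodic_real_iff)
  then have "U0 (y, x + 2 * pi * a3) = U0 (y, x)" for x y by (simp add: vec_eq_iff)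
  then show ?thesis by (simp add: torus_periodic_real_iff horizontal_average_def)
qed

lemma average_measurable: "(\<lambda>x. average x $ i) \<in> borel_measurable lebesgue"
proof (rule periodic_borel_measurable[OF a3 average_periodic])
  let ?g = "\<lambda>x. indicat_real (torus_cell a3) x *\<^sub>R ((LINT y:cell_h|lebesgue. U0 (y, x) $ i) / (4 * pi\<^sup>2 * a1 * a2))"
  have "integrable lebesgue ?g"
    using set_integrable_divide[OF set_integrable_lebesgue_snd[OF U0_integrable]]
    unfolding set_integrable_def by blast
  then show "(\<lambda>x. indicat_real (torus_cell a3) x * average x $ i) \<in> borel_measurable lebesgue"
    by (rule borel_measurable_AE[OF borel_measurable_integrable])
       (use AE_average_nth[of i] in \<open>auto elim!: eventually_mono simp: indicator_def\<close>)
qed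

lemma average_L2: "(\<lambda>x. average x $ i) \<in> torus_L2 a3"
proof -
  let ?v = "4 * pi\<^sup>2 * a1 * a2"
  have v: "?v > 0" using a1 a2 by simp
  have sq: "set_integrable lebesgue (cell_h \<times> torus_cell a3) (\<lambda>x. (U0 x $ i)\<^sup>2)"
    using U0[of i] by (simp add: torus_L2_def torus_cell_Pair)
  have fin: "emeasure lebesgue cell_h < \<infinity>" 
    using emeasure_lborel_cbox_finite[of 0 "(2 * pi * a1, 2 * pi * a2)"] by (simp add: torus_cell_def)
  have "AE x in lebesgue. x \<in> torus_cell a3 \<longrightarrow> (average x $ i)\<^sup>2 \<le> (LINT y:cell_h|lebesgue. (U0 (y, x) $ i)\<^sup>2) / ?v"
    using AE_average_nth[of i] AE_set_integrable_section[OF U0_integrable[of i]] AE_set_integrable_section[OF sq]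
  proof eventually_elim
    case (elim x)
    show ?case
    proof
      assume x: "x \<in> torus_cell a3"
      have "(LINT y:cell_h|lebesgue. U0 (y, x) $ i)\<^sup>2 \<le> ?v * (LINT y:cell_h|lebesgue. (U0 (y, x) $ i)\<^sup>2)"
        using set_integral_power2_le[OF elim(2,3)[rule_format, OF x] sets_lebesgue_torus_cell fin] v
        unfolding measure_cell_h by blast
      moreover have "(J / v)\<^sup>2 \<le> K / v" if "J\<^sup>2 \<le> v * K" "v > 0" for J K v :: real
        using that by (simp add: power_divide field_simps power2_eq_square)
      ultimately show "(average x $ i)\<^sup>2 \<le> (LINT y:cell_h|lebesgue. (U0 (y, x) $ i)\<^sup>2) / ?v"
        using v unfolding elim(1)[rule_format, OF x] by blast
    qed
  qed
  then have le: "AE x in lebesgue. norm (indicat_real (torus_cell a3) x *\<^sub>R (average x $ i)\<^sup>2)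
      \<le> norm (indicat_real (torus_cell a3) x *\<^sub>R ((LINT y:cell_h|lebesgue. (U0 (y, x) $ i)\<^sup>2) / ?v))"
    by eventually_elim (auto simp: indicator_def simp del: abs_divide intro: order_trans[OF _ abs_ge_self])
  have "set_integrable lebesgue (torus_cell a3) (\<lambda>x. (average x $ i)\<^sup>2)"
    unfolding set_integrable_def
  proof (rule Bochner_Integration.integrable_bound[OF _ _ le])
    show "integrable lebesgue (\<lambda>x. indicat_real (torus_cell a3) x *\<^sub>R ((LINT y:cell_h|lebesgue. (U0 (y, x) $ i)\<^sup>2) / ?v))"
      using set_integrable_divide[OF set_integrable_lebesgue_snd[OF sq]]
      unfolding set_integrable_def by blast
    show "(\<lambda>x. indicat_real (torus_cell a3) x *\<^sub>R (average x $ i)\<^sup>2) \<in> borel_measurable lebesgue"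
      by (intro borel_measurable_scaleR borel_measurable_power average_measurable borel_measurable_indicator) simp
  qed
  then show ?thesis using average_periodic average_measurable by (simp add: torus_L2_def)
qed

text \<open>
Averaging is adjoint to extending a function of \<open>x\<^sub>3\<close> to the whole space, up to the area of the
horizontal cell.
\<close>

lemma integral_average_mult:
  assumes k: "continuous_on UNIV k" "\<And>x. \<bar>k x\<bar> \<le> B"
  shows "(LINT x:torus_cell a3|lebesgue. average x $ i * k x) =
    (LINT z:torus_cell ((a1, a2), a3)|lebesgue. U0 z $ i * k (snd z)) / (4 * pi\<^sup>2 * a1 * a2)"
proof -
  let ?v = "4 * pi\<^sup>2 * a1 * a2"
  have F: "set_integrable lebesgue (cell_h \<times> torus_cell a3) (\<lambda>z. U0 z $ i * k (snd z))"
  proof (rule set_integrable_mult_bounded[OF U0_integrable])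
    show "(\<lambda>z::(real \<times> real) \<times> real. k (snd z)) \<in> borel_measurable lebesgue"
      by (intro continuous_imp_lebesgue_measurable continuous_on_compose2[OF k(1)] continuous_intros) auto
  qed (use k(2) in auto)
  have m1: "(\<lambda>x. indicat_real (torus_cell a3) x *\<^sub>R (average x $ i * k x)) \<in> borel_measurable lebesgue"
    by (intro borel_measurable_scaleR borel_measurable_times average_measurable borel_measurable_indicator
        continuous_imp_lebesgue_measurable k) simp
  have m2: "(\<lambda>x. indicat_real (torus_cell a3) x *\<^sub>R ((LINT y:cell_h|lebesgue. U0 (y, x) $ i * k x) / ?v)) \<in> borel_measurable lebesgue"
    using set_integrable_divide[OF set_integrable_lebesgue_snd[OF F]]
    unfolding set_integrable_def by (intro borel_measurable_integrable) simp
  have "(LINT x:torus_cell a3|lebesgue. average x $ i * k x) =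
    (LINT x:torus_cell a3|lebesgue. (LINT y:cell_h|lebesgue. U0 (y, x) $ i * k x) / ?v)"
    unfolding set_lebesgue_integral_def[of lebesgue "torus_cell a3"]
    by (rule integral_cong_AE[OF m1 m2])
       (use AE_average_nth[of i] in \<open>auto elim!: eventually_mono simp: indicator_def\<close>)
  also have "\<dots> = (LINT x:torus_cell a3|lebesgue. LINT y:cell_h|lebesgue. U0 (y, x) $ i * k x) / ?v"
    by (rule set_integral_divide_zero)
  also have "(LINT x:torus_cell a3|lebesgue. LINT y:cell_h|lebesgue. U0 (y, x) $ i * k x) =
    (LINT z:cell_h \<times> torus_cell a3|lebesgue. U0 z $ i * k (snd z))"
    using set_integral_lebesgue_snd[OF F] by simp
  finally show ?thesis by (simp only: torus_cell_Pair)
qed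

lemma fourier_coeff_average:
  "fourier_coeff a3 (\<lambda>x. average x $ i) \<xi> = fourier_coeff ((a1, a2), a3) (\<lambda>x. U0 x $ i) ((0, 0), \<xi>)"
proof -
  have "(LINT x:torus_cell a3|lebesgue. average x $ i * cos (\<xi> \<bullet> x)) =
    (LINT z:torus_cell ((a1, a2), a3)|lebesgue. U0 z $ i * cos (((0, 0), \<xi>) \<bullet> z)) / (4 * pi\<^sup>2 * a1 * a2)"
    "(LINT x:torus_cell a3|lebesgue. average x $ i * sin (\<xi> \<bullet> x)) =
    (LINT z:torus_cell ((a1, a2), a3)|lebesgue. U0 z $ i * sin (((0, 0), \<xi>) \<bullet> z)) / (4 * pi\<^sup>2 * a1 * a2)"
    using integral_average_mult[where k="\<lambda>x. cos (\<xi> * x)" and B=1 and i=i] integral_average_mult[where k="\<lambda>x. sin (\<xi> * x)" and B=1 and i=i]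
    by (simp_all add: inner_prod_def continuous_intros)
  moreover have "measure lebesgue (torus_cell ((a1, a2), a3)) = (4 * pi\<^sup>2 * a1 * a2) * measure lebesgue (torus_cell a3)"
    by (subst measure_torus_cell_Pair) (simp add: measure_cell_h)
  moreover have "(complex_of_real (P / v) - \<i> * of_real (Q / v)) / of_real m = (of_real P - \<i> * of_real Q) / of_real (v * m)" for P Q v m
    by (simp add: diff_divide_distrib)
  ultimately show ?thesis
    unfolding fourier_coeff_cos_sin[OF torus_L2_integrable[OF average_L2]] fourier_coeff_cos_sin[OF torus_L2_integrable[OF U0]]
    by (simp only:)
qed

text \<open>
The frequencies of the average form the vertical axis among those of the datum.
\<close>

lemma Hs_norm_sq_average_le:
  "Hs_norm_sq a3 s (\<lambda>x. average x $ i) \<le> Hs_norm_sq ((a1, a2), a3) s (\<lambda>x. U0 x $ i)"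
proof -
  let ?j = "\<lambda>\<xi>. ((0, 0), \<xi>) :: (real \<times> real) \<times> real"
  let ?F = "\<lambda>\<zeta>. ennreal ((1 + (norm \<zeta>)\<^sup>2) powr s * (norm (fourier_coeff ((a1, a2), a3) (\<lambda>x. U0 x $ i) \<zeta>))\<^sup>2)"
  have sub: "?j ` torus_freqs a3 \<subseteq> torus_freqs ((a1, a2), a3)"
    by (auto simp: torus_freqs_Pair) (simp_all add: torus_freqs_def)
  have bij: "bij_betw ?j (torus_freqs a3) (?j ` torus_freqs a3)"
    by (auto simp: bij_betw_def inj_on_def)
  have ind: "(\<integral>\<^sup>+ \<zeta>. ?F \<zeta> \<partial>count_space X) = (\<integral>\<^sup>+ \<zeta>. ?F \<zeta> * indicator X \<zeta> \<partial>count_space UNIV)" for X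
    by (rule nn_integral_count_space_indicator) simp
  have "Hs_norm_sq a3 s (\<lambda>x. average x $ i) = (\<integral>\<^sup>+ \<xi>. ?F (?j \<xi>) \<partial>count_space (torus_freqs a3))"
    unfolding Hs_norm_sq_def by (simp add: fourier_coeff_average norm_Pair)
  also have "\<dots> = (\<integral>\<^sup>+ \<zeta>. ?F \<zeta> \<partial>count_space (?j ` torus_freqs a3))"
    by (rule nn_integral_bij_count_space[OF bij])
  also have "\<dots> \<le> (\<integral>\<^sup>+ \<zeta>. ?F \<zeta> \<partial>count_space (torus_freqs ((a1, a2), a3)))"
    unfolding ind[of "?j ` torus_freqs a3"] ind[of "torus_freqs ((a1, a2), a3)"]
    using sub by (intro nn_integral_mono) (auto simp: indicator_def)
  finally show ?thesis by (simp add: Hs_norm_sq_def)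
qed

end

lemma fourier_coeff_zero_mean:
  fixes U :: "'a::euclidean_space \<Rightarrow> real ^ 'n"
  assumes "\<And>i. (\<lambda>x. U x $ i) \<in> torus_L2 a" and "(LINT x:torus_cell a|lebesgue. U x) = 0"
  shows "fourier_coeff a (\<lambda>x. U x $ i) 0 = 0"
proof -
  have "(LINT x:torus_cell a|lebesgue. U x $ i) = 0"
    using set_integral_vec_nth[OF torus_L2_integrable[OF assms(1)], where i=i] assms(2) by simp
  then show ?thesis by (simp add: fourier_coeff_cos_sin[OF torus_L2_integrable[OF assms(1)]])
qed

text \<open>
A test function that depends on \<open>x\<^sub>3\<close> alone sees only the third component of the field.
\<close>

lemma divergence_free_fourier_coeff:
  fixes v1 v2 v3 :: "(real \<times> real) \<times> real \<Rightarrow> real"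
  assumes v3: "v3 \<in> torus_L2 a" and div: "divergence_free a (\<lambda>x. ((v1 x, v2 x), v3 x))"
    and \<xi>: "((0, 0), \<xi>) \<in> torus_freqs a" "\<xi> \<noteq> 0"
  shows "fourier_coeff a v3 ((0, 0), \<xi>) = 0"
proof -
  let ?q = "((0, 0), \<xi>) :: (real \<times> real) \<times> real"
  have key: "(LINT x:torus_cell a|lebesgue. v3 x * (\<beta> * cos (?q \<bullet> x) - \<alpha> * sin (?q \<bullet> x))) = 0" for \<alpha> \<beta>
  proof -
    define \<phi> where "\<phi> = (\<lambda>x. \<alpha> * cos (?q \<bullet> x) + \<beta> * sin (?q \<bullet> x))"
    have "C_infinity \<phi>" using C_infinity_exp_trig[of 0 \<alpha> ?q \<beta>] by (simp add: \<phi>_def)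
    moreover have "torus_periodic a \<phi>" unfolding \<phi>_def by (rule torus_periodic_trig[OF \<xi>(1)])
    ultimately have "(LINT x:torus_cell a|lebesgue. frechet_derivative \<phi> (at x) ((v1 x, v2 x), v3 x)) = 0"
      using div unfolding divergence_free_def by blast
    moreover have "frechet_derivative \<phi> (at x) = (\<lambda>h. (\<beta> * cos (?q \<bullet> x) - \<alpha> * sin (?q \<bullet> x)) * (?q \<bullet> h))" for x
    proof -
      have "((\<lambda>z. cos (?q \<bullet> z)) has_derivative (\<lambda>h. - sin (?q \<bullet> x) * (?q \<bullet> h))) (at x)"
        and "((\<lambda>z. sin (?q \<bullet> z)) has_derivative (\<lambda>h. cos (?q \<bullet> x) * (?q \<bullet> h))) (at x)"
        by (rule has_derivative_eq_rhs, (rule derivative_intros)+, simp add: fun_eq_iff)+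
      then have "(\<phi> has_derivative (\<lambda>h. \<alpha> * (- sin (?q \<bullet> x) * (?q \<bullet> h)) + \<beta> * (cos (?q \<bullet> x) * (?q \<bullet> h)))) (at x)"
        unfolding \<phi>_def by (intro has_derivative_add has_derivative_mult_right)
      from frechet_derivative_at[OF this] show ?thesis by (simp add: fun_eq_iff algebra_simps)
    qed
    ultimately have "(LINT x:torus_cell a|lebesgue. (\<beta> * cos (?q \<bullet> x) - \<alpha> * sin (?q \<bullet> x)) * (?q \<bullet> ((v1 x, v2 x), v3 x))) = 0"
      by (simp only:)
    moreover have "(\<beta> * cos (?q \<bullet> x) - \<alpha> * sin (?q \<bullet> x)) * (?q \<bullet> ((v1 x, v2 x), v3 x)) =
       \<xi> * (v3 x * (\<beta> * cos (?q \<bullet> x) - \<alpha> * sin (?q \<bullet> x)))" for x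
      by (simp add: inner_prod_def)
    ultimately have "\<xi> * (LINT x:torus_cell a|lebesgue. v3 x * (\<beta> * cos (?q \<bullet> x) - \<alpha> * sin (?q \<bullet> x))) = 0"
      by (simp only: set_integral_mult_right)
    then show ?thesis using \<xi>(2) by simp
  qed
  have "(LINT x:torus_cell a|lebesgue. v3 x * sin (?q \<bullet> x)) = 0"
    using key[of 0 "-1"] by (simp add: set_lebesgue_integral_def)
  moreover have "(LINT x:torus_cell a|lebesgue. v3 x * cos (?q \<bullet> x)) = 0"
    using key[of 1 0] by simp
  ultimately show ?thesis
    unfolding fourier_coeff_cos_sin[OF torus_L2_integrable[OF v3]] by simp
qed

section \<open>The limit system\<close>

theorem proposition6p1:
  fixes a1 a2 a3 \<nu> s :: real
    and U0 :: "(real \<times> real) \<times> real \<Rightarrow> real ^ 4"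
  assumes "a1 > 0" and "a2 > 0" and "a3 > 0" and "\<nu> > 0" and "s \<ge> 0"
    and "\<And>i. (\<lambda>x. U0 x $ i) \<in> Hs ((a1, a2), a3) s"
    and "(LINT x:torus_cell ((a1, a2), a3)|lebesgue. U0 x) = 0"
    and "divergence_free ((a1, a2), a3) (\<lambda>x. ((U0 x $ 1, U0 x $ 2), U0 x $ 3))"
  shows "(AE x3 in lebesgue. horizontal_average a1 a2 U0 x3 $ 3 = 0) \<and>
    (\<exists>U. averaged_system_solution a3 \<nu> (horizontal_average a1 a2 U0) U \<and>
       (\<forall>i\<in>{1, 2}. (\<lambda>t x3. U t x3 $ i) \<in> C_Hs a3 s \<inter> L2_Hs a3 (s + 1)) \<and>
       (\<lambda>t x3. U t x3 $ 4) \<in> C_Hs a3 s \<and>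
       (\<forall>V. averaged_system_solution a3 \<nu> (horizontal_average a1 a2 U0) V \<longrightarrow>
          (\<forall>t\<ge>0. AE x3 in lebesgue. V t x3 = U t x3)))"
proof (intro conjI exI allI impI)
  note a3 = \<open>a3 > 0\<close> and \<nu> = \<open>\<nu> > 0\<close>
  have L2: "(\<lambda>x. U0 x $ i) \<in> torus_L2 ((a1, a2), a3)" and fin: "Hs_norm_sq ((a1, a2), a3) s (\<lambda>x. U0 x $ i) < \<infinity>" for i
    using assms(6)[of i] by (auto simp: Hs_def)
  define W where "W = horizontal_average a1 a2 U0"
  define w where "w i x = W x $ i" for i x
  have wL2: "w i \<in> torus_L2 a3" for i
    using average_L2[OF assms(1-3) L2, of i] by (simp add: w_def[abs_def] W_def)
  have w_coeff: "fourier_coeff a3 (w i) \<xi> = fourier_coeff ((a1, a2), a3) (\<lambda>x. U0 x $ i) ((0, 0), \<xi>)" for i \<xi>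
    using fourier_coeff_average[OF assms(1-3) L2, of i] by (simp add: w_def[abs_def] W_def)
  have w_fin: "Hs_norm_sq a3 s (w i) < \<infinity>" for i
    using Hs_norm_sq_average_le[OF assms(1-3) L2, of s i] fin[of i] by (simp add: w_def[abs_def] W_def)
  \<comment> \<open>solutions are only required to be continuous in \<open>L\<^sup>2 = H\<^sup>0\<close>\<close>
  have w_fin0: "Hs_norm_sq a3 0 (w i) < \<infinity>" for i
    using Hs_norm_sq_mono[OF \<open>s \<ge> 0\<close>, of a3 "w i"] w_fin[of i] by (rule le_less_trans)
  have w_mean: "fourier_coeff a3 (w i) 0 = 0" for i
    using fourier_coeff_zero_mean[OF L2 assms(7), of i] by (simp add: w_coeff zero_prod_def)
  have w3_coeff: "fourier_coeff a3 (w 3) \<xi> = 0" if \<xi>: "\<xi> \<in> torus_freqs a3" for \<xi>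
  proof (cases "\<xi> = 0")
    case False
    have "((0, 0), \<xi>) \<in> torus_freqs ((a1, a2), a3)"
      using \<xi> by (simp add: torus_freqs_Pair) (simp add: torus_freqs_def)
    then show ?thesis
      unfolding w_coeff using divergence_free_fourier_coeff[OF L2 assms(8)] False by blast
  qed (simp add: w_mean)
  have zero: "(\<lambda>x::real. 0) \<in> torus_L2 a3"
    by (simp add: torus_L2_def torus_periodic_def set_integrable_def)
  have "AE x in lebesgue. w 3 x = 0"
  proof (rule torus_L2_fourier_coeff_eq_imp_AE_eq[OF a3 wL2 zero])
    have "fourier_coeff a3 (\<lambda>x. 0) \<xi> = 0" for \<xi>
      by (simp add: fourier_coeff_def set_lebesgue_integral_def)
    then show "fourier_coeff a3 (w 3) \<xi> = fourier_coeff a3 (\<lambda>x. 0) \<xi>" if "\<xi> \<in> torus_freqs a3" for \<xi>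
      using w3_coeff[OF that] by simp
  qed
  then show "AE x3 in lebesgue. horizontal_average a1 a2 U0 x3 $ 3 = 0"
    by (simp add: w_def W_def)
  define u :: "real \<Rightarrow> real \<Rightarrow> real ^ 4" where
    "u t x = (\<chi> i. if i = 3 then 0 else if i = 4 then w 4 x else heat_flow a3 \<nu> (w i) t x)" for t x
  have u_nth: "(\<lambda>t x. u t x $ i) = heat_flow a3 \<nu> (w i)" if "i \<in> {1, 2}" for i
    using that by (auto simp: u_def fun_eq_iff)
  have u4: "(\<lambda>t x. u t x $ 4) = (\<lambda>t. w 4)" by (auto simp: u_def fun_eq_iff)
  have w0: "heat_flow a3 \<nu> (w i) 0 = w i" for i by (simp add: heat_flow_def)
  have sol: "averaged_system_solution a3 \<nu> W u"
    unfolding averaged_system_solution_def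
  proof (intro conjI ballI allI impI)
    fix i :: 4 assume i: "i \<in> {1, 2}"
    show "(\<lambda>t x3. u t x3 $ i) \<in> C_Hs a3 0"
      unfolding u_nth[OF i] by (rule heat_flow_C_Hs[OF a3 \<nu> wL2 w_fin0])
    show "weak_heat_solution a3 \<nu> (\<lambda>t x3. u t x3 $ i)"
      unfolding u_nth[OF i] by (rule weak_heat_solution_heat_flow[OF a3 \<nu> wL2])
    show "AE x3 in lebesgue. u 0 x3 $ i = W x3 $ i"
      using fun_cong[OF fun_cong[OF u_nth[OF i]], of 0] by (simp add: w0 w_def)
  qed (simp_all add: u_def w_def)
  then show "averaged_system_solution a3 \<nu> (horizontal_average a1 a2 U0) u" by (simp add: W_def)
  show "\<forall>i\<in>{1, 2}. (\<lambda>t x3. u t x3 $ i) \<in> C_Hs a3 s \<inter> L2_Hs a3 (s + 1)"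
    using heat_flow_C_Hs[OF a3 \<nu> wL2 w_fin] heat_flow_L2_Hs[OF a3 \<nu> wL2 w_fin w_mean] u_nth by auto
  show "(\<lambda>t x3. u t x3 $ 4) \<in> C_Hs a3 s"
    unfolding u4 C_Hs_def using wL2 w_fin
    by (auto simp: Hs_def Hs_norm_sq_def fourier_coeff_def set_lebesgue_integral_def)
  fix V t
  assume "averaged_system_solution a3 \<nu> (horizontal_average a1 a2 U0) V" and t: "0 \<le> (t::real)"
  then have V: "averaged_system_solution a3 \<nu> W V" by (simp add: W_def)
  have horizontal: "AE x in lebesgue. V t x $ i = u t x $ i" if i: "i \<in> {1, 2}" for i
  proof -
    let ?v = "\<lambda>t x. V t x $ i"
    have C: "?v \<in> C_Hs a3 0" and weak: "weak_heat_solution a3 \<nu> ?v" and init: "AE x in lebesgue. ?v 0 x = w i x"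
      using V i unfolding averaged_system_solution_def w_def by auto
    have vL2: "?v r \<in> torus_L2 a3" if "r \<ge> 0" for r using C that by (simp add: C_Hs_def Hs_def)
    have "AE x in lebesgue. ?v t x = heat_flow a3 \<nu> (w i) t x"
    proof (rule torus_L2_fourier_coeff_eq_imp_AE_eq[OF a3 vL2[OF t] heat_flow_L2[OF a3 \<nu> wL2]])
      fix \<xi> assume \<xi>: "\<xi> \<in> torus_freqs a3"
      show "fourier_coeff a3 (?v t) \<xi> = fourier_coeff a3 (heat_flow a3 \<nu> (w i) t) \<xi>"
        using weak_heat_solution_fourier_coeff[OF a3 \<xi> weak vL2 t]
          fourier_coeff_cong_AE[OF vL2[OF order_refl] wL2 init] fourier_coeff_heat_flow[OF a3 \<nu> wL2 t \<xi>]
        by simp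
    qed
    moreover have "u t x $ i = heat_flow a3 \<nu> (w i) t x" for x
      using fun_cong[OF fun_cong[OF u_nth[OF i], of t], of x] by simp
    ultimately show ?thesis by (simp only:)
  qed
  have "AE x in lebesgue. V t x $ 3 = 0" "AE x in lebesgue. V t x $ 4 = W x $ 4"
    using V t unfolding averaged_system_solution_def by auto
  moreover have "AE x in lebesgue. V t x $ 1 = u t x $ 1" "AE x in lebesgue. V t x $ 2 = u t x $ 2"
    by (intro horizontal; simp)+
  ultimately show "AE x3 in lebesgue. V t x3 = u t x3"
  proof eventually_elim
    case (elim x)
    then show ?case by (auto simp: vec_eq_iff forall_4 u_def w_def)
  qed
qed

end
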